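(* Let $\mathscr C$ be a non-empty set of finite non-empty sets, each equipped with a fixed total order, let $\mathcal T=\mathcal T(\mathscr C)$ be the transformation category over $\mathscr C$, and let $\mathcal Q$ be one of the subcategories $\mathscr P^+(\mathcal T)$, $\mathscr P^\pm(\mathcal T)$, $\mathscr A^+(\mathcal T)$, $\mathscr A^\pm(\mathcal T)$ (order-preserving; order-preserving or order-reversing; orientation-preserving; orientation-preserving or orientation-reversing maps). Let $\xi$ be the least cardinal strictly greater than $|A|$ for every $A\in\mathscr C$, let $I_r=\{\alpha\in\mathcal Q:\operatorname{rank}(\alpha)\le r\}$ for $1\le r<\xi$, with $I_\omega=\mathcal Q$ if $\xi=\omega$, and for each $1\le q<\xi$ let $\mathcal G_q$ be a group $\mathscr H$-class of $\mathcal Q$ contained in $D_q=\{\alpha\in\mathcal Q:\operatorname{rank}(\alpha)=q\}$. (i) The minimal ideal $I_1$ is (isomorphic to) a partial rectangular band, so its congruences are precisely those corresponding to the relations $\sigma_{\mathcal E_1,\mathcal E_2}$ described in the context. In particular, there is a lattice isomorphism $\operatorname{Cong}(I_1)\cong\prod_{A\in\mathscr C}\mathfrak{Eq}(A)$. (ii) For $r\ge2$ (i.e. $2\le r<\xi$, and also $r=\omega$ if $\xi=\omega$), $$\operatorname{Cong}(I_r)=\{\Delta_{I_r}\}\cup\{R^{I_r}_{I_q,N}:1\le q<r,\ N\unlhd\mathcal G_{q+1}\}\cup\{\widetilde\nabla_{I_r}\}.$$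
   Context: **Categories.** Morphisms of $\mathcal T$ are triples $(A,\alpha,B)$ with $A,B\in\mathscr C$ and $\alpha:A\to B$ a function; $\mathbf d(A,\alpha,B)=A$, $\mathbf r(A,\alpha,B)=B$, $(A,\alpha,B)(B,\beta,C)=(A,\alpha\beta,C)$ (first $\alpha$, then $\beta$). $\operatorname{rank}(\alpha)=|\operatorname{im}(\alpha)|$. For $A=\{a_1<\cdots<a_k\}$, $\alpha:A\to B$ is order-preserving if $a_1\alpha\le\cdots\le a_k\alpha$; order-reversing if $a_1\alpha\ge\cdots\ge a_k\alpha$; orientation-preserving if $a_i\alpha\le\cdots\le a_k\alpha\le a_1\alpha\le\cdots\le a_{i-1}\alpha$ for some $1\le i\le k$; orientation-reversing if the same holds with $\ge$ for some $i$. $\mathcal Q$ is a stable, regular category whose $\mathscr J=\mathscr D$-classes are the $D_q$, $1\le q<\xi$. $\mathfrak{Eq}(A)$ is the lattice of equivalence relations on $A$. **Congruences.** For a partial semigroup (category without necessarily having identities) $S$ with domain/range maps $\mathbf d,\mathbf r$, write $x\sim y$ if $\mathbf d(x)=\mathbf d(y)$ and $\mathbf r(x)=\mathbf r(y)$. A congruence on $S$ is an equivalence $\sigma$ such that $(x,y)\in\sigma$ implies $x\sim y$, and $\sigma$ is compatible with all defined left and right multiplications by elements of $S$. $\operatorname{Cong}(S)$ is the lattice of congruences under inclusion. $\Delta_S$ is equality, $\widetilde\nabla_S=\{(x,y):x\sim y\}$. For an ideal $I$ of $S$ (non-empty, closed under defined multiplication by elements of $S$ on either side), $R_I^S=\widetilde\nabla_I\cup\Delta_S$.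 Green's relations: $x\mathrel{\mathscr R}y\Leftrightarrow xS^1=yS^1$, $x\mathrel{\mathscr L}y\Leftrightarrow S^1x=S^1y$, $x\mathrel{\mathscr J}y\Leftrightarrow S^1xS^1=S^1yS^1$, $\mathscr H=\mathscr R\cap\mathscr L$, where $S^1$ is $S$ with identities adjoined where needed. For $N$ a normal subgroup of a group $\mathscr H$-class contained in a (stable, regular) $\mathscr J$-class $D$ of $S$ that is minimal among the $\mathscr J$-classes in $S\setminus I$, $\nu_N=\{(axb,ayb):x,y\in N,\ a,b\in S^1,\ axb,ayb\in D\}$ and $R^S_{I,N}=R_I^S\cup\nu_N$. **Partial rectangular bands.** Given non-empty sets $X_A,Y_A$ ($A\in\mathscr C$), the $X_A$ pairwise disjoint and the $Y_A$ pairwise disjoint, the partial rectangular band is $\bigcup_{A,B\in\mathscr C}X_A\times Y_B$ with $\mathbf d(x,y)=A$, $\mathbf r(x,y)=B$ for $x\in X_A,y\in Y_B$, and $(x_1,y_1)(x_2,y_2)=(x_1,y_2)$ when $\mathbf r(x_1,y_1)=\mathbf d(x_2,y_2)$. For tuples $\mathcal E_1=(\varepsilon^A_1)_A$, $\mathcal E_2=(\varepsilon_2^A)_A$ with $\varepsilon_1^A\in\mathfrak{Eq}(X_A)$, $\varepsilon_2^A\in\mathfrak{Eq}(Y_A)$, $\sigma_{\mathcal E_1,\mathcal E_2}$ relates $(x_1,y_1)$ and $(x_2,y_2)$ iff both lie in a common $X_A\times Y_B$ and $(x_1,x_2)\in\varepsilon_1^A$, $(y_1,y_2)\in\varepsilon_2^B$.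 Isomorphisms are over $\mathscr C$ (preserving $\mathbf d$, $\mathbf r$). *)

theory Defs
  imports
    "HOL-Library.Extended_Nat"
    "HOL-Library.FuncSet"
    "HOL-Library.Disjoint_Sets"
    "HOL-Algebra.Coset"
    "HOL-Algebra.Lattice"
begin

section \<open>Partial semigroups\<close>

text \<open>
  The field \<open>pmult\<close> is a total function, but \<open>pmult S x y\<close> is meaningful only for
  \<open>x, y \<in> carrier S\<close> with \<open>rng_of S x = dom_of S y\<close>; every definition below is guarded accordingly.
  Products are written left to right.
\<close>

record ('m, 'o) psemigroup = "'m partial_object" +
  dom_of :: "'m \<Rightarrow> 'o"
  rng_of :: "'m \<Rightarrow> 'o"
  pmult :: "'m \<Rightarrow> 'm \<Rightarrow> 'm"

abbreviation restrict_to :: "('m, 'o) psemigroup \<Rightarrow> 'm set \<Rightarrow> ('m, 'o) psemigroup" where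
  "restrict_to S I \<equiv> S\<lparr>carrier := I\<rparr>"

definition composable :: "('m, 'o) psemigroup \<Rightarrow> 'm \<Rightarrow> 'm \<Rightarrow> bool" where
  "composable S x y \<longleftrightarrow> x \<in> carrier S \<and> y \<in> carrier S \<and> rng_of S x = dom_of S y"

definition parallel :: "('m, 'o) psemigroup \<Rightarrow> 'm \<Rightarrow> 'm \<Rightarrow> bool" where
  "parallel S x y \<longleftrightarrow> dom_of S x = dom_of S y \<and> rng_of S x = rng_of S y"

definition is_ideal :: "('m, 'o) psemigroup \<Rightarrow> 'm set \<Rightarrow> bool" where
  "is_ideal S I \<longleftrightarrow> I \<noteq> {} \<and> I \<subseteq> carrier S \<and>
     (\<forall>x\<in>I. \<forall>a\<in>carrier S.
        (composable S a x \<longrightarrow> pmult S a x \<in> I) \<and>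
        (composable S x a \<longrightarrow> pmult S x a \<in> I))"

definition minimal_ideal :: "('m, 'o) psemigroup \<Rightarrow> 'm set \<Rightarrow> bool" where
  "minimal_ideal S I \<longleftrightarrow> is_ideal S I \<and> (\<forall>J. is_ideal S J \<and> J \<subseteq> I \<longrightarrow> J = I)"

definition psemigroup_iso ::
    "('m, 'o) psemigroup \<Rightarrow> ('n, 'o) psemigroup \<Rightarrow> ('m \<Rightarrow> 'n) \<Rightarrow> bool" where
  "psemigroup_iso S T \<phi> \<longleftrightarrow> bij_betw \<phi> (carrier S) (carrier T) \<and>
     (\<forall>x\<in>carrier S. dom_of T (\<phi> x) = dom_of S x \<and> rng_of T (\<phi> x) = rng_of S x) \<and>
     (\<forall>x y. composable S x y \<longrightarrow> \<phi> (pmult S x y) = pmult T (\<phi> x) (\<phi> y))"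

subsection \<open>Congruences\<close>

definition Cong :: "('m, 'o) psemigroup \<Rightarrow> 'm rel set" where
  "Cong S = {\<sigma>. equiv (carrier S) \<sigma> \<and>
     (\<forall>(x, y)\<in>\<sigma>. parallel S x y \<and>
        (\<forall>a\<in>carrier S.
           (composable S a x \<longrightarrow> (pmult S a x, pmult S a y) \<in> \<sigma>) \<and>
           (composable S x a \<longrightarrow> (pmult S x a, pmult S y a) \<in> \<sigma>)))}"

definition diag_cong :: "('m, 'o) psemigroup \<Rightarrow> 'm rel" where
  "diag_cong S = Id_on (carrier S)"

definition univ_cong :: "('m, 'o) psemigroup \<Rightarrow> 'm rel" where
  "univ_cong S = {(x, y). x \<in> carrier S \<and> y \<in> carrier S \<and> parallel S x y}"

definition rees_cong :: "('m, 'o) psemigroup \<Rightarrow> 'm set \<Rightarrow> 'm rel" where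
  "rees_cong S I = univ_cong (restrict_to S I) \<union> diag_cong S"

subsection \<open>Green's relations and group classes\<close>

text \<open>
  In \<open>'m option\<close>, \<open>None\<close> acts as an adjoined identity at every object. Since an adjoined
  identity acts in the same way as one already present in \<open>S\<close>, products with factors in
  \<open>S\<^sup>1\<close> are the same as if identities were adjoined only where they are missing.
\<close>

definition carrier1 :: "('m, 'o) psemigroup \<Rightarrow> 'm option set" where
  "carrier1 S = insert None (Some ` carrier S)"

fun composable_l :: "('m, 'o) psemigroup \<Rightarrow> 'm option \<Rightarrow> 'm \<Rightarrow> bool" where
  "composable_l S None x \<longleftrightarrow> x \<in> carrier S"
| "composable_l S (Some a) x \<longleftrightarrow> composable S a x"

fun composable_r :: "('m, 'o) psemigroup \<Rightarrow> 'm \<Rightarrow> 'm option \<Rightarrow> bool" where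
  "composable_r S x None \<longleftrightarrow> x \<in> carrier S"
| "composable_r S x (Some b) \<longleftrightarrow> composable S x b"

fun mult_l :: "('m, 'o) psemigroup \<Rightarrow> 'm option \<Rightarrow> 'm \<Rightarrow> 'm" where
  "mult_l S None x = x"
| "mult_l S (Some a) x = pmult S a x"

fun mult_r :: "('m, 'o) psemigroup \<Rightarrow> 'm \<Rightarrow> 'm option \<Rightarrow> 'm" where
  "mult_r S x None = x"
| "mult_r S x (Some b) = pmult S x b"

definition greenR :: "('m, 'o) psemigroup \<Rightarrow> 'm rel" where
  "greenR S = {(x, y). x \<in> carrier S \<and> y \<in> carrier S \<and>
     {mult_r S x b | b. b \<in> carrier1 S \<and> composable_r S x b} =
     {mult_r S y b | b. b \<in> carrier1 S \<and> composable_r S y b}}"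

definition greenL :: "('m, 'o) psemigroup \<Rightarrow> 'm rel" where
  "greenL S = {(x, y). x \<in> carrier S \<and> y \<in> carrier S \<and>
     {mult_l S a x | a. a \<in> carrier1 S \<and> composable_l S a x} =
     {mult_l S a y | a. a \<in> carrier1 S \<and> composable_l S a y}}"

definition greenH :: "('m, 'o) psemigroup \<Rightarrow> 'm rel" where
  "greenH S = greenR S \<inter> greenL S"

definition class_group :: "('m, 'o) psemigroup \<Rightarrow> 'm set \<Rightarrow> 'm monoid" where
  "class_group S H = \<lparr>carrier = H, mult = pmult S,
     one = (THE e. e \<in> H \<and> (\<forall>x\<in>H. pmult S e x = x \<and> pmult S x e = x))\<rparr>"

definition group_H_class :: "('m, 'o) psemigroup \<Rightarrow> 'm set \<Rightarrow> bool" where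
  "group_H_class S H \<longleftrightarrow> H \<in> carrier S // greenH S \<and>
     (\<forall>x\<in>H. \<forall>y\<in>H. composable S x y) \<and> group (class_group S H)"

definition nu :: "('m, 'o) psemigroup \<Rightarrow> 'm set \<Rightarrow> 'm set \<Rightarrow> 'm rel" where
  "nu S D N = {(mult_r S (mult_l S a x) b, mult_r S (mult_l S a y) b) | x y a b.
     x \<in> N \<and> y \<in> N \<and> a \<in> carrier1 S \<and> b \<in> carrier1 S \<and>
     composable_l S a x \<and> composable_r S (mult_l S a x) b \<and>
     composable_l S a y \<and> composable_r S (mult_l S a y) b \<and>
     mult_r S (mult_l S a x) b \<in> D \<and> mult_r S (mult_l S a y) b \<in> D}"

text \<open>
  Here \<open>D\<close> is the \<open>\<J>\<close>-class of \<open>S\<close> containing \<open>N\<close>, minimal among those outside \<open>I\<close>.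
\<close>

definition rees_nu_cong ::
    "('m, 'o) psemigroup \<Rightarrow> 'm set \<Rightarrow> 'm set \<Rightarrow> 'm set \<Rightarrow> 'm rel" where
  "rees_nu_cong S I D N = rees_cong S I \<union> nu S D N"

section \<open>Lattices of congruences and of equivalences\<close>

definition cong_lattice :: "('m, 'o) psemigroup \<Rightarrow> 'm rel gorder" where
  "cong_lattice S = \<lparr>carrier = Cong S, eq = (=), le = (\<subseteq>)\<rparr>"

definition Eq :: "'a set \<Rightarrow> 'a rel set" where
  "Eq A = {\<epsilon>. equiv A \<epsilon>}"

definition prod_Eq_lattice :: "'a set set \<Rightarrow> ('a set \<Rightarrow> 'a rel) gorder" where
  "prod_Eq_lattice C = \<lparr>carrier = (\<Pi>\<^sub>E A\<in>C. Eq A), eq = (=),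
     le = (\<lambda>f g. \<forall>A\<in>C. f A \<subseteq> g A)\<rparr>"

definition lattice_isomorphic :: "'x gorder \<Rightarrow> 'y gorder \<Rightarrow> bool" where
  "lattice_isomorphic L M \<longleftrightarrow>
     (\<exists>\<Phi>. bij_betw \<Phi> (carrier L) (carrier M) \<and> join_pres L M \<Phi> \<and> meet_pres L M \<Phi>)"

section \<open>Partial rectangular bands\<close>

definition band_data :: "'o set \<Rightarrow> ('o \<Rightarrow> 'x set) \<Rightarrow> ('o \<Rightarrow> 'y set) \<Rightarrow> bool" where
  "band_data C X Y \<longleftrightarrow> (\<forall>A\<in>C. X A \<noteq> {} \<and> Y A \<noteq> {}) \<and>
     disjoint_family_on X C \<and> disjoint_family_on Y C"

definition partial_rect_band ::
    "'o set \<Rightarrow> ('o \<Rightarrow> 'x set) \<Rightarrow> ('o \<Rightarrow> 'y set) \<Rightarrow> ('x \<times> 'y, 'o) psemigroup" where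
  "partial_rect_band C X Y = \<lparr>carrier = (\<Union>A\<in>C. \<Union>B\<in>C. X A \<times> Y B),
     dom_of = (\<lambda>(x, y). THE A. A \<in> C \<and> x \<in> X A),
     rng_of = (\<lambda>(x, y). THE B. B \<in> C \<and> y \<in> Y B),
     pmult = (\<lambda>(x1, y1) (x2, y2). (x1, y2))\<rparr>"

definition band_cong ::
    "'o set \<Rightarrow> ('o \<Rightarrow> 'x set) \<Rightarrow> ('o \<Rightarrow> 'y set) \<Rightarrow>
     ('o \<Rightarrow> 'x rel) \<Rightarrow> ('o \<Rightarrow> 'y rel) \<Rightarrow> ('x \<times> 'y) rel" where
  "band_cong C X Y E1 E2 = {((x1, y1), (x2, y2)). \<exists>A\<in>C. \<exists>B\<in>C.
     (x1, y1) \<in> X A \<times> Y B \<and> (x2, y2) \<in> X A \<times> Y B \<and>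
     (x1, x2) \<in> E1 A \<and> (y1, y2) \<in> E2 B}"

definition pullback_rel :: "'m set \<Rightarrow> ('m \<Rightarrow> 'n) \<Rightarrow> 'n rel \<Rightarrow> 'm rel" where
  "pullback_rel M \<phi> \<sigma> = {(x, y). x \<in> M \<and> y \<in> M \<and> (\<phi> x, \<phi> y) \<in> \<sigma>}"

section \<open>Transformation categories\<close>

text \<open>Functions \<open>A \<rightarrow> B\<close> are extensional, so that distinct triples are distinct morphisms.\<close>

type_synonym 'a morphism = "'a set \<times> ('a \<Rightarrow> 'a) \<times> 'a set"

definition trans_cat :: "'a set set \<Rightarrow> ('a morphism, 'a set) psemigroup" where
  "trans_cat C = \<lparr>carrier = {(A, \<alpha>, B). A \<in> C \<and> B \<in> C \<and> \<alpha> \<in> A \<rightarrow>\<^sub>E B},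
     dom_of = (\<lambda>(A, \<alpha>, B). A),
     rng_of = (\<lambda>(A, \<alpha>, B). B),
     pmult = (\<lambda>(A, \<alpha>, B) (B', \<beta>, D). (A, compose A \<beta> \<alpha>, D))\<rparr>"

fun rank :: "'a morphism \<Rightarrow> nat" where
  "rank (A, \<alpha>, B) = card (\<alpha> ` A)"

text \<open>
  \<open>ord A\<close> is the (reflexive) total order fixed on the finite set \<open>A\<close>, and
  \<open>enumeration ord A\<close> is the list \<open>[a\<^sub>1, \<dots>, a\<^sub>k]\<close> with \<open>A = {a\<^sub>1 < \<dots> < a\<^sub>k}\<close>.
  Rotating this list by \<open>j\<close> gives \<open>[a\<^sub>i, \<dots>, a\<^sub>k, a\<^sub>1, \<dots>, a\<^bsub>i-1\<^esub>]\<close> with \<open>i = j + 1\<close>.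
\<close>

definition enumeration :: "('a set \<Rightarrow> 'a rel) \<Rightarrow> 'a set \<Rightarrow> 'a list" where
  "enumeration ord A =
     (THE xs. set xs = A \<and> distinct xs \<and> sorted_wrt (\<lambda>x y. (x, y) \<in> ord A) xs)"

fun order_preserving :: "('a set \<Rightarrow> 'a rel) \<Rightarrow> 'a morphism \<Rightarrow> bool" where
  "order_preserving ord (A, \<alpha>, B) \<longleftrightarrow>
     sorted_wrt (\<lambda>x y. (x, y) \<in> ord B) (map \<alpha> (enumeration ord A))"

fun order_reversing :: "('a set \<Rightarrow> 'a rel) \<Rightarrow> 'a morphism \<Rightarrow> bool" where
  "order_reversing ord (A, \<alpha>, B) \<longleftrightarrow>
     sorted_wrt (\<lambda>x y. (y, x) \<in> ord B) (map \<alpha> (enumeration ord A))"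

fun orientation_preserving :: "('a set \<Rightarrow> 'a rel) \<Rightarrow> 'a morphism \<Rightarrow> bool" where
  "orientation_preserving ord (A, \<alpha>, B) \<longleftrightarrow>
     (\<exists>j<card A. sorted_wrt (\<lambda>x y. (x, y) \<in> ord B) (map \<alpha> (rotate j (enumeration ord A))))"

fun orientation_reversing :: "('a set \<Rightarrow> 'a rel) \<Rightarrow> 'a morphism \<Rightarrow> bool" where
  "orientation_reversing ord (A, \<alpha>, B) \<longleftrightarrow>
     (\<exists>j<card A. sorted_wrt (\<lambda>x y. (y, x) \<in> ord B) (map \<alpha> (rotate j (enumeration ord A))))"

definition P_plus :: "'a set set \<Rightarrow> ('a set \<Rightarrow> 'a rel) \<Rightarrow> ('a morphism, 'a set) psemigroup" where
  "P_plus C ord = restrict_to (trans_cat C)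
     {\<alpha> \<in> carrier (trans_cat C). order_preserving ord \<alpha>}"

definition P_pm :: "'a set set \<Rightarrow> ('a set \<Rightarrow> 'a rel) \<Rightarrow> ('a morphism, 'a set) psemigroup" where
  "P_pm C ord = restrict_to (trans_cat C)
     {\<alpha> \<in> carrier (trans_cat C). order_preserving ord \<alpha> \<or> order_reversing ord \<alpha>}"

definition A_plus :: "'a set set \<Rightarrow> ('a set \<Rightarrow> 'a rel) \<Rightarrow> ('a morphism, 'a set) psemigroup" where
  "A_plus C ord = restrict_to (trans_cat C)
     {\<alpha> \<in> carrier (trans_cat C). orientation_preserving ord \<alpha>}"

definition A_pm :: "'a set set \<Rightarrow> ('a set \<Rightarrow> 'a rel) \<Rightarrow> ('a morphism, 'a set) psemigroup" where
  "A_pm C ord = restrict_to (trans_cat C)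
     {\<alpha> \<in> carrier (trans_cat C). orientation_preserving ord \<alpha> \<or> orientation_reversing ord \<alpha>}"

text \<open>
  As all members of \<open>C\<close> are finite, the least cardinal above all of their sizes is a natural
  number or \<open>\<omega>\<close>; the latter is represented by \<open>\<infinity> :: enat\<close>.
\<close>

definition xi :: "'a set set \<Rightarrow> enat" where
  "xi C = (LEAST k. \<forall>A\<in>C. enat (card A) < k)"

definition rank_class :: "('a morphism, 'a set) psemigroup \<Rightarrow> nat \<Rightarrow> 'a morphism set" where
  "rank_class Q q = {\<alpha> \<in> carrier Q. rank \<alpha> = q}"

text \<open>Note that \<open>rank_ideal Q \<infinity>\<close> is the whole of \<open>Q\<close>.\<close>

definition rank_ideal :: "('a morphism, 'a set) psemigroup \<Rightarrow> enat \<Rightarrow> 'a morphism set" where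
  "rank_ideal Q r = {\<alpha> \<in> carrier Q. enat (rank \<alpha>) \<le> r}"

abbreviation rank_psemigroup ::
    "('a morphism, 'a set) psemigroup \<Rightarrow> enat \<Rightarrow> ('a morphism, 'a set) psemigroup" where
  "rank_psemigroup Q r \<equiv> restrict_to Q (rank_ideal Q r)"

end

theory Submission
  imports Defs
begin

text \<open>
  All four categories contain the order-preserving maps, are closed under composition and are regular,
  and nothing else about them is needed. Regularity gives factorizations through kernels and images,
  so Green's relations are read off from kernels and images, and any \<open>y\<close> with \<open>rank y \<le> rank x\<close> is of
  the form \<open>a x b\<close>.

  Let \<open>\<sigma>\<close> be a congruence on \<open>I\<^sub>r\<close> containing a pair \<open>(x, y)\<close> with \<open>x \<noteq> y\<close> and \<open>rank y \<le> rank x = q\<close>,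
  where \<open>q \<ge> 2\<close>. If the ranks are equal but \<open>x\<close> and \<open>y\<close> are not \<open>\<H>\<close>-related, then composing with an
  order-preserving map on the left (different kernels) or on the right (different images) lowers the
  rank of exactly one of them; and once \<open>rank y < rank x = q\<close>, the factorization shows that \<open>\<sigma>\<close> identifies all parallel elements of \<open>I\<^sub>q\<close>. If they are \<open>\<H>\<close>-related, then deleting one point of
  a transversal gives a pair of rank \<open>q - 1\<close> with different images, so \<open>\<sigma>\<close> identifies all parallel
  elements of \<open>I\<^bsub>q-1\<^esub>\<close>. Hence, if \<open>q\<close> is maximal such that \<open>\<sigma>\<close> identifies all parallel elements
  of \<open>I\<^sub>q\<close>, then above \<open>I\<^sub>q\<close> the congruence relates only \<open>\<H>\<close>-related elements of rank \<open>q + 1\<close>, and these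
  are governed by the normal subgroup of all \<open>n\<close> related to the identity of the group \<open>\<H>\<close>-class.
\<close>

section \<open>Monotone maps between finite linear orders\<close>

text \<open>All multipliers must lie in I_r, so the factorizations used later come with rank bounds
  on their factors. Lowering the rank of just one of two maps is easy on the left: every nonempty
  subset of A is the image of an order-preserving map of A, so a transversal may be prescribed. On
  the right it is the main obstacle: fibres of an order-preserving map are convex, so points of an
  image cannot be merged at will. Rounding up to one image or down to the other still separates
  them, but it is the position of the images that decides which one shrinks. This suffices, because
  congruences are symmetric. The bound 2 <= r matters because a map of rank 2 sends two distinct
  points to two distinct points, which makes one nontrivial pair generate all pairs of constants. In
  I_1 only constants remain: right multiplication forgets its left factor and left multiplication
  only changes the domain. So independent equivalences on the codomains survive, while the kernel
  coordinate is a single point for each domain; this is why the product has only one factor per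
  object.\<close>

definition mono_rel :: "'a set \<Rightarrow> 'a rel \<Rightarrow> 'b rel \<Rightarrow> ('a \<Rightarrow> 'b) \<Rightarrow> bool" where
  "mono_rel A R S f \<longleftrightarrow> (\<forall>x\<in>A. \<forall>y\<in>A. (x, y) \<in> R \<longrightarrow> (f x, f y) \<in> S)"

lemma mono_relD: "mono_rel A R S f \<Longrightarrow> (x, y) \<in> R \<Longrightarrow> x \<in> A \<Longrightarrow> y \<in> A \<Longrightarrow> (f x, f y) \<in> S"
  by (auto simp: mono_rel_def)

lemma mono_rel_cong: "(\<And>x. x \<in> A \<Longrightarrow> f x = g x) \<Longrightarrow> mono_rel A R S f \<longleftrightarrow> mono_rel A R S g"
  by (auto simp: mono_rel_def)

lemma mono_rel_converse: "mono_rel A (R\<inverse>) (S\<inverse>) f \<longleftrightarrow> mono_rel A R S f"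
  by (auto simp: mono_rel_def)

lemma mono_rel_converse_left: "mono_rel A (R\<inverse>) S f \<longleftrightarrow> mono_rel A R (S\<inverse>) f"
  by (auto simp: mono_rel_def)

lemma mono_rel_comp:
  "mono_rel A R S f \<Longrightarrow> mono_rel B S T g \<Longrightarrow> f \<in> A \<rightarrow> B \<Longrightarrow> mono_rel A R T (g \<circ> f)"
  unfolding mono_rel_def by (simp add: Pi_iff)

lemma linear_order_onD:
  assumes "linear_order_on A R"
  shows "x \<in> A \<Longrightarrow> (x, x) \<in> R" "(x, y) \<in> R \<Longrightarrow> (y, z) \<in> R \<Longrightarrow> (x, z) \<in> R"
    "(x, y) \<in> R \<Longrightarrow> (y, x) \<in> R \<Longrightarrow> x = y" "x \<in> A \<Longrightarrow> y \<in> A \<Longrightarrow> (x, y) \<in> R \<or> (y, x) \<in> R"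
    "(x, y) \<in> R \<Longrightarrow> x \<in> A \<and> y \<in> A"
proof -
  have 1: "R \<subseteq> A \<times> A" "refl_on A R" "trans R" "antisym R" "total_on A R"
    using assms by (auto simp: order_on_defs)
  show "x \<in> A \<Longrightarrow> (x, x) \<in> R" using 1(2) by (simp add: refl_on_def)
  show "(x, y) \<in> R \<Longrightarrow> (y, z) \<in> R \<Longrightarrow> (x, z) \<in> R" using 1(3) by (rule transD)
  show "(x, y) \<in> R \<Longrightarrow> (y, x) \<in> R \<Longrightarrow> x = y" using 1(4) by (rule antisymD)
  show "x \<in> A \<Longrightarrow> y \<in> A \<Longrightarrow> (x, y) \<in> R \<or> (y, x) \<in> R"
    using 1(2,5) by (cases "x = y") (auto simp: refl_on_def total_on_def)
  show "(x, y) \<in> R \<Longrightarrow> x \<in> A \<and> y \<in> A" using 1(1) by auto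
qed

lemma linear_order_onI:
  assumes "\<And>x. x \<in> A \<Longrightarrow> (x, x) \<in> R" "\<And>x y z. (x, y) \<in> R \<Longrightarrow> (y, z) \<in> R \<Longrightarrow> (x, z) \<in> R"
    "\<And>x y. (x, y) \<in> R \<Longrightarrow> (y, x) \<in> R \<Longrightarrow> x = y" "\<And>x y. x \<in> A \<Longrightarrow> y \<in> A \<Longrightarrow> (x, y) \<in> R \<or> (y, x) \<in> R"
    "R \<subseteq> A \<times> A"
  shows "linear_order_on A R"
proof -
  have "trans R" using assms(2) by (rule transI)
  moreover have "antisym R" using assms(3) by (rule antisymI)
  moreover have "refl_on A R" using assms(1) by (simp add: refl_on_def)
  moreover have "total_on A R" using assms(4) by (simp add: total_on_def)
  ultimately show ?thesis using assms(5) by (simp add: order_on_defs)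
qed

lemma linear_order_on_subset:
  "linear_order_on A R \<Longrightarrow> B \<subseteq> A \<Longrightarrow> linear_order_on B (R \<inter> B \<times> B)"
  by (rule linear_order_onI) (blast dest: linear_order_onD)+

lemma finite_linear_greatest:
  assumes "linear_order_on A R" "finite F" "F \<noteq> {}" "F \<subseteq> A"
  shows "\<exists>m\<in>F. \<forall>x\<in>F. (x, m) \<in> R"
  using assms(2-4)
proof (induction F rule: finite_ne_induct)
  case (singleton x)
  then show ?case using linear_order_onD[OF assms(1)] by auto
next
  case (insert x F)
  then obtain m where m: "m \<in> F" "\<forall>x\<in>F. (x, m) \<in> R" by auto
  show ?case
  proof (cases "(x, m) \<in> R")
    case True
    then show ?thesis using m by auto
  next
    case False
    then have "(m, x) \<in> R" using insert m linear_order_onD(4)[OF assms(1)] by blast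
    then have "\<forall>y\<in>insert x F. (y, x) \<in> R"
      using m insert linear_order_onD(1,2)[OF assms(1)] by blast
    then show ?thesis by blast
  qed
qed

text \<open>The inverse sends \<open>b\<close> to the largest element whose image is at most \<open>b\<close>.\<close>

lemma mono_rel_regular:
  assumes R: "linear_order_on A R" and S: "linear_order_on B S" and A: "finite A" "A \<noteq> {}"
    and f: "f \<in> A \<rightarrow> B" "mono_rel A R S f"
  obtains g where "g \<in> B \<rightarrow> A" "mono_rel B S R g" "\<And>x. x \<in> A \<Longrightarrow> f (g (f x)) = f x"
    "\<And>a b. a \<in> A \<Longrightarrow> b \<in> B \<Longrightarrow> (f a, b) \<in> S \<Longrightarrow> (f (g b), b) \<in> S \<and> (a, g b) \<in> R"
proof -
  note R' = linear_order_onD[OF R] and S' = linear_order_onD[OF S]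
  obtain m where m: "m \<in> A" "\<forall>x\<in>A. (m, x) \<in> R"
    using finite_linear_greatest[of A "R\<inverse>" A] R A by auto
  define P where "P b = {a \<in> A. (f a, b) \<in> S}" for b
  \<comment> \<open>The default \<open>m\<close> is the least element of A. The set
    \<open>P b\<close> grows with b, so the empty cases come first and g remains monotone.\<close>
  define g where "g b = (if P b = {} then m else SOME x. x \<in> P b \<and> (\<forall>a\<in>P b. (a, x) \<in> R))" for b
  have g: "g b \<in> P b \<and> (\<forall>a\<in>P b. (a, g b) \<in> R)" if "P b \<noteq> {}" for b
  proof -
    have "\<exists>x. x \<in> P b \<and> (\<forall>a\<in>P b. (a, x) \<in> R)"
      using finite_linear_greatest[OF R, of "P b"] that A by (auto simp: P_def)
    from someI_ex[OF this] show ?thesis using that by (simp add: g_def)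
  qed
  have g0: "P b = {} \<Longrightarrow> g b = m" for b by (simp add: g_def)
  have gA: "g b \<in> A" for b
  proof (cases "P b = {}")
    case True
    then show ?thesis using g0 m by simp
  next
    case False
    then show ?thesis using g by (simp add: P_def)
  qed
  show thesis
  proof
    show "g \<in> B \<rightarrow> A" using gA by simp
    show "mono_rel B S R g"
      unfolding mono_rel_def
    proof (intro ballI impI)
      fix x y assume xy: "x \<in> B" "y \<in> B" "(x, y) \<in> S"
      have sub: "P x \<subseteq> P y" using xy S'(2) by (auto simp: P_def)
      show "(g x, g y) \<in> R"
      proof (cases "P x = {}")
        case True
        then show ?thesis using g0 m gA by auto
      next
        case False
        then show ?thesis using g[of x] g[of y] sub by auto
      qed
    qed
    show *: "(f (g b), b) \<in> S \<and> (a, g b) \<in> R" if "a \<in> A" "b \<in> B" "(f a, b) \<in> S" for a b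
      using g[of b] that by (auto simp: P_def)
    show "f (g (f x)) = f x" if "x \<in> A" for x
    proof -
      have fx: "f x \<in> B" using that f by auto
      have 1: "(f (g (f x)), f x) \<in> S" "(x, g (f x)) \<in> R" using *[OF that fx] S'(1)[OF fx] by auto
      then have "g (f x) \<in> A" using R'(5) by blast
      then have "(f x, f (g (f x))) \<in> S" using f(2) that 1 by (auto simp: mono_rel_def)
      then show ?thesis using 1 S'(3) by auto
    qed
  qed
qed

text \<open>The regular inverse of the inclusion of U in B rounds down to U, sending points below
  all of U to the least element of U. Over the converse order the same lemma rounds up.\<close>

lemma mono_rel_retraction:
  assumes S: "linear_order_on B S" and U: "finite U" "U \<noteq> {}" "U \<subseteq> B"
  obtains g where "g \<in> B \<rightarrow> U" "mono_rel B S S g" "\<And>x. x \<in> U \<Longrightarrow> g x = x"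
    "\<And>a b. a \<in> U \<Longrightarrow> (a, b) \<in> S \<Longrightarrow> (g b, b) \<in> S \<and> (a, g b) \<in> S"
proof -
  note S' = linear_order_onD[OF S]
  have 2: "id \<in> U \<rightarrow> B" using U by auto
  obtain g where "g \<in> B \<rightarrow> U" "mono_rel B S (S \<inter> U \<times> U) g" "\<And>x. x \<in> U \<Longrightarrow> id (g (id x)) = id x"
    "\<And>a b. a \<in> U \<Longrightarrow> b \<in> B \<Longrightarrow> (id a, b) \<in> S \<Longrightarrow> (id (g b), b) \<in> S \<and> (a, g b) \<in> S \<inter> U \<times> U"
    by (rule mono_rel_regular[OF linear_order_on_subset[OF S U(3)] S U(1,2) 2]) (auto simp: mono_rel_def)
  then show thesis using S'(5) by (intro that[of g]) (auto simp: mono_rel_def)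
qed

text \<open>Let \<open>m\<close> be the least element of the symmetric difference, say \<open>m \<in> U\<close>. If \<open>m\<close> is not the greatest
  element of \<open>U\<close>, then rounding up to \<open>U\<close> sends no element of \<open>V\<close> to \<open>m\<close>; otherwise, rounding down
  to \<open>V\<close> identifies \<open>m\<close> with its predecessor in \<open>U\<close>.\<close>

lemma mono_rel_separation_aux:
  assumes S: "linear_order_on B S" and U: "finite U" "U \<subseteq> B" and V: "finite V" "V \<subseteq> B"
    and card: "card U = q" "card V = q" "2 \<le> q"
    and m: "m \<in> U" "m \<notin> V" and least: "\<And>x. x \<in> (U - V) \<union> (V - U) \<Longrightarrow> (m, x) \<in> S"
  shows "\<exists>g\<in>B \<rightarrow> B. mono_rel B S S g \<and> card (g ` B) \<le> q \<and>
    (card (g ` U) = q \<and> card (g ` V) < q \<or> card (g ` V) = q \<and> card (g ` U) < q)"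
proof -
  note S' = linear_order_onD[OF S]
  have below: "x \<in> U \<longleftrightarrow> x \<in> V" if "(x, m) \<in> S" "x \<noteq> m" for x
    using least[of x] S'(3)[of x m] that by blast
  show ?thesis
  proof (cases "\<forall>s\<in>U. (s, m) \<in> S")
    case False
    then obtain M where M: "M \<in> U" "(M, m) \<notin> S" by blast
    obtain g where g: "g \<in> B \<rightarrow> U" "mono_rel B (S\<inverse>) (S\<inverse>) g" "\<And>x. x \<in> U \<Longrightarrow> g x = x"
      "\<And>a b. a \<in> U \<Longrightarrow> (a, b) \<in> S\<inverse> \<Longrightarrow> (g b, b) \<in> S\<inverse> \<and> (a, g b) \<in> S\<inverse>"
      using mono_rel_retraction[of B "S\<inverse>" U] S U M by auto
    have gm: "mono_rel B S S g" using g(2) by (simp add: mono_rel_converse)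
    have "m \<notin> g ` V"
    proof
      assume "m \<in> g ` V"
      then obtain x where x: "x \<in> V" "g x = m" by auto
      show False
      \<comment> \<open>A point with an element of U above it is rounded up, so reaching m would put
        it below m, where U and V agree. A point above all of U is rounded to at least M, which lies
        above m.\<close>
      proof (cases "\<exists>s\<in>U. (x, s) \<in> S")
        case True
        then have "(x, m) \<in> S" using g(4) x by auto
        moreover have "x \<noteq> m" using x m by auto
        ultimately have "x \<in> U" using below x by blast
        then show False using g(3) x \<open>x \<noteq> m\<close> by auto
      next
        case False
        then have "(M, x) \<in> S" using S'(4)[of x M] M U V x by blast
        then have "(g M, g x) \<in> S" using gm M x U V by (auto simp: mono_rel_def)
        then show False using g(3) M x by auto
      qed
    qed
    moreover have "g ` V \<subseteq> U" using g(1) V by auto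
    ultimately have "g ` V \<subset> U" using m by blast
    then have "card (g ` V) < q" using psubset_card_mono U card by blast
    moreover have "g ` U = U" using g(3) by auto
    moreover have "card (g ` B) \<le> q" using card_mono[of U "g ` B"] g(1) U card by auto
    ultimately show ?thesis using gm g(1) U card by (intro bexI[of _ g]) auto
  next
    case True
    have "card (U - {m}) = q - 1" using m U card by simp
    \<comment> \<open>As q is at least 2, m has a predecessor p in U. It lies in V as well, so
      rounding down to V sends m to p.\<close>
    then have ne: "U - {m} \<noteq> {}" using card by force
    obtain p where p: "p \<in> U - {m}" "\<forall>x\<in>U - {m}. (x, p) \<in> S"
      using finite_linear_greatest[OF S, of "U - {m}"] U ne by auto
    have pV: "p \<in> V" using below[of p] True p by blast
    obtain g where g: "g \<in> B \<rightarrow> V" "mono_rel B S S g" "\<And>x. x \<in> V \<Longrightarrow> g x = x"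
      "\<And>a b. a \<in> V \<Longrightarrow> (a, b) \<in> S \<Longrightarrow> (g b, b) \<in> S \<and> (a, g b) \<in> S"
      using mono_rel_retraction[of B S V] S V pV by auto
    have mB: "m \<in> B" using m U by auto
    have gmV: "g m \<in> V" using g(1) mB by auto
    have 1: "(g m, m) \<in> S" "(p, g m) \<in> S" using g(4)[OF pV, of m] p True by auto
    have "g m \<noteq> m" using gmV m by auto
    then have "g m \<in> U - {m}" using below[of "g m"] 1 gmV by auto
    then have "g m = p" using p 1 S'(3) by auto
    then have "g m = g p" using g(3) pV by auto
    then have "\<not> inj_on g U" using p m unfolding inj_on_def by auto
    then have "card (g ` U) \<noteq> q" using U card inj_on_iff_eq_card by metis
    then have "card (g ` U) < q" using card_image_le[of U g] U card by simp
    moreover have "g ` V = V" using g(3) by auto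
    moreover have "card (g ` B) \<le> q" using card_mono[of V "g ` B"] g(1) V card by auto
    ultimately show ?thesis using g V card by (intro bexI[of _ g]) auto
  qed
qed

text \<open>The least point of the symmetric difference may lie in either set, and its position
  decides which image shrinks; hence the symmetric conclusion. The bound on the whole image of g
  keeps the resulting multiplier inside the ideal.\<close>

lemma mono_rel_separation:
  assumes S: "linear_order_on B S" and U: "finite U" "U \<subseteq> B" and V: "finite V" "V \<subseteq> B"
    and card: "card U = q" "card V = q" "2 \<le> q" and "U \<noteq> V"
  shows "\<exists>g\<in>B \<rightarrow> B. mono_rel B S S g \<and> card (g ` B) \<le> q \<and>
    (card (g ` U) = q \<and> card (g ` V) < q \<or> card (g ` V) = q \<and> card (g ` U) < q)"
proof -
  have "(U - V) \<union> (V - U) \<noteq> {}" using \<open>U \<noteq> V\<close> by auto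
  then obtain m where m: "m \<in> (U - V) \<union> (V - U)" "\<forall>x\<in>(U - V) \<union> (V - U). (m, x) \<in> S"
    using finite_linear_greatest[of B "S\<inverse>" "(U - V) \<union> (V - U)"] S U V by auto
  then show ?thesis
    using mono_rel_separation_aux[OF S U V card, of m] mono_rel_separation_aux[OF S V U card(2,1,3), of m]
    by (metis (no_types, lifting) Diff_iff Un_iff)
qed

subsection \<open>Enumerations\<close>

lemma sorted_list_exists:
  assumes "linear_order_on A R" "finite F" "F \<subseteq> A"
  shows "\<exists>xs. set xs = F \<and> distinct xs \<and> sorted_wrt (\<lambda>x y. (x, y) \<in> R) xs"
  using assms(2,3)
proof (induction "card F" arbitrary: F)
  case 0
  then show ?case by (intro exI[of _ "[]"]) auto
next
  case (Suc n)
  then have "F \<noteq> {}" by auto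
  then obtain m where m: "m \<in> F" "\<forall>x\<in>F. (m, x) \<in> R"
    using finite_linear_greatest[of A "R\<inverse>" F] Suc assms(1) by auto
  obtain xs where xs: "set xs = F - {m}" "distinct xs" "sorted_wrt (\<lambda>x y. (x, y) \<in> R) xs"
    using Suc(1)[of "F - {m}"] card_Diff_singleton[OF m(1)] Suc(2)[symmetric] Suc(3,4) by fastforce
  have "set (m # xs) = F" using xs(1) m(1) by (simp add: insert_absorb)
  moreover have "distinct (m # xs)" using xs by simp
  moreover have "sorted_wrt (\<lambda>x y. (x, y) \<in> R) (m # xs)" using xs m(2) by simp
  ultimately show ?case by blast
qed

lemma sorted_list_unique:
  assumes "linear_order_on A R"
    and "sorted_wrt (\<lambda>x y. (x, y) \<in> R) xs" "sorted_wrt (\<lambda>x y. (x, y) \<in> R) ys"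
    and "distinct xs" "distinct ys" "set xs = set ys"
  shows "xs = ys"
  using assms(2-)
proof (induction xs arbitrary: ys)
  case Nil
  then show ?case by auto
next
  case (Cons x xs)
  then obtain y ys' where ys: "ys = y # ys'" by (cases ys) auto
  have "x = y"
  proof (rule ccontr)
    assume "x \<noteq> y"
    then have "y \<in> set xs" "x \<in> set ys'" using Cons.prems(5) ys by (metis set_ConsD list.set_intros(1))+
    then show False using Cons.prems(1,2) ys \<open>x \<noteq> y\<close> linear_order_onD(3)[OF assms(1), of x y] by auto
  qed
  then show ?case using Cons.IH[of ys'] Cons.prems ys by (auto simp: insert_ident)
qed

lemma enumeration:
  assumes "linear_order_on A (ord A)" "finite A"
  shows "set (enumeration ord A) = A" "distinct (enumeration ord A)"
    "sorted_wrt (\<lambda>x y. (x, y) \<in> ord A) (enumeration ord A)"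
proof -
  let ?P = "\<lambda>xs. set xs = A \<and> distinct xs \<and> sorted_wrt (\<lambda>x y. (x, y) \<in> ord A) xs"
  have "\<exists>!xs. ?P xs"
    using sorted_list_exists[OF assms(1,2)] sorted_list_unique[OF assms(1)] by blast
  from theI'[OF this] show "set (enumeration ord A) = A" "distinct (enumeration ord A)"
    "sorted_wrt (\<lambda>x y. (x, y) \<in> ord A) (enumeration ord A)"
    unfolding enumeration_def by auto
qed

text \<open>\<open>sorted_wrt\<close> compares earlier with later entries only. By antisymmetry of R
  the remaining pairs of \<open>mono_rel\<close> are diagonal, and S is reflexive.\<close>

lemma sorted_map_iff:
  assumes "linear_order_on A R" "linear_order_on B S"
    and "sorted_wrt (\<lambda>x y. (x, y) \<in> R) xs" "f ` set xs \<subseteq> B"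
  shows "sorted_wrt (\<lambda>x y. (x, y) \<in> S) (map f xs) \<longleftrightarrow> mono_rel (set xs) R S f"
  using assms(3-)
proof (induction xs)
  case Nil
  then show ?case by (simp add: mono_rel_def)
next
  case (Cons a xs)
  then have IH: "sorted_wrt (\<lambda>x y. (x, y) \<in> S) (map f xs) \<longleftrightarrow> mono_rel (set xs) R S f"
    and a: "\<forall>y\<in>set xs. (a, y) \<in> R" by auto
  have "mono_rel (set (a # xs)) R S f \<longleftrightarrow> mono_rel (set xs) R S f \<and> (\<forall>y\<in>set xs. (f a, f y) \<in> S)"
    using a Cons.prems linear_order_onD(3)[OF assms(1), of a] linear_order_onD(1)[OF assms(2)]
    by (fastforce simp: mono_rel_def)
  then show ?case using IH by auto
qed

text \<open>The set \<open>L\<close> is the initial segment that a rotation moves to the end.\<close>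

definition cut_mono :: "'a set \<Rightarrow> 'a rel \<Rightarrow> 'a set \<Rightarrow> 'b rel \<Rightarrow> ('a \<Rightarrow> 'b) \<Rightarrow> bool" where
  "cut_mono A R L S f \<longleftrightarrow> (\<forall>x\<in>A. \<forall>y\<in>A. x \<in> L \<longrightarrow> y \<notin> L \<longrightarrow> (x, y) \<in> R \<and> (f y, f x) \<in> S) \<and>
     (\<forall>x\<in>A. \<forall>y\<in>A. (x \<in> L \<longleftrightarrow> y \<in> L) \<longrightarrow> (x, y) \<in> R \<longrightarrow> (f x, f y) \<in> S)"

lemma cut_mono_empty: "cut_mono A R {} S f \<longleftrightarrow> mono_rel A R S f"
  by (auto simp: cut_mono_def mono_rel_def)

lemma cut_mono_superset: "A \<subseteq> L \<Longrightarrow> cut_mono A R L S f \<longleftrightarrow> mono_rel A R S f"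
  by (auto simp: cut_mono_def mono_rel_def subset_iff)

text \<open>Initial segments become final ones under the converse order, so the cut is complemented.
  This serves composition after an orientation-reversing map.\<close>

lemma cut_mono_converse: "cut_mono A R L S f \<Longrightarrow> cut_mono A (R\<inverse>) (A - L) (S\<inverse>) f"
  by (auto simp: cut_mono_def)

text \<open>A rotation by j corresponds to the cut formed by the first j entries. Conversely, every
  cut meets A in a prefix of the list, because its elements precede all others.\<close>

lemma sorted_rotate_iff:
  assumes R: "linear_order_on A R" and S: "linear_order_on B S" and A: "finite A" "A \<noteq> {}"
    and xs: "set xs = A" "distinct xs" "sorted_wrt (\<lambda>x y. (x, y) \<in> R) xs" and f: "f ` A \<subseteq> B"
  shows "(\<exists>j<card A. sorted_wrt (\<lambda>x y. (x, y) \<in> S) (map f (rotate j xs))) \<longleftrightarrow> (\<exists>L. cut_mono A R L S f)"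
proof -
  have len: "length xs = card A" using xs distinct_card by fastforce
  have *: "sorted_wrt (\<lambda>x y. (x, y) \<in> S) (map f (rotate j xs)) \<longleftrightarrow> cut_mono A R (set (take j xs)) S f"
    if j: "j < card A" for j
  proof -
    let ?T = "take j xs" and ?D = "drop j xs"
    have rot: "rotate j xs = ?D @ ?T" using j len by (simp add: rotate_drop_take)
    have un: "set ?T \<union> set ?D = A" using xs by (metis append_take_drop_id set_append)
    have dj: "set ?T \<inter> set ?D = {}" using xs(2) by (simp add: set_take_disj_set_drop_if_distinct)
    have "sorted_wrt (\<lambda>x y. (x, y) \<in> R) (?T @ ?D)" using xs(3) by simp
    then have sw: "sorted_wrt (\<lambda>x y. (x, y) \<in> R) ?T" "sorted_wrt (\<lambda>x y. (x, y) \<in> R) ?D"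
      "\<forall>x\<in>set ?T. \<forall>y\<in>set ?D. (x, y) \<in> R" unfolding sorted_wrt_append by auto
    have fi: "f ` set ?T \<subseteq> B" "f ` set ?D \<subseteq> B" using f un by auto
    have "sorted_wrt (\<lambda>x y. (x, y) \<in> S) (map f (rotate j xs)) \<longleftrightarrow>
      mono_rel (set ?T) R S f \<and> mono_rel (set ?D) R S f \<and> (\<forall>y\<in>set ?D. \<forall>x\<in>set ?T. (f y, f x) \<in> S)"
      unfolding rot map_append sorted_wrt_append
        sorted_map_iff[OF R S sw(1) fi(1)] sorted_map_iff[OF R S sw(2) fi(2)] by auto
    also have "\<dots> \<longleftrightarrow> cut_mono A R (set ?T) S f"
    proof -
      have D: "y \<in> set ?D \<longleftrightarrow> y \<in> A \<and> y \<notin> set ?T" and T: "y \<in> set ?T \<Longrightarrow> y \<in> A" for y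
        using un dj by auto
      have "(x, y) \<in> R" if "x \<in> set ?T" "y \<in> A" "y \<notin> set ?T" for x y
        using sw(3) that D by blast
      moreover have "cut_mono A R (set ?T) S f \<longleftrightarrow> (\<forall>x\<in>set ?T. \<forall>y\<in>set ?D. (x, y) \<in> R \<and> (f y, f x) \<in> S) \<and>
          mono_rel (set ?T) R S f \<and> mono_rel (set ?D) R S f"
        unfolding mono_rel_def cut_mono_def Ball_def D using T by blast
      ultimately show ?thesis using D by blast
    qed
    finally show ?thesis .
  qed
  show ?thesis
  proof
    assume "\<exists>j<card A. sorted_wrt (\<lambda>x y. (x, y) \<in> S) (map f (rotate j xs))"
    then show "\<exists>L. cut_mono A R L S f" using * by blast
  next
    assume "\<exists>L. cut_mono A R L S f"
    then obtain L where L: "cut_mono A R L S f" by blast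
    show "\<exists>j<card A. sorted_wrt (\<lambda>x y. (x, y) \<in> S) (map f (rotate j xs))"
    proof (cases "A \<subseteq> L")
      case True
      \<comment> \<open>A cut containing all of A would be the rotation by \<open>card A\<close>,
        which is out of range; it has the same effect as no rotation.\<close>
      then have "cut_mono A R (set (take 0 xs)) S f" using L by (simp add: cut_mono_superset[OF True] cut_mono_empty)
      moreover have "0 < card A" using A by (simp add: card_gt_0_iff)
      ultimately show ?thesis using * by blast
    next
      case False
      \<comment> \<open>The rotation count is the length of the prefix inside L. Beyond its end d no
        entry lies in L, since all of L precedes d.\<close>
      define j where "j = length (takeWhile (\<lambda>x. x \<in> L) xs)"
      have T: "take j xs = takeWhile (\<lambda>x. x \<in> L) xs" unfolding j_def by (rule takeWhile_eq_take[symmetric])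
      have D: "drop j xs = dropWhile (\<lambda>x. x \<in> L) xs" unfolding j_def by (rule dropWhile_eq_drop[symmetric])
      have ne: "dropWhile (\<lambda>x. x \<in> L) xs \<noteq> []" using False xs(1) by (auto simp: dropWhile_eq_Nil_conv)
      then obtain d ds where d: "drop j xs = d # ds" "d \<notin> L"
        using D hd_dropWhile[OF ne] by (metis list.exhaust_sel)
      have j: "j < card A" using d len by (metis drop_all list.distinct(1) not_le_imp_less)
      have "sorted_wrt (\<lambda>x y. (x, y) \<in> R) (take j xs @ drop j xs)" using xs(3) by simp
      then have "\<forall>x\<in>set ds. (d, x) \<in> R" unfolding sorted_wrt_append d by auto
      moreover have "d \<notin> set ds" using xs(2) d by (metis distinct_drop distinct.simps(2))
      moreover have "set (d # ds) \<subseteq> A" using xs(1) d by (metis set_drop_subset)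
      ultimately have "x \<notin> L" if "x \<in> set (d # ds)" for x
        using that d(2) L linear_order_onD(3)[OF R, of x d] unfolding cut_mono_def by auto
      then have "x \<in> set (take j xs) \<longleftrightarrow> x \<in> L" if "x \<in> A" for x
        using that xs(1) T d by (metis Un_iff append_take_drop_id set_append set_takeWhileD)
      then have "cut_mono A R (set (take j xs)) S f" using L unfolding cut_mono_def by auto
      then show ?thesis using * j by blast
    qed
  qed
qed

text \<open>For the rotated order that puts A - L before L, the map f is monotone, so the preimage
  of M is an initial segment of that order. It either avoids L or contains all of A - L. The cut of
  the composite is the union of L with the preimage in the first case and their intersection in the
  second.\<close>

lemma cut_mono_comp:
  assumes R: "linear_order_on A R" and S: "linear_order_on B S"
    and f: "f \<in> A \<rightarrow> B" "cut_mono A R L S f" and g: "cut_mono B S M T g"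
  shows "\<exists>K. cut_mono A R K T (g \<circ> f)"
proof -
  note R' = linear_order_onD[OF R] and S' = linear_order_onD[OF S]
  have fB: "f x \<in> B" if "x \<in> A" for x using f(1) that by auto
  have f1: "(x, y) \<in> R" "(f y, f x) \<in> S" if "x \<in> A" "y \<in> A" "x \<in> L" "y \<notin> L" for x y
    using f(2) that unfolding cut_mono_def by auto
  have f2: "(f x, f y) \<in> S" if "x \<in> A" "y \<in> A" "x \<in> L \<longleftrightarrow> y \<in> L" "(x, y) \<in> R" for x y
    using f(2) that unfolding cut_mono_def by auto
  have g1: "(f x, f y) \<in> S" "(g (f y), g (f x)) \<in> T" if "x \<in> A" "y \<in> A" "f x \<in> M" "f y \<notin> M" for x y
    using g that fB unfolding cut_mono_def by auto
  have g2: "(g (f x), g (f y)) \<in> T" if "x \<in> A" "y \<in> A" "f x \<in> M \<longleftrightarrow> f y \<in> M" "(f x, f y) \<in> S" for x y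
    using g that fB unfolding cut_mono_def by auto
  have fP: "(x, y) \<in> R" if "x \<in> A" "y \<in> A" "f x \<in> M" "f y \<notin> M" "x \<in> L \<longleftrightarrow> y \<in> L" for x y
  proof (rule ccontr)
    assume "(x, y) \<notin> R"
    then have "(f y, f x) \<in> S" using f2[of y x] R'(4)[of x y] that by auto
    then have "f x = f y" using g1(1)[of x y] S'(3) that by auto
    then show False using that by auto
  qed
  \<comment> \<open>The values of f outside L lie below its values on L, so one point of L over M
    forces everything outside L over M.\<close>
  have fL: "f y \<in> M" if "x \<in> A" "y \<in> A" "x \<in> L" "y \<notin> L" "f x \<in> M" for x y
    using f1(2)[of x y] g1(1)[of x y] S'(3)[of "f x" "f y"] that by metis
  show ?thesis
  proof (cases "\<exists>p\<in>A. p \<in> L \<and> f p \<in> M")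
    case False
    then have no: "f x \<notin> M" if "x \<in> A" "x \<in> L" for x using that by auto
    show ?thesis
    proof (intro exI[of _ "L \<union> f -` M"])
      show "cut_mono A R (L \<union> f -` M) T (g \<circ> f)"
        unfolding cut_mono_def
      proof (intro conjI ballI impI)
        fix x y assume xy: "x \<in> A" "y \<in> A" "x \<in> L \<union> f -` M" "y \<notin> L \<union> f -` M"
        show "(x, y) \<in> R" using f1 fP xy by (cases "x \<in> L") auto
        show "((g \<circ> f) y, (g \<circ> f) x) \<in> T"
          using g1(2)[of x y] g2[of y x] f1(2)[of x y] no xy by (cases "x \<in> L") auto
      next
        fix x y assume xy: "x \<in> A" "y \<in> A" "x \<in> L \<union> f -` M \<longleftrightarrow> y \<in> L \<union> f -` M" "(x, y) \<in> R"
        show "((g \<circ> f) x, (g \<circ> f) y) \<in> T"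
        proof (cases "x \<in> L \<longleftrightarrow> y \<in> L")
          case True
          then show ?thesis using f2[OF xy(1,2) _ xy(4)] g2[of x y] no xy by auto
        next
          case F: False
          show ?thesis
          proof (cases "x \<in> L")
            case True
            then show ?thesis using F xy g1(2)[of y x] no by auto
          next
            case False
            then have "(y, x) \<in> R" using F f1(1)[of y x] xy by auto
            then show ?thesis using xy R'(3) F by blast
          qed
        qed
      qed
    qed
  next
    case True
    then obtain p where p: "p \<in> A" "p \<in> L" "f p \<in> M" by auto
    have yes: "f y \<in> M" if "y \<in> A" "y \<notin> L" for y using fL[OF p(1) that(1) p(2) that(2) p(3)] .
    show ?thesis
    proof (intro exI[of _ "L \<inter> f -` M"])
      show "cut_mono A R (L \<inter> f -` M) T (g \<circ> f)"
        unfolding cut_mono_def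
      proof (intro conjI ballI impI)
        fix x y assume xy: "x \<in> A" "y \<in> A" "x \<in> L \<inter> f -` M" "y \<notin> L \<inter> f -` M"
        show "(x, y) \<in> R" using f1 fP xy by (cases "y \<in> L") auto
        show "((g \<circ> f) y, (g \<circ> f) x) \<in> T"
          using g1(2)[of x y] g2[of y x] f1(2)[of x y] yes xy by (cases "y \<in> L") auto
      next
        fix x y assume xy: "x \<in> A" "y \<in> A" "x \<in> L \<inter> f -` M \<longleftrightarrow> y \<in> L \<inter> f -` M" "(x, y) \<in> R"
        show "((g \<circ> f) x, (g \<circ> f) y) \<in> T"
        proof (cases "x \<in> L \<longleftrightarrow> y \<in> L")
          case True
          then show ?thesis using f2[OF xy(1,2) _ xy(4)] g2[of x y] yes xy by auto
        next
          case F: False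
          show ?thesis
          proof (cases "x \<in> L")
            case True
            then show ?thesis using F xy g1(2)[of y x] yes by auto
          next
            case False
            then have "(y, x) \<in> R" using F f1(1)[of y x] xy by auto
            then show ?thesis using xy R'(3) F by blast
          qed
        qed
      qed
    qed
  qed
qed

text \<open>Rotating the order on \<open>A\<close> by \<open>L\<close> makes \<open>f\<close> monotone, so the monotone case applies.\<close>

lemma cut_mono_regular:
  assumes R: "linear_order_on A R" and S: "linear_order_on B S" and A: "finite A" "A \<noteq> {}"
    and f: "f \<in> A \<rightarrow> B" "cut_mono A R L S f"
  shows "\<exists>g\<in>B \<rightarrow> A. (\<exists>K. cut_mono B S K R g) \<and> (\<forall>x\<in>A. f (g (f x)) = f x)"
proof -
  note R' = linear_order_onD[OF R] and S' = linear_order_onD[OF S]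
  define R0 where "R0 = {(x, y) \<in> A \<times> A. (x \<in> L \<longleftrightarrow> y \<in> L) \<and> (x, y) \<in> R \<or> x \<notin> L \<and> y \<in> L}"
  have "linear_order_on A R0"
  proof (rule linear_order_onI)
    show "(x, x) \<in> R0" if "x \<in> A" for x using R'(1) that unfolding R0_def by auto
    show "(x, z) \<in> R0" if "(x, y) \<in> R0" "(y, z) \<in> R0" for x y z
      using R'(2)[of x y z] that unfolding R0_def by auto
    show "x = y" if "(x, y) \<in> R0" "(y, x) \<in> R0" for x y
      using R'(3)[of x y] that unfolding R0_def by auto
    show "(x, y) \<in> R0 \<or> (y, x) \<in> R0" if "x \<in> A" "y \<in> A" for x y
      using R'(4)[of x y] that unfolding R0_def by auto
    show "R0 \<subseteq> A \<times> A" unfolding R0_def by auto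
  qed
  moreover have "mono_rel A R0 S f"
    using f unfolding mono_rel_def cut_mono_def R0_def by auto
  ultimately obtain g where g: "g \<in> B \<rightarrow> A" "mono_rel B S R0 g" "\<And>x. x \<in> A \<Longrightarrow> f (g (f x)) = f x"
    using mono_rel_regular[OF _ S A f(1)] by metis
  have g2: "(g x, g y) \<in> R0" if "(x, y) \<in> S" for x y using g(2) that S'(5) by (auto simp: mono_rel_def)
  \<comment> \<open>The order \<open>R0\<close> begins with the complement of L, so the points that
    the monotone map g sends there form an initial segment of B. This segment is the cut of
    g.\<close>
  have "cut_mono B S {b. g b \<notin> L} R g"
    unfolding cut_mono_def
  proof (intro conjI ballI impI)
    fix x y assume xy: "x \<in> B" "y \<in> B" "x \<in> {b. g b \<notin> L}" "y \<notin> {b. g b \<notin> L}"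
    show "(x, y) \<in> S" using S'(4)[of x y] g2[of y x] xy unfolding R0_def by auto
    show "(g y, g x) \<in> R" using f(2) funcset_mem[OF g(1)] xy unfolding cut_mono_def by simp
  next
    fix x y assume xy: "x \<in> B" "y \<in> B" "(x \<in> {b. g b \<notin> L}) = (y \<in> {b. g b \<notin> L})" "(x, y) \<in> S"
    then show "(g x, g y) \<in> R" using g2[of x y] unfolding R0_def by auto
  qed
  then show ?thesis using g by blast
qed

section \<open>Regular transformation categories containing all order-preserving maps\<close>

abbreviation dm :: "'a morphism \<Rightarrow> 'a set" where "dm x \<equiv> fst x"
abbreviation fn :: "'a morphism \<Rightarrow> 'a \<Rightarrow> 'a" where "fn x \<equiv> fst (snd x)"
abbreviation cd :: "'a morphism \<Rightarrow> 'a set" where "cd x \<equiv> snd (snd x)"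

definition mcomp :: "'a morphism \<Rightarrow> 'a morphism \<Rightarrow> 'a morphism" (infixl "\<odot>" 70) where
  "x \<odot> y = (dm x, compose (dm x) (fn y) (fn x), cd y)"

lemma rank_eq: "rank x = card (fn x ` dm x)"
  by (cases x) auto

text \<open>Each value not taken on \<open>U0\<close> receives one chosen preimage, and as many of
  these as needed are added to \<open>U0\<close>.\<close>

lemma partial_transversal:
  assumes "finite A" "U0 \<subseteq> A" "inj_on f U0" "card U0 \<le> k" "k \<le> card (f ` A)"
  obtains U where "U0 \<subseteq> U" "U \<subseteq> A" "inj_on f U" "card U = k"
proof -
  obtain V where V: "V \<subseteq> A" "inj_on f V" "f ` A - f ` U0 = f ` V"
    using subset_image_inj[of "f ` A - f ` U0" f A] by auto
  have fin: "finite U0" "finite V" using assms(1,2) V(1) finite_subset by auto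
  have "card (f ` A - f ` U0) = card (f ` A) - card (f ` U0)"
    using assms(1,2) fin by (intro card_Diff_subset) auto
  then have cV: "card V = card (f ` A) - card U0"
    using V card_image assms(3) by metis
  then have "k - card U0 \<le> card V" using assms by auto
  then obtain W where W: "W \<subseteq> V" "card W = k - card U0" by (meson obtain_subset_with_card_n)
  have dj: "f ` U0 \<inter> f ` W = {}" using W V by blast
  then have "U0 \<inter> W = {}" by auto
  then have "card (U0 \<union> W) = k" using W fin assms card_Un_disjoint[of U0 W] finite_subset[OF W(1)] by simp
  moreover have "inj_on f (U0 \<union> W)"
    unfolding inj_on_Un using assms(3) V W dj inj_on_subset[OF V(2)] by blast
  ultimately show thesis using that[of "U0 \<union> W"] W V assms by auto
qed

text \<open>Greatest elements are matched with each other, and the remaining elements are treated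
  recursively.\<close>

lemma order_iso_exists:
  assumes R: "linear_order_on A R" and S: "linear_order_on B S"
    and "finite U" "U \<subseteq> A" "finite T" "T \<subseteq> B" "card U = card T"
  shows "\<exists>f. bij_betw f U T \<and> mono_rel U R S f"
  using assms(3-)
proof (induction "card U" arbitrary: U T)
  case 0
  then show ?case by (intro exI[of _ undefined]) (auto simp: bij_betw_def mono_rel_def)
next
  case (Suc n)
  then have "U \<noteq> {}" "T \<noteq> {}" by auto
  then obtain m m' where m: "m \<in> U" "\<And>x. x \<in> U \<Longrightarrow> (x, m) \<in> R" and m': "m' \<in> T" "\<And>x. x \<in> T \<Longrightarrow> (x, m') \<in> S"
    using finite_linear_greatest[OF R, of U] finite_linear_greatest[OF S, of T] Suc.prems by metis
  have "n = card (U - {m})" "card (U - {m}) = card (T - {m'})"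
    using Suc.hyps(2) Suc.prems(5) m(1) m'(1) by (simp_all add: card_Diff_singleton)
  moreover have "finite (U - {m})" "U - {m} \<subseteq> A" "finite (T - {m'})" "T - {m'} \<subseteq> B"
    using Suc.prems by auto
  ultimately obtain f where f: "bij_betw f (U - {m}) (T - {m'})" "mono_rel (U - {m}) R S f"
    using Suc.hyps(1)[of "U - {m}" "T - {m'}"] by blast
  let ?f = "f(m := m')"
  have "bij_betw ?f (U - {m}) (T - {m'})" using f(1) by (subst bij_betw_cong[of _ _ f]) auto
  then have "bij_betw ?f (insert m (U - {m})) (insert m' (T - {m'}))"
    using notIn_Un_bij_betw[of m "U - {m}" ?f "T - {m'}"] by simp
  moreover have "mono_rel U R S ?f"
    unfolding mono_rel_def
  proof (intro ballI impI)
    fix x y assume xy: "x \<in> U" "y \<in> U" "(x, y) \<in> R"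
    have fT: "?f z \<in> T" if "z \<in> U" for z using bij_betwE[OF f(1)] that m' by auto
    show "(?f x, ?f y) \<in> S"
    proof (cases "y = m")
      case True
      then show ?thesis using fT[OF xy(1)] m'(2) by simp
    next
      case False
      then have "x \<noteq> m" using m(2)[OF xy(2)] xy linear_order_onD(3)[OF R] by blast
      then show ?thesis using mono_relD[OF f(2) xy(3)] xy False by simp
    qed
  qed
  ultimately show ?case using m m' by (metis insert_Diff)
qed

text \<open>\<open>M_mono\<close> is the source of the order-preserving multipliers;
  \<open>M_regular\<close> is the equation x x' x = x, stated pointwise.\<close>

locale trans_subcat =
  fixes C :: "'a set set" and ord :: "'a set \<Rightarrow> 'a rel" and M :: "'a morphism set"
  assumes C_ne: "C \<noteq> {}" and C_finite: "A \<in> C \<Longrightarrow> finite A" and C_nonempty: "A \<in> C \<Longrightarrow> A \<noteq> {}"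
    and C_linear: "A \<in> C \<Longrightarrow> linear_order_on A (ord A)"
    and M_sub: "x \<in> M \<Longrightarrow> dm x \<in> C \<and> cd x \<in> C \<and> fn x \<in> dm x \<rightarrow>\<^sub>E cd x"
    and M_comp: "x \<in> M \<Longrightarrow> y \<in> M \<Longrightarrow> cd x = dm y \<Longrightarrow> x \<odot> y \<in> M"
    and M_mono: "A \<in> C \<Longrightarrow> B \<in> C \<Longrightarrow> f \<in> A \<rightarrow>\<^sub>E B \<Longrightarrow> mono_rel A (ord A) (ord B) f \<Longrightarrow> (A, f, B) \<in> M"
    and M_regular: "x \<in> M \<Longrightarrow> \<exists>x'\<in>M. dm x' = cd x \<and> cd x' = dm x \<and> (\<forall>a\<in>dm x. fn x (fn x' (fn x a)) = fn x a)"
begin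

definition mor :: "'a set \<Rightarrow> 'a set \<Rightarrow> 'a morphism set" where
  "mor A B = {x \<in> M. dm x = A \<and> cd x = B}"

lemma morI: "x \<in> M \<Longrightarrow> x \<in> mor (dm x) (cd x)" by (simp add: mor_def)

lemma mor_M: "x \<in> mor A B \<Longrightarrow> x \<in> M" by (simp add: mor_def)

lemma mor_dm: "x \<in> mor A B \<Longrightarrow> dm x = A"
  by (simp add: mor_def)

lemma mor_PiE: "x \<in> mor A B \<Longrightarrow> A \<in> C \<and> B \<in> C \<and> fn x \<in> A \<rightarrow>\<^sub>E B"
  using M_sub[of x] by (simp add: mor_def)

lemma mor_obj: "x \<in> mor A B \<Longrightarrow> A \<in> C \<and> B \<in> C"
  using mor_PiE[of x] by simp

lemma mor_fn: "x \<in> mor A B \<Longrightarrow> a \<in> A \<Longrightarrow> fn x a \<in> B"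
  using mor_PiE[of x] by auto

lemma mor_finite: "x \<in> mor A B \<Longrightarrow> finite A" "x \<in> mor A B \<Longrightarrow> finite B"
  using mor_obj C_finite by auto

lemma comp_dm [simp]: "dm (x \<odot> y) = dm x" and comp_cd [simp]: "cd (x \<odot> y) = cd y"
  by (simp_all add: mcomp_def)

lemma comp_mor: "x \<in> mor A B \<Longrightarrow> y \<in> mor B D \<Longrightarrow> x \<odot> y \<in> mor A D"
  using M_comp[of x y] by (simp add: mor_def)

lemma comp_fn: "x \<in> mor A B \<Longrightarrow> a \<in> A \<Longrightarrow> fn (x \<odot> y) a = fn y (fn x a)"
  by (simp add: mor_def mcomp_def compose_def)

lemma mor_eqI:
  assumes "x \<in> mor A B" "y \<in> mor A B" "\<And>a. a \<in> A \<Longrightarrow> fn x a = fn y a"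
  shows "x = y"
proof -
  have "fn x = fn y" using assms mor_PiE[of x A B] mor_PiE[of y A B] by (intro PiE_ext) auto
  then show ?thesis using assms(1,2) by (simp add: mor_def prod_eq_iff)
qed

text \<open>The values of x lie in the domain of y, where the restriction hidden in
  \<open>compose\<close> has no effect; z may therefore be arbitrary, which allows rewriting in
  front of any remainder.\<close>

lemma comp_assoc:
  assumes "x \<in> M" "cd x = dm y"
  shows "x \<odot> y \<odot> z = x \<odot> (y \<odot> z)"
  using mor_fn[OF morI[OF assms(1)]] assms(2) by (auto simp: mcomp_def compose_def restrict_def)

lemmas comp_simps = mor_def comp_assoc M_comp

section \<open>Rank, kernels, images and factorization\<close>

lemma mor_rank: "x \<in> mor A B \<Longrightarrow> rank x = card (fn x ` A)"
  by (simp add: rank_eq mor_def)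

lemma comp_image: "x \<in> mor A B \<Longrightarrow> fn (x \<odot> y) ` A = fn y ` fn x ` A"
  unfolding image_image by (intro image_cong) (simp_all add: comp_fn[of x A B])

lemma rank_pos: "x \<in> mor A B \<Longrightarrow> 1 \<le> rank x"
  using mor_finite[of x A B] mor_obj[of x A B] C_nonempty[of A] mor_rank[of x A B]
  by (simp add: Suc_le_eq card_gt_0_iff)

lemma rank_comp1:
  assumes "x \<in> mor A B" "y \<in> mor B D"
  shows "rank (x \<odot> y) \<le> rank x"
  unfolding mor_rank[OF comp_mor[OF assms]] mor_rank[OF assms(1)] comp_image[OF assms(1)]
  using mor_finite[OF assms(1)] by (intro card_image_le) simp

lemma rank_comp2:
  assumes "x \<in> mor A B" "y \<in> mor B D"
  shows "rank (x \<odot> y) \<le> rank y"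
proof -
  have "fn y ` fn x ` A \<subseteq> fn y ` B" using mor_fn[OF assms(1)] by auto
  then show ?thesis
    unfolding mor_rank[OF comp_mor[OF assms]] mor_rank[OF assms(2)] comp_image[OF assms(1)]
    using mor_finite[OF assms(1)] by (intro card_mono) auto
qed

text \<open>Inclusion of kernels. It is tested on the domain of x, so it is meaningful for maps with
  a common domain.\<close>

definition ker_le :: "'a morphism \<Rightarrow> 'a morphism \<Rightarrow> bool" where
  "ker_le x y \<longleftrightarrow> (\<forall>a\<in>dm x. \<forall>b\<in>dm x. fn x a = fn x b \<longrightarrow> fn y a = fn y b)"

text \<open>With a regular inverse x' the factor is z = x' y: the points a and a x x' have the same
  image under x, hence under y. The form of z also gives the rank bound that admits it as a
  multiplier.\<close>

lemma ker_le_factor: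
  assumes x: "x \<in> mor A B" and y: "y \<in> mor A D" and k: "ker_le x y"
  obtains z where "z \<in> mor B D" "y = x \<odot> z" "rank z \<le> rank y"
proof -
  obtain x' where x': "x' \<in> mor B A" "\<forall>a\<in>A. fn x (fn x' (fn x a)) = fn x a"
    using M_regular[OF mor_M[OF x]] x by (auto simp only: mor_def mem_Collect_eq)
  have z: "x' \<odot> y \<in> mor B D" by (rule comp_mor[OF x'(1) y])
  have "y = x \<odot> (x' \<odot> y)"
  proof (rule mor_eqI[OF y comp_mor[OF x z]])
    fix a assume a: "a \<in> A"
    have "fn x' (fn x a) \<in> A" using mor_fn[OF x'(1) mor_fn[OF x a]] .
    then have "fn y (fn x' (fn x a)) = fn y a" using k x'(2) a unfolding ker_le_def mor_dm[OF x] by blast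
    then show "fn y a = fn (x \<odot> (x' \<odot> y)) a"
      using comp_fn[OF x a] comp_fn[OF x'(1) mor_fn[OF x a]] by simp
  qed
  then show thesis using that z rank_comp2[OF x'(1) y] by blast
qed

text \<open>The dual choice is z = y x', because x' followed by x fixes the image of x.\<close>

lemma image_factor:
  assumes x: "x \<in> mor A B" and y: "y \<in> mor D B" and i: "fn y ` D \<subseteq> fn x ` A"
  obtains z where "z \<in> mor D A" "y = z \<odot> x" "rank z \<le> rank y"
proof -
  obtain x' where x': "x' \<in> mor B A" "\<forall>a\<in>A. fn x (fn x' (fn x a)) = fn x a"
    using M_regular[OF mor_M[OF x]] x by (auto simp only: mor_def mem_Collect_eq)
  have z: "y \<odot> x' \<in> mor D A" by (rule comp_mor[OF y x'(1)])
  have "y = (y \<odot> x') \<odot> x"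
  proof (rule mor_eqI[OF y comp_mor[OF z x]])
    fix a assume a: "a \<in> D"
    then obtain b where "b \<in> A" "fn y a = fn x b" using i by auto
    then show "fn y a = fn ((y \<odot> x') \<odot> x) a"
      using comp_fn[OF z a] comp_fn[OF y a] x' by simp
  qed
  then show thesis using that z rank_comp1[OF y x'(1)] by blast
qed

lemma ker_le_map:
  assumes "x \<in> mor A B" "ker_le x y"
  shows "\<exists>h. \<forall>a\<in>A. h (fn x a) = fn y a"
proof (intro exI ballI)
  fix a assume a: "a \<in> A"
  let ?P = "\<lambda>b. b \<in> A \<and> fn x b = fn x a"
  have "?P (SOME b. ?P b)" by (rule someI[of ?P a]) (simp add: a)
  then show "(\<lambda>c. fn y (SOME b. b \<in> A \<and> fn x b = c)) (fn x a) = fn y a"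
    using assms(2) a unfolding ker_le_def mor_dm[OF assms(1)] by blast
qed

text \<open>Kernel inclusion gives a map from the image of x onto the image of y; between finite
  sets of equal size it is injective.\<close>

lemma ker_le_rank:
  assumes x: "x \<in> mor A B" and y: "y \<in> mor A D" and k: "ker_le x y"
  shows "rank y \<le> rank x" and "rank x \<le> rank y \<Longrightarrow> ker_le y x"
proof -
  obtain h where h: "\<forall>a\<in>A. h (fn x a) = fn y a" using ker_le_map[OF x k] by blast
  have im: "fn y ` A = h ` fn x ` A" using h by (auto simp: image_image)
  have fin: "finite (fn x ` A)" using mor_finite[OF x] by auto
  show le: "rank y \<le> rank x" unfolding mor_rank[OF x] mor_rank[OF y] im by (rule card_image_le[OF fin])
  assume "rank x \<le> rank y"
  then have "card (h ` fn x ` A) = card (fn x ` A)" using le mor_rank[OF x] mor_rank[OF y] im by simp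
  then have "inj_on h (fn x ` A)" by (rule eq_card_imp_inj_on[OF fin])
  then show "ker_le y x" unfolding ker_le_def mor_dm[OF y] using h by (metis imageI inj_onD)
qed

text \<open>Stability on one side: right multiplication can only enlarge the kernel, and it cannot
  do so properly without losing rank.\<close>

lemma rank_eq_ker:
  assumes "a \<in> mor A B" "b \<in> mor B D" "rank a \<le> rank (a \<odot> b)"
  shows "ker_le a (a \<odot> b)" "ker_le (a \<odot> b) a"
proof -
  show 1: "ker_le a (a \<odot> b)" unfolding ker_le_def mor_dm[OF assms(1)] using comp_fn[OF assms(1)] by auto
  show "ker_le (a \<odot> b) a" by (rule ker_le_rank(2)[OF assms(1) comp_mor[OF assms(1,2)] 1 assms(3)])
qed

text \<open>Stability on the other side: left multiplication can only shrink the image, and equal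
  finite sizes exclude a proper inclusion.\<close>

lemma rank_eq_image:
  assumes "a \<in> mor A B" "b \<in> mor B D" "rank b \<le> rank (a \<odot> b)"
  shows "fn (a \<odot> b) ` A = fn b ` B"
proof -
  have "fn (a \<odot> b) ` A \<subseteq> fn b ` B" using comp_image[OF assms(1)] mor_fn[OF assms(1)] by auto
  then show ?thesis
    using card_subset_eq[of "fn b ` B"] card_mono[of "fn b ` B"] mor_finite[OF assms(1)] assms(3)
      mor_rank[OF assms(2)] mor_rank[OF comp_mor[OF assms(1,2)]]
    by (metis dual_order.antisym finite_imageI)
qed

text \<open>The order isomorphism between U and T is preceded by a retraction of A onto U, and its
  inverse by a retraction of B onto T. Both composites are order-preserving, hence in M, with ranks
  controlled by the prescribed images.\<close>

lemma monotone_transfer: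
  assumes A: "A \<in> C" and B: "B \<in> C" and U: "U \<subseteq> A" and T: "T \<subseteq> B" and c: "card U = card T" "1 \<le> card T"
  obtains k l where "k \<in> mor A B" "l \<in> mor B A" "fn k ` A = T" "fn k ` U = T" "fn l ` B = U"
    "\<And>u. u \<in> U \<Longrightarrow> fn l (fn k u) = u"
proof -
  have fin: "finite U" "finite T" using A B U T C_finite finite_subset by metis+
  have ne: "U \<noteq> {}" "T \<noteq> {}" using c by auto
  obtain f where f: "bij_betw f U T" "mono_rel U (ord A) (ord B) f"
    using order_iso_exists[OF C_linear[OF A] C_linear[OF B] fin(1) U fin(2) T c(1)] by blast
  let ?h = "the_inv_into U f"
  have h: "bij_betw ?h T U" using f(1) bij_betw_the_inv_into by blast
  have hf: "?h (f u) = u" if "u \<in> U" for u using f(1) that by (simp add: bij_betw_def the_inv_into_f_f)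
  have hm: "mono_rel T (ord B) (ord A) ?h"
    unfolding mono_rel_def
  proof (intro ballI impI)
    fix s t assume st: "s \<in> T" "t \<in> T" "(s, t) \<in> ord B"
    then obtain u v where uv: "u \<in> U" "v \<in> U" "s = f u" "t = f v" using f(1) by (auto simp: bij_betw_def)
    have "(u, v) \<in> ord A"
    proof (rule ccontr)
      assume n: "(u, v) \<notin> ord A"
      have "u \<in> A" "v \<in> A" using uv U by auto
      then have "(v, u) \<in> ord A" using n linear_order_onD(4)[OF C_linear[OF A]] by blast
      then have "(t, s) \<in> ord B" using mono_relD[OF f(2)] uv by auto
      then have "s = t" using st linear_order_onD(3)[OF C_linear[OF B]] by blast
      then have "u = v" using uv hf by metis
      then show False using n \<open>u \<in> A\<close> linear_order_onD(1)[OF C_linear[OF A]] by auto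
    qed
    then show "(?h s, ?h t) \<in> ord A" using uv hf by simp
  qed
  obtain p where p: "p \<in> A \<rightarrow> U" "mono_rel A (ord A) (ord A) p" "\<And>x. x \<in> U \<Longrightarrow> p x = x"
    by (rule mono_rel_retraction[OF C_linear[OF A] fin(1) ne(1) U]) auto
  obtain q where q: "q \<in> B \<rightarrow> T" "mono_rel B (ord B) (ord B) q" "\<And>x. x \<in> T \<Longrightarrow> q x = x"
    by (rule mono_rel_retraction[OF C_linear[OF B] fin(2) ne(2) T]) auto
  let ?k = "(A, restrict (f \<circ> p) A, B)" and ?l = "(B, restrict (?h \<circ> q) B, A)"
  have pA: "p ` A = U" using p(1,3) U by (intro equalityI subsetI) (auto simp: image_iff, metis subsetD)
  have qB: "q ` B = T" using q(1,3) T by (intro equalityI subsetI) (auto simp: image_iff, metis subsetD)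
  have fp: "f (p a) \<in> T" if "a \<in> A" for a using f(1) p(1) that by (auto simp: bij_betw_def)
  have hq: "?h (q b) \<in> U" if "b \<in> B" for b using h q(1) that by (auto simp: bij_betw_def)
  have "mono_rel A (ord A) (ord B) (restrict (f \<circ> p) A)"
    using funcset_mem[OF p(1)] p(2) f(2) by (simp add: mono_rel_def)
  moreover have "restrict (f \<circ> p) A \<in> A \<rightarrow>\<^sub>E B" using fp T by auto
  ultimately have k: "?k \<in> mor A B" using M_mono[OF A B] by (simp add: mor_def)
  have "mono_rel B (ord B) (ord A) (restrict (?h \<circ> q) B)"
    using funcset_mem[OF q(1)] q(2) hm by (simp add: mono_rel_def)
  moreover have "restrict (?h \<circ> q) B \<in> B \<rightarrow>\<^sub>E A" using hq U by auto
  ultimately have l: "?l \<in> mor B A" using M_mono[OF B A] by (simp add: mor_def)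
  have fU: "f ` U = T" "?h ` T = U" using f(1) h by (auto simp: bij_betw_def)
  have im: "fn ?k ` A = T" "fn ?l ` B = U"
    using fU pA qB image_image[of f p A] image_image[of ?h q B] by simp_all
  have kU: "fn ?k u = f u" if "u \<in> U" for u using that U p(3) by auto
  then have im2: "fn ?k ` U = T" using fU by auto
  have inv: "fn ?l (fn ?k u) = u" if "u \<in> U" for u
  proof -
    have "f u \<in> T" using that fU by auto
    then show ?thesis using kU[OF that] T q(3) hf[OF that] by auto
  qed
  show thesis by (rule that[OF k l im(1) im2 im(2) inv])
qed

text \<open>If \<open>k\<close> maps the image of \<open>y\<close> bijectively onto a partial transversal of \<open>x\<close>, then
  \<open>k\<close> and \<open>k \<odot> x\<close> have the same kernel, so \<open>k = k \<odot> x \<odot> d\<close> for some \<open>d\<close>.\<close>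

lemma rank_le_factor:
  assumes x: "x \<in> mor A B" and y: "y \<in> mor A' B'" and r: "rank y \<le> rank x"
  obtains a b where "a \<in> mor A' A" "b \<in> mor B B'" "y = a \<odot> x \<odot> b" "rank a \<le> rank y" "rank b \<le> rank y"
proof -
  obtain T where T: "T \<subseteq> A" "inj_on (fn x) T" "card T = rank y"
    using partial_transversal[of A "{}" "fn x" "rank y"] mor_finite[OF x] r mor_rank[OF x] by auto
  let ?U = "fn y ` A'"
  have cU: "card ?U = card T" "1 \<le> card T" using mor_rank[OF y] T rank_pos[OF y] by auto
  have UB: "?U \<subseteq> B'" using mor_fn[OF y] by auto
  obtain k l where kl: "k \<in> mor B' A" "l \<in> mor A B'" "fn k ` B' = T" "fn k ` ?U = T" "fn l ` A = ?U"
    "\<And>u. u \<in> ?U \<Longrightarrow> fn l (fn k u) = u"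
    using monotone_transfer[of B' A, OF _ _ UB T(1) cU] mor_obj x y by blast
  have kx: "k \<odot> x \<in> mor B' B" by (rule comp_mor[OF kl(1) x])
  have "ker_le (k \<odot> x) k" unfolding ker_le_def mor_dm[OF kx]
  proof (intro ballI impI)
    fix a b assume ab: "a \<in> B'" "b \<in> B'" "fn (k \<odot> x) a = fn (k \<odot> x) b"
    then have "fn x (fn k a) = fn x (fn k b)" by (simp add: comp_fn[OF kl(1)])
    then show "fn k a = fn k b" using T(2) kl(3) ab by (metis imageI inj_onD)
  qed
  then obtain d where d: "d \<in> mor B A" "k = k \<odot> x \<odot> d" "rank d \<le> rank k"
    using ker_le_factor[OF kx kl(1)] by metis
  have yk: "y \<odot> k \<in> mor A' A" and dl: "d \<odot> l \<in> mor B B'" and kl': "k \<odot> l \<in> mor B' B'"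
    using comp_mor y kl d by metis+
  \<comment> \<open>The product collapses because k x d = k and l undoes k on the image of
    y.\<close>
  have "(y \<odot> k) \<odot> x \<odot> (d \<odot> l) = y \<odot> ((k \<odot> x \<odot> d) \<odot> l)"
    using y kl(1,2) x d(1) by (simp add: comp_simps)
  also have "\<dots> = y \<odot> (k \<odot> l)" using d(2) by simp
  also have "\<dots> = y"
    by (rule mor_eqI[OF comp_mor[OF y kl'] y])
      (simp add: comp_fn[OF y] comp_fn[OF kl(1) mor_fn[OF y]] kl(6))
  finally have "y = (y \<odot> k) \<odot> x \<odot> (d \<odot> l)" by simp
  moreover have "rank (y \<odot> k) \<le> rank y" by (rule rank_comp1[OF y kl(1)])
  moreover have "rank (d \<odot> l) \<le> rank y"
    using rank_comp2[OF d(1) kl(2)] mor_rank[OF kl(2)] kl(5) mor_rank[OF y] by simp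
  ultimately show thesis using that yk dl by blast
qed

section \<open>Separating different kernels and different images\<close>

lemma image_morphism:
  assumes "A \<in> C" "U \<subseteq> A" "U \<noteq> {}"
  obtains c where "c \<in> mor A A" "fn c ` A = U" "rank c = card U"
proof -
  have "1 \<le> card U" using assms C_finite by (simp add: Suc_le_eq card_gt_0_iff finite_subset)
  then obtain c where "c \<in> mor A A" "fn c ` A = U"
    using monotone_transfer[OF assms(1,1,2,2) refl] by metis
  then show thesis using that mor_rank by metis
qed

text \<open>Two points identified by y but not by x extend to a partial transversal of x with k
  elements; a map with this image keeps k values of x and loses one of y. The size k is left free
  because the induction on rank drops uses it below the rank of x.\<close>

lemma kernel_separation:
  assumes x: "x \<in> mor A B" and y: "y \<in> mor A B'" and k: "2 \<le> k" "k \<le> rank x" and n: "\<not> ker_le y x"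
  obtains c where "c \<in> mor A A" "rank c = k" "rank (c \<odot> x) = k" "rank (c \<odot> y) < k"
proof -
  obtain a b where ab: "a \<in> A" "b \<in> A" "fn y a = fn y b" "fn x a \<noteq> fn x b"
    using n unfolding ker_le_def mor_dm[OF y] by auto
  have "inj_on (fn x) {a, b}" "card {a, b} \<le> k" using ab k by (auto simp: card_insert_if)
  then obtain U where U: "{a, b} \<subseteq> U" "U \<subseteq> A" "inj_on (fn x) U" "card U = k"
    using partial_transversal[of A "{a, b}" "fn x" k] mor_finite[OF x] ab k mor_rank[OF x] by auto
  obtain c where c: "c \<in> mor A A" "fn c ` A = U" "rank c = card U"
    using image_morphism[of A U] U mor_obj[OF x] by blast
  have finU: "finite U" using U(2) mor_finite[OF x] finite_subset by blast
  have "rank (c \<odot> x) = k" using mor_rank[OF comp_mor[OF c(1) x]] comp_image[OF c(1)] c(2) U card_image by metis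
  moreover have "\<not> inj_on (fn y) U" using ab U(1) unfolding inj_on_def by auto
  then have "card (fn y ` U) < k" using card_image_le[OF finU] U(4) finU inj_on_iff_eq_card by (metis le_neq_implies_less)
  then have "rank (c \<odot> y) < k" using mor_rank[OF comp_mor[OF c(1) y]] comp_image[OF c(1)] c(2) by simp
  ultimately show thesis using that c U by auto
qed

text \<open>The order-theoretic separation applied to the two images. Nothing is assumed about the
  kernels, and which product drops is not determined.\<close>

lemma image_separation:
  assumes x: "x \<in> mor A B" and y: "y \<in> mor A' B" and q: "rank x = q" "rank y = q" "2 \<le> q"
    and n: "fn x ` A \<noteq> fn y ` A'"
  obtains c where "c \<in> mor B B" "rank c \<le> q"
    "rank (x \<odot> c) = q \<and> rank (y \<odot> c) < q \<or> rank (y \<odot> c) = q \<and> rank (x \<odot> c) < q"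
proof -
  have B: "B \<in> C" using mor_obj[OF x] by simp
  have UV: "fn x ` A \<subseteq> B" "fn y ` A' \<subseteq> B" "finite (fn x ` A)" "finite (fn y ` A')"
    using mor_fn[OF x] mor_fn[OF y] mor_finite[OF x] mor_finite[OF y] by auto
  obtain g where g: "g \<in> B \<rightarrow> B" "mono_rel B (ord B) (ord B) g" "card (g ` B) \<le> q"
    "card (g ` fn x ` A) = q \<and> card (g ` fn y ` A') < q \<or> card (g ` fn y ` A') = q \<and> card (g ` fn x ` A) < q"
    using mono_rel_separation[OF C_linear[OF B] UV(3,1,4,2) _ _ q(3) n] q mor_rank[OF x] mor_rank[OF y] by auto
  let ?c = "(B, restrict g B, B)"
  have "mono_rel B (ord B) (ord B) (restrict g B)" using g(2) by (auto simp: mono_rel_def)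
  then have c: "?c \<in> mor B B" using M_mono[OF B B] g(1) by (auto simp: mor_def)
  have im: "restrict g B ` fn x ` A = g ` fn x ` A" "restrict g B ` fn y ` A' = g ` fn y ` A'"
    using UV by (auto intro!: image_cong)
  have "rank ?c \<le> q" using g(3) by simp
  moreover have "rank (x \<odot> ?c) = card (g ` fn x ` A)" "rank (y \<odot> ?c) = card (g ` fn y ` A')"
    using mor_rank[OF comp_mor[OF x c]] mor_rank[OF comp_mor[OF y c]] comp_image[OF x] comp_image[OF y] im by simp_all
  ultimately show thesis using that[OF c] g(4) by simp
qed

end

lemma equivI_elem:
  assumes "S \<subseteq> A \<times> A" "\<And>x. x \<in> A \<Longrightarrow> (x, x) \<in> S" "\<And>x y. (x, y) \<in> S \<Longrightarrow> (y, x) \<in> S"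
    "\<And>x y z. (x, y) \<in> S \<Longrightarrow> (y, z) \<in> S \<Longrightarrow> (x, z) \<in> S"
  shows "equiv A S"
proof (rule equivI)
  show "S \<subseteq> A \<times> A" by (rule assms(1))
  show "refl_on A S" using assms(2) by (simp add: refl_on_def)
  show "sym S" using assms(3) by (rule symI)
  show "trans S" using assms(4) by (rule transI)
qed

lemma equivD_elem:
  assumes "equiv A S"
  shows "S \<subseteq> A \<times> A" "\<And>x. x \<in> A \<Longrightarrow> (x, x) \<in> S" "\<And>x y. (x, y) \<in> S \<Longrightarrow> (y, x) \<in> S"
    "\<And>x y z. (x, y) \<in> S \<Longrightarrow> (y, z) \<in> S \<Longrightarrow> (x, z) \<in> S"
proof -
  show "S \<subseteq> A \<times> A" using assms by (auto simp: equiv_def)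
  show "\<And>x. x \<in> A \<Longrightarrow> (x, x) \<in> S" using assms by (simp add: equiv_def refl_on_def)
  show "\<And>x y. (x, y) \<in> S \<Longrightarrow> (y, x) \<in> S" using assms unfolding equiv_def by (meson symD)
  show "\<And>x y z. (x, y) \<in> S \<Longrightarrow> (y, z) \<in> S \<Longrightarrow> (x, z) \<in> S"
    using assms unfolding equiv_def by (meson transD)
qed

declare split_paired_All [simp del] split_paired_Ex [simp del]

section \<open>Congruences on the ideals of bounded rank\<close>

context trans_subcat
begin

definition bounded :: "enat \<Rightarrow> 'a morphism set" where
  "bounded r = {x \<in> M. enat (rank x) \<le> r}"

definition congruence :: "enat \<Rightarrow> 'a morphism rel \<Rightarrow> bool" where
  "congruence r \<sigma> \<longleftrightarrow> equiv (bounded r) \<sigma> \<and>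
     (\<forall>x y. (x, y) \<in> \<sigma> \<longrightarrow> dm x = dm y \<and> cd x = cd y \<and>
       (\<forall>a\<in>bounded r. (cd a = dm x \<longrightarrow> (a \<odot> x, a \<odot> y) \<in> \<sigma>) \<and>
          (cd x = dm a \<longrightarrow> (x \<odot> a, y \<odot> a) \<in> \<sigma>)))"

text \<open>The universal part of the Rees congruence of I_q. The index is a natural number and r
  does not occur, so that levels can be compared by inclusion and a least level can be
  taken.\<close>

definition univ_upto :: "nat \<Rightarrow> 'a morphism rel" where
  "univ_upto q = {(x, y). x \<in> M \<and> y \<in> M \<and> rank x \<le> q \<and> rank y \<le> q \<and> dm x = dm y \<and> cd x = cd y}"

lemma boundedI: "x \<in> mor A B \<Longrightarrow> rank x \<le> q \<Longrightarrow> enat q \<le> r \<Longrightarrow> x \<in> bounded r"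
  by (simp add: bounded_def mor_def order_trans[of "enat (rank x)" "enat q" r])

end

locale trans_congruence = trans_subcat +
  fixes r :: enat and \<sigma> :: "'a morphism rel"
  assumes r: "2 \<le> r" and cong: "congruence r \<sigma>"
begin

lemma sigma_equiv: "equiv (bounded r) \<sigma>"
  using cong by (simp add: congruence_def)

lemmas sigma_sym = equivD_elem(3)[OF sigma_equiv]
  and sigma_trans = equivD_elem(4)[OF sigma_equiv]
  and sigma_refl = equivD_elem(2)[OF sigma_equiv]

lemma sigma_bounded: "(x, y) \<in> \<sigma> \<Longrightarrow> x \<in> bounded r \<and> y \<in> bounded r"
  using equivD_elem(1)[OF sigma_equiv] by auto

lemma sigma_mor:
  assumes "(x, y) \<in> \<sigma>"
  obtains A B where "x \<in> mor A B" "y \<in> mor A B"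
proof -
  have "dm x = dm y" "cd x = cd y" using cong assms unfolding congruence_def by blast+
  moreover have "x \<in> M" "y \<in> M" using sigma_bounded[OF assms] by (simp_all add: bounded_def)
  ultimately show thesis using that[of "dm x" "cd x"] by (simp add: mor_def)
qed

lemma sigma_left: "(x, y) \<in> \<sigma> \<Longrightarrow> x \<in> mor A B \<Longrightarrow> a \<in> mor A' A \<Longrightarrow> enat (rank a) \<le> r \<Longrightarrow> (a \<odot> x, a \<odot> y) \<in> \<sigma>"
  using cong by (simp add: congruence_def bounded_def mor_def)

lemma sigma_right: "(x, y) \<in> \<sigma> \<Longrightarrow> x \<in> mor A B \<Longrightarrow> b \<in> mor B B' \<Longrightarrow> enat (rank b) \<le> r \<Longrightarrow> (x \<odot> b, y \<odot> b) \<in> \<sigma>"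
  using cong by (simp add: congruence_def bounded_def mor_def)

lemma sigma_rank: "(x, y) \<in> \<sigma> \<Longrightarrow> enat (rank x) \<le> r \<and> enat (rank y) \<le> r"
  using sigma_bounded by (simp add: bounded_def)

lemma enat_le_r: "m \<le> n \<Longrightarrow> enat n \<le> r \<Longrightarrow> enat m \<le> r"
  by (meson enat_ord_simps(1) order_trans)

lemma two_le_r: "enat 2 \<le> r"
  using r by (simp add: numeral_eq_enat)

text \<open>Composing \<open>x\<close> and \<open>y\<close> with a constant map on the left gives two different constant maps, and
  a monotone map of rank 2 sends their values to those of any two given constant maps.\<close>

lemma univ_upto_1:
  assumes xy: "(x, y) \<in> \<sigma>" and ne: "x \<noteq> y"
  shows "univ_upto 1 \<subseteq> \<sigma>"
proof
  fix p assume "p \<in> univ_upto 1"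
  then obtain z w where p: "p = (z, w)" and zw: "z \<in> M" "w \<in> M" "rank z \<le> 1" "rank w \<le> 1" "dm z = dm w" "cd z = cd w"
    by (auto simp: univ_upto_def)
  obtain A B where x: "x \<in> mor A B" and y: "y \<in> mor A B" using sigma_mor[OF xy] by blast
  obtain a where a: "a \<in> A" "fn x a \<noteq> fn y a" using ne mor_eqI[OF x y] by blast
  define A' D where "A' = dm z" and "D = cd z"
  have z: "z \<in> mor A' D" and w: "w \<in> mor A' D" using zw by (simp_all add: mor_def A'_def D_def)
  have one: "enat 1 \<le> r" using enat_le_r[OF _ two_le_r] by simp
  have "rank z = 1" "rank w = 1" using zw rank_pos[OF z] rank_pos[OF w] by auto
  then obtain d e where d: "fn z ` A' = {d}" and e: "fn w ` A' = {e}"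
    using mor_rank[OF z] mor_rank[OF w] card_1_singletonE by metis
  have "A' \<noteq> {}" using mor_obj[OF z] C_nonempty by blast
  then obtain b0 where b0: "b0 \<in> A'" by blast
  have zv: "fn z b = d" "fn w b = e" if "b \<in> A'" for b
    using imageI[OF that, of "fn z"] imageI[OF that, of "fn w"] d e by simp_all
  then have dD: "d \<in> D" "e \<in> D" using mor_fn[OF z b0] mor_fn[OF w b0] b0 by simp_all
  show "p \<in> \<sigma>"
  proof (cases "d = e")
    case True
    have "fn z b = fn w b" if "b \<in> A'" for b using zv[OF that] True by simp
    then have "z = w" by (rule mor_eqI[OF z w])
    then show ?thesis using sigma_refl boundedI[OF z zw(3) one] p by simp
  next
    case False
    obtain k where k: "k \<in> mor B D" "fn k ` B = {d, e}" "fn k ` {fn x a, fn y a} = {d, e}"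
    proof (rule monotone_transfer[of B D "{fn x a, fn y a}" "{d, e}"])
      show "B \<in> C" "D \<in> C" using mor_obj[OF x] mor_obj[OF z] by simp_all
      show "{fn x a, fn y a} \<subseteq> B" using mor_fn[OF x a(1)] mor_fn[OF y a(1)] by simp
    qed (use dD a(2) False in simp_all)
    have rk: "enat (rank k) \<le> r" using mor_rank[OF k(1)] k(2) False two_le_r by (simp add: numeral_2_eq_2)
    \<comment> \<open>\<open>monotone_transfer\<close> matches sets of equal size, so an arbitrary
      point of \<open>A'\<close> is paired with a; only the constant value a matters.\<close>
    obtain c where c: "c \<in> mor A' A" "fn c ` A' = {a}"
    proof (rule monotone_transfer[of A' A "{SOME b. b \<in> A'}" "{a}"])
      show "A' \<in> C" "A \<in> C" using mor_obj[OF x] mor_obj[OF z] by simp_all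
      show "{SOME b. b \<in> A'} \<subseteq> A'" using \<open>A' \<noteq> {}\<close> some_in_eq by auto
    qed (use a(1) in simp_all)
    have rc: "enat (rank c) \<le> r" using mor_rank[OF c(1)] c(2) one by simp
    have cx: "c \<odot> x \<in> mor A' B" and cy: "c \<odot> y \<in> mor A' B" using comp_mor c x y by blast+
    have s: "(c \<odot> x \<odot> k, c \<odot> y \<odot> k) \<in> \<sigma>" by (rule sigma_right[OF sigma_left[OF xy x c(1) rc] cx k(1) rk])
    have ca: "fn c b = a" if "b \<in> A'" for b using c(2) that by auto
    have val: "fn (c \<odot> x \<odot> k) b = fn k (fn x a)" "fn (c \<odot> y \<odot> k) b = fn k (fn y a)" if "b \<in> A'" for b
      using that by (simp_all add: comp_fn[OF cx] comp_fn[OF cy] comp_fn[OF c(1)] ca)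
    have cxk: "c \<odot> x \<odot> k \<in> mor A' D" "c \<odot> y \<odot> k \<in> mor A' D" using comp_mor cx cy k by blast+
    \<comment> \<open>Being monotone, k sends the smaller value to the smaller one, so it may
      exchange the roles of d and e. Symmetry of \<sigma> absorbs this.\<close>
    have "fn k (fn x a) = d \<and> fn k (fn y a) = e \<or> fn k (fn x a) = e \<and> fn k (fn y a) = d"
      using k(3) False by (auto simp: doubleton_eq_iff)
    then show ?thesis
    proof
      assume h: "fn k (fn x a) = d \<and> fn k (fn y a) = e"
      have "c \<odot> x \<odot> k = z" by (rule mor_eqI[OF cxk(1) z]) (simp add: val zv h)
      moreover have "c \<odot> y \<odot> k = w" by (rule mor_eqI[OF cxk(2) w]) (simp add: val zv h)
      ultimately show ?thesis using s p by simp
    next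
      assume h: "fn k (fn x a) = e \<and> fn k (fn y a) = d"
      have "c \<odot> x \<odot> k = w" by (rule mor_eqI[OF cxk(1) w]) (simp add: val zv h)
      moreover have "c \<odot> y \<odot> k = z" by (rule mor_eqI[OF cxk(2) z]) (simp add: val zv h)
      ultimately show ?thesis using sigma_sym[OF s] p by simp
    qed
  qed
qed

text \<open>Everything of rank at most \<open>q\<close> is \<open>\<sigma>\<close>-related to something of rank at most \<open>rank y\<close>; restricting
  \<open>x\<close> and \<open>y\<close> to a suitable subset shows inductively that \<open>univ_upto (rank y) \<subseteq> \<sigma>\<close>.\<close>

lemma univ_upto_rank_drop:
  assumes "(x, y) \<in> \<sigma>" "rank x = q" "rank y < q"
  shows "univ_upto q \<subseteq> \<sigma>"
  using assms
proof (induction q arbitrary: x y rule: less_induct)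
  case (less q)
  obtain A B where x: "x \<in> mor A B" and y: "y \<in> mor A B" using sigma_mor[OF less.prems(1)] by blast
  define k where "k = rank y"
  have kq: "1 \<le> k" "k < q" using rank_pos[OF y] less.prems by (simp_all add: k_def)
  have qr: "enat q \<le> r" using sigma_rank[OF less.prems(1)] less.prems(2) by simp
  have k: "univ_upto k \<subseteq> \<sigma>"
  proof (cases "k = 1")
    case True
    have "x \<noteq> y" using less.prems by auto
    then show ?thesis using univ_upto_1[OF less.prems(1)] True by simp
  next
    case False
    \<comment> \<open>Separating at size k = \<open>rank y\<close> yields a related pair of rank k
      and of smaller rank, to which the induction hypothesis for k < q applies.\<close>
    have "\<not> ker_le y x" using ker_le_rank(1)[OF y x] less.prems by auto
    then obtain c where c: "c \<in> mor A A" "rank c = k" "rank (c \<odot> x) = k" "rank (c \<odot> y) < k"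
      using kernel_separation[OF x y, of k] kq False less.prems by auto
    have "(c \<odot> x, c \<odot> y) \<in> \<sigma>"
      using sigma_left[OF less.prems(1) x c(1)] enat_le_r[OF _ qr] c(2) kq by simp
    then show ?thesis using less.IH[OF kq(2)] c by blast
  qed
  have *: "\<exists>z'\<in>M. (z, z') \<in> \<sigma> \<and> rank z' \<le> k \<and> dm z' = dm z \<and> cd z' = cd z" if z: "z \<in> M" "rank z \<le> q" for z
  proof -
    obtain a b where ab: "a \<in> mor (dm z) A" "b \<in> mor B (cd z)" "z = a \<odot> x \<odot> b" "rank a \<le> rank z" "rank b \<le> rank z"
      using rank_le_factor[OF x morI[OF z(1)]] z(2) less.prems(2) by metis
    have ax: "a \<odot> x \<in> mor (dm z) B" and ay: "a \<odot> y \<in> mor (dm z) B" using comp_mor ab x y by blast+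
    have "(a \<odot> x \<odot> b, a \<odot> y \<odot> b) \<in> \<sigma>"
      using ab(4,5) z(2) enat_le_r[OF _ qr]
      by (intro sigma_right[OF sigma_left[OF less.prems(1) x ab(1)] ax ab(2)]) auto
    moreover have "rank (a \<odot> y \<odot> b) \<le> k"
      using rank_comp1[OF ay ab(2)] rank_comp2[OF ab(1) y] by (simp add: k_def)
    moreover have "a \<odot> y \<odot> b \<in> mor (dm z) (cd z)" by (rule comp_mor[OF ay ab(2)])
    ultimately show ?thesis unfolding ab(3)[symmetric] by (auto simp only: mor_def mem_Collect_eq)
  qed
  show ?case
  proof
    fix p assume "p \<in> univ_upto q"
    then obtain z w where p: "p = (z, w)" and zw: "z \<in> M" "w \<in> M" "rank z \<le> q" "rank w \<le> q" "dm z = dm w" "cd z = cd w"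
      by (auto simp: univ_upto_def)
    obtain z' where z': "z' \<in> M" "(z, z') \<in> \<sigma>" "rank z' \<le> k" "dm z' = dm z" "cd z' = cd z"
      using *[OF zw(1,3)] by blast
    obtain w' where w': "w' \<in> M" "(w, w') \<in> \<sigma>" "rank w' \<le> k" "dm w' = dm w" "cd w' = cd w"
      using *[OF zw(2,4)] by blast
    have "(z', w') \<in> univ_upto k" using z' w' zw by (simp add: univ_upto_def)
    then have "(z', w') \<in> \<sigma>" using k by blast
    then show "p \<in> \<sigma>" using z'(2) w'(2) sigma_trans sigma_sym p by blast
  qed
qed

text \<open>Only one kernel inclusion appears in the hypothesis: at equal rank it implies the other
  one.\<close>

lemma univ_upto_not_H:
  assumes xy: "(x, y) \<in> \<sigma>" and q: "rank x = q" "rank y \<le> q" "2 \<le> q"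
    and n: "\<not> (ker_le y x \<and> fn x ` dm x = fn y ` dm y)"
  shows "univ_upto q \<subseteq> \<sigma>"
proof (cases "rank y = q")
  case False
  then show ?thesis using univ_upto_rank_drop[OF xy q(1)] q by simp
next
  case True
  have qr: "enat q \<le> r" using sigma_rank[OF xy] q(1) by simp
  obtain A B where x: "x \<in> mor A B" and y: "y \<in> mor A B" using sigma_mor[OF xy] by blast
  show ?thesis
  proof (cases "ker_le y x")
    case False
    obtain c where c: "c \<in> mor A A" "rank c = q" "rank (c \<odot> x) = q" "rank (c \<odot> y) < q"
      using kernel_separation[OF x y q(3) _ False] q by auto
    have "(c \<odot> x, c \<odot> y) \<in> \<sigma>" using sigma_left[OF xy x c(1)] qr c(2) by simp
    then show ?thesis using univ_upto_rank_drop c by blast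
  next
    case ker: True
    have "fn x ` A \<noteq> fn y ` A" using n ker mor_dm[OF x] mor_dm[OF y] by simp
    then obtain c where c: "c \<in> mor B B" "rank c \<le> q"
      "rank (x \<odot> c) = q \<and> rank (y \<odot> c) < q \<or> rank (y \<odot> c) = q \<and> rank (x \<odot> c) < q"
      using image_separation[OF x y q(1) True q(3)] by blast
    have "(x \<odot> c, y \<odot> c) \<in> \<sigma>" using sigma_right[OF xy x c(1)] enat_le_r[OF c(2) qr] by simp
    then show ?thesis using univ_upto_rank_drop c(3) sigma_sym by blast
  qed
qed

text \<open>In the \<open>\<H>\<close>-related case, removing a point where \<open>x\<close> and \<open>y\<close> differ from a transversal of
  their common kernel produces a pair of rank \<open>q\<close> with different images.\<close>

lemma univ_upto_pred:
  assumes xy: "(x, y) \<in> \<sigma>" and ne: "x \<noteq> y" and q: "rank x = Suc q" "rank y \<le> Suc q" "1 \<le> q"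
  shows "univ_upto q \<subseteq> \<sigma>"
proof (cases "ker_le y x \<and> fn x ` dm x = fn y ` dm y")
  case False
  have "univ_upto (Suc q) \<subseteq> \<sigma>" using univ_upto_not_H[OF xy q(1,2) _ False] q(3) by simp
  moreover have "univ_upto q \<subseteq> univ_upto (Suc q)" by (auto simp: univ_upto_def)
  ultimately show ?thesis by blast
next
  case H: True
  show ?thesis
  proof (cases "q = 1")
    case True
    \<comment> \<open>Images are separated only from rank 2 on, so the level q = 1 relies on the
      constants instead.\<close>
    then show ?thesis using univ_upto_1[OF xy ne] by simp
  next
    case False
    have qr: "enat (Suc q) \<le> r" using sigma_rank[OF xy] q(1) by simp
    obtain A B where x: "x \<in> mor A B" and y: "y \<in> mor A B" using sigma_mor[OF xy] by blast
    have im: "fn x ` A = fn y ` A" using H mor_dm[OF x] mor_dm[OF y] by simp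
    then have ranks: "rank x = rank y" using mor_rank[OF x] mor_rank[OF y] by simp
    then have ker: "ker_le x y" using ker_le_rank(2)[OF y x] H by simp
    obtain a where a: "a \<in> A" "fn x a \<noteq> fn y a" using ne mor_eqI[OF x y] by blast
    obtain U where U: "{a} \<subseteq> U" "U \<subseteq> A" "inj_on (fn x) U" "card U = Suc q"
      using partial_transversal[of A "{a}" "fn x" "Suc q"] mor_finite[OF x] a(1) q(1) mor_rank[OF x] by auto
    have finU: "finite U" using U(2) mor_finite[OF x] finite_subset by blast
    have injy: "inj_on (fn y) U"
      using U(2,3) H unfolding ker_le_def mor_dm[OF y] inj_on_def by blast
    have cU: "card (U - {a}) = q" using U finU by simp
    have ne': "U - {a} \<noteq> {}" using cU q(3) by (metis card.empty not_one_le_zero)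
    obtain c where c: "c \<in> mor A A" "fn c ` A = U - {a}" "rank c = q"
      using image_morphism[of A "U - {a}"] U(2) ne' cU mor_obj[OF x] by blast
    have s: "(c \<odot> x, c \<odot> y) \<in> \<sigma>" using sigma_left[OF xy x c(1)] enat_le_r[OF _ qr] c(3) by simp
    \<comment> \<open>U is a transversal of x and of y, and both have the same image. Omitting a
      therefore removes \<open>fn x a\<close> from one image and \<open>fn y a\<close> from the
      other, and these values differ.\<close>
    have full: "fn x ` U = fn x ` A" "fn y ` U = fn y ` A"
      using U(2,4) q(1) ranks mor_rank[OF x] mor_rank[OF y] card_image[OF U(3)] card_image[OF injy] mor_finite[OF x]
      by (simp_all add: card_subset_eq image_mono)
    have im': "fn (c \<odot> x) ` A = fn x ` A - {fn x a}" "fn (c \<odot> y) ` A = fn y ` A - {fn y a}"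
      unfolding comp_image[OF c(1)] c(2) full[symmetric]
      using inj_on_image_set_diff[OF U(3), of U "{a}"] inj_on_image_set_diff[OF injy, of U "{a}"] U(1) by auto
    have cx: "c \<odot> x \<in> mor A B" and cy: "c \<odot> y \<in> mor A B" using comp_mor c x y by blast+
    have "fn x ` A - {fn x a} \<noteq> fn y ` A - {fn y a}" using a im by blast
    then have diff: "fn (c \<odot> x) ` dm (c \<odot> x) \<noteq> fn (c \<odot> y) ` dm (c \<odot> y)"
      unfolding mor_dm[OF cx] mor_dm[OF cy] im' .
    have "finite (fn x ` A)" "fn x a \<in> fn x ` A" "fn y a \<in> fn y ` A" using a(1) mor_finite[OF x] by auto
    then have rk: "rank (c \<odot> x) = q" "rank (c \<odot> y) = q"
      unfolding mor_rank[OF cx] mor_rank[OF cy] im' using q(1) ranks mor_rank[OF x] mor_rank[OF y] by simp_all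
    show ?thesis using univ_upto_not_H[OF s rk(1)] rk(2) False q(3) diff by simp
  qed
qed

end

section \<open>Group classes and the relations \<open>\<nu>\<^sub>N\<close>\<close>

lemma trans_cat_simps [simp]:
  "dom_of (trans_cat C) x = dm x" "rng_of (trans_cat C) x = cd x" "pmult (trans_cat C) x y = x \<odot> y"
  by (auto simp: trans_cat_def mcomp_def split: prod.split)

context trans_subcat
begin

abbreviation Q :: "('a morphism, 'a set) psemigroup" where
  "Q \<equiv> restrict_to (trans_cat C) M"

abbreviation Qr :: "enat \<Rightarrow> ('a morphism, 'a set) psemigroup" where
  "Qr r \<equiv> restrict_to (trans_cat C) (bounded r)"

lemma rank_ideal_Q: "rank_ideal Q r = bounded r"
  by (auto simp: rank_ideal_def bounded_def)

text \<open>The guards in \<open>composable\<close> reduce to matching objects, since related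
  elements and multipliers already lie in the ideal.\<close>

lemma Cong_Qr: "Cong (Qr r) = {\<sigma>. congruence r \<sigma>}"
proof -
  have ball: "(\<forall>(x, y)\<in>\<sigma>. P x y) \<longleftrightarrow> (\<forall>x y. (x, y) \<in> \<sigma> \<longrightarrow> P x y)" for P and \<sigma> :: "'a morphism rel"
    by blast
  have bd: "x \<in> bounded r" if "equiv (bounded r) \<sigma>" "(x, y) \<in> \<sigma>" for x y \<sigma>
    using equivD_elem(1)[OF that(1)] that(2) by blast
  have "Cong (Qr r) = {\<sigma>. equiv (bounded r) \<sigma> \<and> (\<forall>x y. (x, y) \<in> \<sigma> \<longrightarrow> (dm x = dm y \<and> cd x = cd y) \<and>
      (\<forall>a\<in>bounded r. (a \<in> bounded r \<and> x \<in> bounded r \<and> cd a = dm x \<longrightarrow> (a \<odot> x, a \<odot> y) \<in> \<sigma>) \<and>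
        (x \<in> bounded r \<and> a \<in> bounded r \<and> cd x = dm a \<longrightarrow> (x \<odot> a, y \<odot> a) \<in> \<sigma>)))}"
    unfolding Cong_def ball parallel_def composable_def by simp
  also have "\<dots> = {\<sigma>. congruence r \<sigma>}"
    unfolding congruence_def
    by (intro Collect_cong conj_cong refl) (meson bd)
  finally show ?thesis .
qed

lemma ker_le_trans: "dm x = dm y \<Longrightarrow> ker_le x y \<Longrightarrow> ker_le y z \<Longrightarrow> ker_le x z"
  unfolding ker_le_def by blast

lemma ker_le_comp:
  assumes "a \<in> mor A B"
  shows "ker_le a (a \<odot> b)"
  unfolding ker_le_def mor_dm[OF assms] using comp_fn[OF assms] by auto

lemma ker_le_comp_mono:
  assumes k: "ker_le x y" and x: "x \<in> mor A B" and c: "c \<in> mor A' A"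
  shows "ker_le (c \<odot> x) (c \<odot> y)"
  unfolding ker_le_def comp_dm mor_dm[OF c]
proof (intro ballI impI)
  fix a b assume ab: "a \<in> A'" "b \<in> A'" "fn (c \<odot> x) a = fn (c \<odot> x) b"
  then have "fn x (fn c a) = fn x (fn c b)" using comp_fn[OF c] by simp
  then have "fn y (fn c a) = fn y (fn c b)"
    using k mor_fn[OF c ab(1)] mor_fn[OF c ab(2)] unfolding ker_le_def mor_dm[OF x] by blast
  then show "fn (c \<odot> y) a = fn (c \<odot> y) b" using comp_fn[OF c] ab by simp
qed

text \<open>Green's relation H in concrete form, as \<open>greenH_iff\<close> confirms: parallel
  maps with equal kernels and equal images.\<close>

definition H_rel :: "'a morphism \<Rightarrow> 'a morphism \<Rightarrow> bool" where
  "H_rel x y \<longleftrightarrow> dm x = dm y \<and> cd x = cd y \<and> ker_le x y \<and> ker_le y x \<and> fn x ` dm x = fn y ` dm y"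

lemma H_rel_sym: "H_rel x y \<Longrightarrow> H_rel y x"
  unfolding H_rel_def by (elim conjE, intro conjI) (rule sym, assumption | assumption)+

lemma H_rel_trans:
  assumes xy: "H_rel x y" and yz: "H_rel y z"
  shows "H_rel x z"
proof -
  have "ker_le x z" "ker_le z x"
    using ker_le_trans[of x y z] ker_le_trans[of z y x] xy yz unfolding H_rel_def by simp_all
  moreover have "fn x ` dm x = fn z ` dm z" using xy yz unfolding H_rel_def by argo
  ultimately show ?thesis using xy yz unfolding H_rel_def by simp
qed

text \<open>Equal kernels remain equal after left multiplication, and the rank depends on the kernel
  only. Thus related elements lose rank together.\<close>

lemma H_rel_left:
  assumes "H_rel x y" "x \<in> mor A B" "y \<in> mor A B" "c \<in> mor A' A"
  shows "rank (c \<odot> x) = rank (c \<odot> y)"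
proof -
  have m: "c \<odot> x \<in> mor A' B" "c \<odot> y \<in> mor A' B" using assms(2-4) comp_mor by blast+
  have k: "ker_le x y" "ker_le y x" using assms(1) by (simp_all add: H_rel_def)
  show ?thesis
    using ker_le_rank(1)[OF m ker_le_comp_mono[OF k(1) assms(2,4)]]
      ker_le_rank(1)[OF m(2,1) ker_le_comp_mono[OF k(2) assms(3,4)]] by simp
qed

lemma H_rel_right:
  assumes "H_rel x y" "x \<in> mor A B" "y \<in> mor A B" "c \<in> mor B B'"
  shows "rank (x \<odot> c) = rank (y \<odot> c)"
proof -
  have "fn x ` A = fn y ` A" using assms(1) unfolding H_rel_def mor_dm[OF assms(2)] mor_dm[OF assms(3)] by simp
  then show ?thesis
    unfolding mor_rank[OF comp_mor[OF assms(2,4)]] mor_rank[OF comp_mor[OF assms(3,4)]]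
      comp_image[OF assms(2)] comp_image[OF assms(3)] by simp
qed

text \<open>By regularity, a map with larger kernel is a right multiple of x; this turns Green's R
  into equality of kernels. The dual statement does the same for L and images.\<close>

lemma principal_right:
  assumes "x \<in> M"
  shows "{mult_r Q x b | b. b \<in> carrier1 Q \<and> composable_r Q x b} = {w \<in> M. dm w = dm x \<and> ker_le x w}"
    (is "?L = ?R")
proof (intro equalityI subsetI)
  fix w assume "w \<in> ?L"
  then obtain b where b: "w = mult_r Q x b" "composable_r Q x b" by blast
  show "w \<in> ?R"
  proof (cases b)
    case None
    then show ?thesis using b assms by (simp add: ker_le_def)
  next
    case (Some c)
    then show ?thesis using b assms ker_le_comp[OF morI[OF assms]] by (simp add: composable_def M_comp)
  qed
next
  fix w assume "w \<in> ?R"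
  then have w: "w \<in> mor (dm x) (cd w)" "ker_le x w" by (simp_all add: mor_def)
  obtain z where z: "z \<in> mor (cd x) (cd w)" "w = x \<odot> z" using ker_le_factor[OF morI[OF assms] w] by blast
  then have "w = mult_r Q x (Some z)" "Some z \<in> carrier1 Q" "composable_r Q x (Some z)"
    using assms by (simp_all add: carrier1_def composable_def mor_def)
  then show "w \<in> ?L" by blast
qed

lemma principal_left:
  assumes "x \<in> M"
  shows "{mult_l Q a x | a. a \<in> carrier1 Q \<and> composable_l Q a x} = {w \<in> M. cd w = cd x \<and> fn w ` dm w \<subseteq> fn x ` dm x}"
    (is "?L = ?R")
proof (intro equalityI subsetI)
  fix w assume "w \<in> ?L"
  then obtain b where b: "w = mult_l Q b x" "composable_l Q b x" by blast
  show "w \<in> ?R"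
  proof (cases b)
    case None
    then show ?thesis using b assms by simp
  next
    case (Some c)
    then have c: "c \<in> mor (dm c) (dm x)" "w = c \<odot> x" using b by (simp_all add: composable_def mor_def)
    have "fn w ` dm c \<subseteq> fn x ` dm x" using comp_image[OF c(1)] mor_fn[OF c(1)] c(2) by auto
    then show ?thesis using c assms by (simp add: mor_def M_comp)
  qed
next
  fix w assume "w \<in> ?R"
  then have w: "w \<in> mor (dm w) (cd x)" "fn w ` dm w \<subseteq> fn x ` dm x" by (simp_all add: mor_def)
  obtain z where z: "z \<in> mor (dm w) (dm x)" "w = z \<odot> x" using image_factor[OF morI[OF assms] w] by blast
  then have "w = mult_l Q (Some z) x" "Some z \<in> carrier1 Q" "composable_l Q (Some z) x"
    using assms by (simp_all add: carrier1_def composable_def mor_def)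
  then show "w \<in> ?L" by blast
qed

lemma greenH_iff: "(x, y) \<in> greenH Q \<longleftrightarrow> x \<in> M \<and> y \<in> M \<and> H_rel x y"
proof (cases "x \<in> M \<and> y \<in> M")
  case True
  then have M: "x \<in> M" "y \<in> M" by simp_all
  define R where "R z = {w \<in> M. dm w = dm z \<and> ker_le z w}" for z
  define L where "L z = {w \<in> M. cd w = cd z \<and> fn w ` dm w \<subseteq> fn z ` dm z}" for z
  have self: "z \<in> R z" if "z \<in> M" for z using that by (simp add: R_def ker_le_def)
  have "R x = R y \<longleftrightarrow> dm x = dm y \<and> ker_le x y \<and> ker_le y x"
  proof
    assume "R x = R y"
    then have "y \<in> R x" "x \<in> R y" using self[OF M(1)] self[OF M(2)] by blast+
    then show "dm x = dm y \<and> ker_le x y \<and> ker_le y x" by (simp add: R_def)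
  next
    assume h: "dm x = dm y \<and> ker_le x y \<and> ker_le y x"
    then have "ker_le x w \<longleftrightarrow> ker_le y w" for w using ker_le_trans[of x y w] ker_le_trans[of y x w] by metis
    then show "R x = R y" using h by (simp add: R_def)
  qed
  moreover have "L x = L y \<longleftrightarrow> cd x = cd y \<and> fn x ` dm x = fn y ` dm y"
  proof
    assume "L x = L y"
    moreover have "x \<in> L x" "y \<in> L y" using M by (simp_all add: L_def)
    ultimately have "x \<in> L y" "y \<in> L x" by blast+
    then show "cd x = cd y \<and> fn x ` dm x = fn y ` dm y" by (simp add: L_def subset_antisym)
  qed (simp add: L_def)
  moreover have "(x, y) \<in> greenH Q \<longleftrightarrow> R x = R y \<and> L x = L y"
    unfolding greenH_def greenR_def greenL_def R_def L_def
    using M principal_right[OF M(1)] principal_right[OF M(2)] principal_left[OF M(1)] principal_left[OF M(2)] by simp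
  ultimately show ?thesis using M by (simp add: H_rel_def) blast
next
  case False
  then show ?thesis by (auto simp: greenH_def greenR_def)
qed

end

locale trans_group = trans_subcat +
  fixes p :: nat and H :: "'a morphism set"
  assumes H_class: "group_H_class Q H" and H_rank: "H \<subseteq> rank_class Q p"
begin

abbreviation Grp :: "'a morphism monoid" where "Grp \<equiv> class_group Q H"

lemma Grp_carrier [simp]: "carrier Grp = H" and Grp_mult [simp]: "mult Grp = (\<odot>)"
  by (auto simp: class_group_def fun_eq_iff)

sublocale G: group Grp using H_class by (simp add: group_H_class_def)

definition e :: "'a morphism" where "e = \<one>\<^bsub>Grp\<^esub>"

definition Ob :: "'a set" where "Ob = dm e"

lemma e_H [simp]: "e \<in> H"
  using G.one_closed by (simp add: e_def)

lemma H_simps [simp]: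
  assumes "x \<in> H"
  shows "x \<in> M" "dm x = Ob" "cd x = Ob" "rank x = p"
proof -
  have "composable Q x e" "composable Q e x" using H_class assms by (auto simp: group_H_class_def)
  then have "cd x = Ob" "x \<in> M" "dm x = cd e" by (simp_all add: composable_def Ob_def)
  moreover have "composable Q e e" using H_class by (auto simp: group_H_class_def)
  then have "cd e = Ob" by (simp add: composable_def Ob_def)
  ultimately show "x \<in> M" "dm x = Ob" "cd x = Ob" by simp_all
  show "rank x = p" using H_rank assms by (auto simp: rank_class_def)
qed

lemma H_mor: "x \<in> H \<Longrightarrow> x \<in> mor Ob Ob"
  by (simp add: mor_def)

lemma e_simps [simp]:
  assumes "x \<in> H"
  shows "e \<odot> x = x" "x \<odot> e = x" "e \<odot> (x \<odot> z) = x \<odot> z" "x \<odot> (e \<odot> z) = x \<odot> z"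
proof -
  show 1: "e \<odot> x = x" "x \<odot> e = x" using G.l_one G.r_one assms by (simp_all add: e_def)
  show "e \<odot> (x \<odot> z) = x \<odot> z" using comp_assoc[of e x z] 1 assms by simp
  show "x \<odot> (e \<odot> z) = x \<odot> z" using comp_assoc[of x e z] 1 assms by simp
qed

text \<open>H is given as the class of an unnamed element; it contains e, so it is the class of e,
  and membership becomes a test of kernel and image.\<close>

lemma H_iff: "x \<in> H \<longleftrightarrow> x \<in> M \<and> H_rel e x"
proof -
  obtain h where h: "H = greenH Q `` {h}"
    using H_class by (auto simp: group_H_class_def quotient_def)
  have *: "z \<in> H \<longleftrightarrow> h \<in> M \<and> z \<in> M \<and> H_rel h z" for z
    by (subst h) (simp add: greenH_iff)
  then have he: "h \<in> M" "H_rel h e" using e_H by blast+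
  show ?thesis
  proof
    assume "x \<in> H"
    then show "x \<in> M \<and> H_rel e x" using * H_rel_trans[OF H_rel_sym[OF he(2)]] by blast
  next
    assume "x \<in> M \<and> H_rel e x"
    then show "x \<in> H" using * he(1) H_rel_trans[OF he(2)] by blast
  qed
qed

text \<open>The kernel of e w e contains that of e, and its image is contained in that of e. Without
  loss of rank both inclusions are equalities.\<close>

lemma sandwich_H:
  assumes w: "w \<in> mor Ob Ob" and r: "p \<le> rank (e \<odot> w \<odot> e)"
  shows "e \<odot> w \<odot> e \<in> H"
proof -
  have e: "e \<in> mor Ob Ob" by (simp add: H_mor)
  have we: "w \<odot> e \<in> mor Ob Ob" and ew: "e \<odot> w \<in> mor Ob Ob" and m: "e \<odot> w \<odot> e \<in> mor Ob Ob"
    using comp_mor w e by blast+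
  have eq: "e \<odot> w \<odot> e = e \<odot> (w \<odot> e)" using w by (simp add: comp_simps)
  have k: "ker_le e (e \<odot> w \<odot> e)" "ker_le (e \<odot> w \<odot> e) e"
    using rank_eq_ker[OF e we] r unfolding eq by simp_all
  have "fn (e \<odot> w \<odot> e) ` Ob = fn e ` Ob" using rank_eq_image[OF ew e] r by simp
  then show ?thesis using k m unfolding H_iff H_rel_def by (simp add: mor_def)
qed

text \<open>If a e b has rank p, so have a e and e b, and e is recovered from them by a left factor
  u and a right factor v. The versions with a remainder z serve cancellation inside right-nested
  products.\<close>

lemma local_inverses:
  assumes a: "a \<in> mor A Ob" and b: "b \<in> mor Ob B" and r: "rank (a \<odot> e \<odot> b) = p"
  obtains u v where "u \<in> mor Ob A" "v \<in> mor B Ob" "rank u \<le> p" "rank v \<le> p"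
    "\<And>z. u \<odot> (a \<odot> (e \<odot> z)) = e \<odot> z" "\<And>z. e \<odot> (b \<odot> (v \<odot> z)) = e \<odot> z"
    "u \<odot> (a \<odot> e) = e" "e \<odot> (b \<odot> v) = e"
proof -
  have e: "e \<in> mor Ob Ob" by (simp add: H_mor)
  have ae: "a \<odot> e \<in> mor A Ob" and eb: "e \<odot> b \<in> mor Ob B" using comp_mor a b e by blast+
  have "a \<odot> e \<odot> b = a \<odot> (e \<odot> b)" using a b by (simp add: comp_simps)
  then have ranks: "p \<le> rank (a \<odot> e)" "p \<le> rank (e \<odot> b)"
    using r rank_comp1[OF ae b] rank_comp2[OF a eb] by simp_all
  have "fn e ` Ob \<subseteq> fn (a \<odot> e) ` A" using rank_eq_image[OF a e] ranks by simp
  then obtain u where u: "u \<in> mor Ob A" "e = u \<odot> (a \<odot> e)" "rank u \<le> rank e"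
    using image_factor[OF ae e] by blast
  have "ker_le (e \<odot> b) e" using rank_eq_ker(2)[OF e b] ranks by simp
  then obtain v where v: "v \<in> mor B Ob" "e = e \<odot> b \<odot> v" "rank v \<le> rank e"
    using ker_le_factor[OF eb e] by blast
  have "u \<odot> (a \<odot> (e \<odot> z)) = e \<odot> z" for z
  proof -
    have "u \<odot> (a \<odot> (e \<odot> z)) = u \<odot> (a \<odot> e) \<odot> z" using u(1) a by (simp add: comp_simps)
    then show ?thesis using u(2) by simp
  qed
  moreover have 2: "e \<odot> (b \<odot> v) = e" using v b by (simp add: comp_simps)
  moreover have "e \<odot> (b \<odot> (v \<odot> z)) = e \<odot> z" for z
  proof -
    have "e \<odot> (b \<odot> (v \<odot> z)) = e \<odot> (b \<odot> v) \<odot> z" using v(1) b by (simp add: comp_simps)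
    then show ?thesis using 2 by simp
  qed
  ultimately show thesis using that[OF u(1) v(1)] u(2,3) v(3) by simp
qed

text \<open>A normal form of \<nu>: the first entry has e in the middle, and both outer factors are
  actual morphisms of rank at most p. This makes the relation independent of r.\<close>

definition nu_rel :: "'a morphism set \<Rightarrow> 'a morphism rel" where
  "nu_rel N = {(x, y). \<exists>A B a b n. a \<in> mor A Ob \<and> b \<in> mor Ob B \<and> n \<in> N \<and> rank a \<le> p \<and> rank b \<le> p \<and>
     x = a \<odot> e \<odot> b \<and> y = a \<odot> n \<odot> b \<and> rank x = p \<and> rank y = p}"

lemma nu_relE:
  assumes "(x, y) \<in> nu_rel N"
  obtains A B a b n where "a \<in> mor A Ob" "b \<in> mor Ob B" "n \<in> N" "rank a \<le> p" "rank b \<le> p"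
    "x = a \<odot> e \<odot> b" "y = a \<odot> n \<odot> b" "rank x = p" "rank y = p"
  using assms unfolding nu_rel_def by blast

lemma nu_relI:
  "a \<in> mor A Ob \<Longrightarrow> b \<in> mor Ob B \<Longrightarrow> n \<in> N \<Longrightarrow> rank a \<le> p \<Longrightarrow> rank b \<le> p \<Longrightarrow>
    rank (a \<odot> e \<odot> b) = p \<Longrightarrow> rank (a \<odot> n \<odot> b) = p \<Longrightarrow> (a \<odot> e \<odot> b, a \<odot> n \<odot> b) \<in> nu_rel N"
  unfolding nu_rel_def by blast

lemma inv_simps:
  assumes "x \<in> H"
  shows "inv\<^bsub>Grp\<^esub> x \<in> H" "x \<odot> inv\<^bsub>Grp\<^esub> x = e" "inv\<^bsub>Grp\<^esub> x \<odot> x = e"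
    "x \<odot> (inv\<^bsub>Grp\<^esub> x \<odot> z) = e \<odot> z" "inv\<^bsub>Grp\<^esub> x \<odot> (x \<odot> z) = e \<odot> z"
proof -
  show 1: "inv\<^bsub>Grp\<^esub> x \<in> H" using G.inv_closed assms by simp
  show 2: "x \<odot> inv\<^bsub>Grp\<^esub> x = e" "inv\<^bsub>Grp\<^esub> x \<odot> x = e"
    using G.r_inv[of x] G.l_inv[of x] assms by (simp_all add: e_def)
  show "x \<odot> (inv\<^bsub>Grp\<^esub> x \<odot> z) = e \<odot> z" using comp_assoc[of x "inv\<^bsub>Grp\<^esub> x" z] 1 2 assms by simp
  show "inv\<^bsub>Grp\<^esub> x \<odot> (x \<odot> z) = e \<odot> z" using comp_assoc[of "inv\<^bsub>Grp\<^esub> x" x z] 1 2 assms by simp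
qed

lemma H_mult: "x \<in> H \<Longrightarrow> y \<in> H \<Longrightarrow> x \<odot> y \<in> H"
  using G.m_closed by simp

text \<open>A pair from N can be written as (x e, x n), so x moves into the left factor, and e into
  the right one. This removes adjoined identities and bounds the outer ranks by p; conversely, such
  factors belong to I_r.\<close>

lemma nu_eq:
  assumes N: "N \<lhd> Grp" and r: "enat p \<le> r"
  shows "nu (Qr r) (rank_class Q p) N = nu_rel N"
proof (intro equalityI subsetI)
  interpret N: normal N Grp by (rule N)
  have NH: "x \<in> H" if "x \<in> N" for x using N.subset that by auto
  fix t assume "t \<in> nu (Qr r) (rank_class Q p) N"
  then obtain x y a b where t: "t = (mult_r (Qr r) (mult_l (Qr r) a x) b, mult_r (Qr r) (mult_l (Qr r) a y) b)"
    and xy: "x \<in> N" "y \<in> N"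
    and ab: "composable_l (Qr r) a x" "composable_r (Qr r) (mult_l (Qr r) a x) b"
    and D: "mult_r (Qr r) (mult_l (Qr r) a x) b \<in> rank_class Q p" "mult_r (Qr r) (mult_l (Qr r) a y) b \<in> rank_class Q p"
    unfolding nu_def by blast
  define n where "n = inv\<^bsub>Grp\<^esub> x \<odot> y"
  have n: "n \<in> N" using N.m_closed[OF N.m_inv_closed[OF xy(1)] xy(2)] by (simp add: n_def)
  note xyn = NH[OF xy(1)] NH[OF xy(2)] NH[OF n]
  have xn: "x \<odot> n = y" using xyn inv_simps(4)[of x y] by (simp add: n_def)
  obtain A c where c: "c \<in> mor A Ob" "rank c \<le> p" "mult_l (Qr r) a x = c \<odot> e" "mult_l (Qr r) a y = c \<odot> n"
  proof (cases a)
    case None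
    show thesis by (rule that[of x Ob]) (use None xyn xn H_mor in simp_all)
  next
    case (Some a')
    then have a': "a' \<in> mor (dm a') Ob" using ab(1) xyn by (simp add: composable_def bounded_def mor_def)
    have "rank (a' \<odot> x) \<le> p" using rank_comp2[OF a' H_mor[OF xyn(1)]] xyn by simp
    moreover have "a' \<odot> x \<in> mor (dm a') Ob" by (rule comp_mor[OF a' H_mor[OF xyn(1)]])
    moreover have "a' \<odot> x \<odot> e = a' \<odot> x" "a' \<odot> x \<odot> n = a' \<odot> y" using a' xyn xn by (simp_all add: comp_simps)
    ultimately show thesis using that[of "a' \<odot> x"] Some by simp
  qed
  have ce: "c \<odot> e \<odot> e = c \<odot> e" "c \<odot> n \<odot> e = c \<odot> n" using c(1) xyn by (simp_all add: comp_simps)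
  \<comment> \<open>Both products absorb e on the right, so the right factor may be replaced by e b,
    or by e itself if it is an adjoined identity.\<close>
  obtain B d where d: "d \<in> mor Ob B" "rank d \<le> p" "\<And>w. w \<in> mor A Ob \<Longrightarrow> w \<odot> e = w \<Longrightarrow> mult_r (Qr r) w b = w \<odot> d"
  proof (cases b)
    case None
    show thesis by (rule that[of e Ob]) (use None H_mor in simp_all)
  next
    case (Some b')
    then have b': "b' \<in> mor Ob (cd b')" using ab(2) unfolding c(3) by (simp add: composable_def bounded_def mor_def)
    have 1: "rank (e \<odot> b') \<le> p" using rank_comp1[OF H_mor[OF e_H] b'] by simp
    have 2: "w \<odot> b' = w \<odot> (e \<odot> b')" if "w \<in> mor A Ob" "w \<odot> e = w" for w
    proof -
      have "w \<odot> (e \<odot> b') = w \<odot> e \<odot> b'" using that(1) by (simp add: comp_simps)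
      then show ?thesis using that(2) by simp
    qed
    show thesis by (rule that[OF comp_mor[OF H_mor[OF e_H] b'] 1]) (use Some 2 in simp)
  qed
  have m: "c \<odot> e \<in> mor A Ob" "c \<odot> n \<in> mor A Ob" using comp_mor[OF c(1)] H_mor xyn by simp_all
  have teq: "t = (c \<odot> e \<odot> d, c \<odot> n \<odot> d)" using t d(3)[OF m(1) ce(1)] d(3)[OF m(2) ce(2)] c(3,4) by simp
  moreover have "rank (c \<odot> e \<odot> d) = p" "rank (c \<odot> n \<odot> d) = p"
    using D d(3)[OF m(1) ce(1)] d(3)[OF m(2) ce(2)] c(3,4) by (simp_all add: rank_class_def)
  ultimately show "t \<in> nu_rel N" using nu_relI[OF c(1) d(1) n c(2) d(2)] by simp
next
  interpret N: normal N Grp by (rule N)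
  fix t assume "t \<in> nu_rel N"
  then obtain A B a b n where a: "a \<in> mor A Ob" and b: "b \<in> mor Ob B" and n: "n \<in> N" and ab: "rank a \<le> p" "rank b \<le> p"
    and t: "t = (a \<odot> e \<odot> b, a \<odot> n \<odot> b)" and rk: "rank (a \<odot> e \<odot> b) = p" "rank (a \<odot> n \<odot> b) = p"
    unfolding nu_rel_def by blast
  have nH: "n \<in> H" using N.subset n by auto
  have e: "e \<in> N" using N.one_closed by (simp add: e_def)
  have ae: "a \<odot> e \<in> mor A Ob" "a \<odot> n \<in> mor A Ob" using comp_mor[OF a] H_mor nH by simp_all
  have bd: "a \<in> bounded r" "b \<in> bounded r" "e \<in> bounded r" "n \<in> bounded r" "a \<odot> e \<in> bounded r" "a \<odot> n \<in> bounded r"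
    using boundedI[OF _ _ r] a b ab H_mor[OF e_H] H_mor[OF nH] H_simps(4)[OF nH] H_simps(4)[OF e_H] ae
      rank_comp1[OF a H_mor[OF e_H]] rank_comp1[OF a H_mor[OF nH]]
    by (blast intro: order_trans order_refl order_eq_refl)+
  have "mult_r (Qr r) (mult_l (Qr r) (Some a) e) (Some b) = a \<odot> e \<odot> b"
    "mult_r (Qr r) (mult_l (Qr r) (Some a) n) (Some b) = a \<odot> n \<odot> b"
    "Some a \<in> carrier1 (Qr r)" "Some b \<in> carrier1 (Qr r)"
    "composable_l (Qr r) (Some a) e" "composable_l (Qr r) (Some a) n"
    "composable_r (Qr r) (mult_l (Qr r) (Some a) e) (Some b)" "composable_r (Qr r) (mult_l (Qr r) (Some a) n) (Some b)"
    "a \<odot> e \<odot> b \<in> rank_class Q p" "a \<odot> n \<odot> b \<in> rank_class Q p"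
    using bd rk a b nH mor_M[OF comp_mor[OF ae(1) b]] mor_M[OF comp_mor[OF ae(2) b]]
    by (simp_all add: carrier1_def composable_def rank_class_def mor_def)
  then show "t \<in> nu (Qr r) (rank_class Q p) N"
    unfolding nu_def mem_Collect_eq t
    by (intro exI[of _ e] exI[of _ n] exI[of _ "Some a"] exI[of _ "Some b"]) (use e n in simp)
qed

text \<open>The two entries are H-related because n can be absorbed on either side: both have the
  kernel of a e and the image of e b.\<close>

lemma nu_rel_mor:
  assumes N: "N \<subseteq> H" and xy: "(x, y) \<in> nu_rel N"
  shows "x \<in> mor (dm x) (cd x)" "y \<in> mor (dm x) (cd x)" "H_rel x y" "rank x = p" "rank y = p"
proof -
  obtain A B a b n where a: "a \<in> mor A Ob" and b: "b \<in> mor Ob B" and n: "n \<in> N" and ab: "rank a \<le> p" "rank b \<le> p"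
    and x: "x = a \<odot> e \<odot> b" and y: "y = a \<odot> n \<odot> b" and rk: "rank x = p" "rank y = p"
    using nu_relE[OF xy] .
  have nH: "n \<in> H" using N n by blast
  have e: "e \<in> mor Ob Ob" and n': "n \<in> mor Ob Ob" using H_mor nH by simp_all
  have ae: "a \<odot> e \<in> mor A Ob" and an: "a \<odot> n \<in> mor A Ob" and eb: "e \<odot> b \<in> mor Ob B" and nb: "n \<odot> b \<in> mor Ob B"
    using comp_mor a b e n' by blast+
  \<comment> \<open>Two splittings of y: with n in the right factor its kernel is visible, with n in
    the left factor its image.\<close>
  have x1: "x = a \<odot> e \<odot> (e \<odot> b)" and y1: "y = a \<odot> e \<odot> (n \<odot> b)" and y2: "y = a \<odot> n \<odot> (e \<odot> b)"
    using a b nH unfolding x y by (simp_all add: comp_simps)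
  have rae: "rank (a \<odot> e) \<le> p" and reb: "rank (e \<odot> b) \<le> p" using rank_comp1[OF a e] rank_comp2[OF e b] ab by simp_all
  have xm: "x \<in> mor A B" and ym: "y \<in> mor A B" unfolding x y using comp_mor ae an b by blast+
  have kx: "ker_le (a \<odot> e) x" "ker_le x (a \<odot> e)" using rank_eq_ker[OF ae eb] rae rk unfolding x1 by simp_all
  have ky: "ker_le (a \<odot> e) y" "ker_le y (a \<odot> e)" using rank_eq_ker[OF ae nb] rae rk unfolding y1 by simp_all
  have "ker_le x y" "ker_le y x"
    using ker_le_trans[OF _ kx(2) ky(1)] ker_le_trans[OF _ ky(2) kx(1)] xm ym ae by (simp_all add: mor_def)
  moreover have "fn x ` A = fn (e \<odot> b) ` Ob" using rank_eq_image[OF ae eb] reb rk unfolding x1 by simp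
  moreover have "fn y ` A = fn (e \<odot> b) ` Ob" using rank_eq_image[OF an eb] reb rk unfolding y2 by simp
  ultimately show "H_rel x y" using xm ym by (simp add: H_rel_def mor_def)
  show "x \<in> mor (dm x) (cd x)" "y \<in> mor (dm x) (cd x)" using xm ym by (simp_all add: mor_def)
  show "rank x = p" "rank y = p" using rk .
qed

text \<open>If \<open>a n b = a' e b'\<close> has rank \<open>p\<close>, then \<open>a' e = a g\<close> and \<open>e b' = h b\<close> with \<open>g\<close>, \<open>h\<close> in the group,
  and cancellation gives \<open>n = g h\<close>; hence \<open>a' m b' = a (g m g\<inverse>) n b\<close>.\<close>

lemma nu_rel_trans:
  assumes N: "N \<lhd> Grp" and xy: "(x, y) \<in> nu_rel N" and yz: "(y, z) \<in> nu_rel N"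
  shows "(x, z) \<in> nu_rel N"
proof -
  interpret N: normal N Grp by (rule N)
  obtain A B a b n where a: "a \<in> mor A Ob" and b: "b \<in> mor Ob B" and n: "n \<in> N" and ab: "rank a \<le> p" "rank b \<le> p"
    and x: "x = a \<odot> e \<odot> b" and y: "y = a \<odot> n \<odot> b" and rk: "rank x = p" "rank y = p"
    using nu_relE[OF xy] .
  obtain A' B' a' b' m where a': "a' \<in> mor A' Ob" and b': "b' \<in> mor Ob B'" and m: "m \<in> N" and ab': "rank a' \<le> p" "rank b' \<le> p"
    and y': "y = a' \<odot> e \<odot> b'" and z: "z = a' \<odot> m \<odot> b'" and rk': "rank z = p"
    using nu_relE[OF yz] .
  have "dm y = A" "cd y = B" using y a b by (simp_all add: mor_def)
  then have [simp]: "A' = A" "B' = B" using y' a' b' by (simp_all add: mor_def)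
  note a' = a'[simplified] and b' = b'[simplified]
  have nH: "n \<in> H" and mH: "m \<in> H" using N.subset n m by auto
  have e: "e \<in> mor Ob Ob" and n': "n \<in> mor Ob Ob" using H_mor nH by simp_all
  have ae: "a \<odot> e \<in> mor A Ob" and eb: "e \<odot> b \<in> mor Ob B" and a'e: "a' \<odot> e \<in> mor A Ob" and eb': "e \<odot> b' \<in> mor Ob B"
    and an: "a \<odot> n \<in> mor A Ob" and nb: "n \<odot> b \<in> mor Ob B" and ym: "y \<in> mor A B"
    using comp_mor a b a' b' e n' y by blast+
  have y1: "y = a \<odot> e \<odot> (n \<odot> b)" and y2: "y = a \<odot> n \<odot> (e \<odot> b)"
    using a b nH unfolding y by (simp_all add: comp_simps)
  have y3: "y = a' \<odot> e \<odot> (e \<odot> b')" using a' b' unfolding y' by (simp add: comp_simps)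
  have r': "rank (a' \<odot> e) \<le> p" "rank (e \<odot> b') \<le> p"
    using rank_comp1[OF a' e] rank_comp2[OF e b'] ab' by simp_all
  have r'': "p \<le> rank (a' \<odot> e)" "p \<le> rank (e \<odot> b')"
    using rank_comp1[OF a'e eb'] rank_comp2[OF a'e eb'] rk(2) unfolding y3[symmetric] by simp_all
  obtain u v where u: "u \<in> mor Ob A" and v: "v \<in> mor B Ob"
    and uv: "\<And>z. u \<odot> (a \<odot> (e \<odot> z)) = e \<odot> z" "\<And>z. e \<odot> (b \<odot> (v \<odot> z)) = e \<odot> z" "u \<odot> (a \<odot> e) = e" "e \<odot> (b \<odot> v) = e"
    using local_inverses[OF a b] rk(1) unfolding x by metis
  have "ker_le (a \<odot> e) y" unfolding y1 by (rule ker_le_comp[OF ae])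
  moreover have "ker_le y (a' \<odot> e)" using rank_eq_ker(2)[OF a'e eb'] r' rk(2) unfolding y3[symmetric] by simp
  moreover have "dm (a \<odot> e) = dm y" using ae ym by (simp add: mor_def)
  ultimately have "ker_le (a \<odot> e) (a' \<odot> e)" using ker_le_trans by blast
  then obtain w where w: "w \<in> mor Ob Ob" "a' \<odot> e = a \<odot> e \<odot> w" using ker_le_factor[OF ae a'e] by metis
  have "fn (e \<odot> b') ` Ob \<subseteq> fn (e \<odot> b) ` Ob"
  proof -
    have "fn y ` A = fn (e \<odot> b') ` Ob" using rank_eq_image[OF a'e eb'] r' rk(2) unfolding y3[symmetric] by simp
    moreover have "fn y ` A \<subseteq> fn (e \<odot> b) ` Ob"
      unfolding y2 comp_image[OF an] using mor_fn[OF an] by blast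
    ultimately show ?thesis by simp
  qed
  then obtain w' where w': "w' \<in> mor Ob Ob" "e \<odot> b' = w' \<odot> (e \<odot> b)" using image_factor[OF eb eb'] by metis
  define g h where "g = e \<odot> w \<odot> e" and "h = e \<odot> w' \<odot> e"
  have gm: "g \<in> mor Ob Ob" and hm: "h \<in> mor Ob Ob" unfolding g_def h_def using comp_mor e w w' by blast+
  have ag: "a' \<odot> e = a \<odot> g"
  proof -
    have "a' \<odot> e = a' \<odot> e \<odot> e" using a' by (simp add: comp_simps)
    also have "\<dots> = a \<odot> g" unfolding w(2) g_def using a w(1) by (simp add: comp_simps)
    finally show ?thesis .
  qed
  have hb: "e \<odot> b' = h \<odot> b"
  proof -
    have "e \<odot> b' = e \<odot> (e \<odot> b')" using b' by simp
    also have "\<dots> = h \<odot> b" unfolding w'(2) h_def using b w'(1) by (simp add: comp_simps)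
    finally show ?thesis .
  qed
  \<comment> \<open>The product a g = a' e still has rank p, so the sandwiched element g cannot have
    lost rank; likewise for h.\<close>
  have gH: "g \<in> H" using sandwich_H[OF w(1)] rank_comp2[OF a gm] r'' unfolding ag g_def by simp
  have hH: "h \<in> H" using sandwich_H[OF w'(1)] rank_comp1[OF hm b] r'' unfolding hb h_def by simp
  have "a \<odot> n \<odot> b = a \<odot> g \<odot> (h \<odot> b)" using y y3 ag hb by simp
  then have "u \<odot> (a \<odot> n \<odot> b) \<odot> v = u \<odot> (a \<odot> g \<odot> (h \<odot> b)) \<odot> v" by simp
  moreover have "u \<odot> (a \<odot> n \<odot> b) \<odot> v = n"
  proof -
    have "u \<odot> (a \<odot> n \<odot> b) \<odot> v = u \<odot> (a \<odot> (e \<odot> (n \<odot> (e \<odot> (b \<odot> v)))))"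
      using u a b v nH by (simp add: comp_simps)
    also have "\<dots> = n" unfolding uv(1,4) using nH by simp
    finally show ?thesis .
  qed
  moreover have "u \<odot> (a \<odot> g \<odot> (h \<odot> b)) \<odot> v = g \<odot> h"
  proof -
    have "u \<odot> (a \<odot> g \<odot> (h \<odot> b)) \<odot> v = u \<odot> (a \<odot> (e \<odot> (g \<odot> (h \<odot> (e \<odot> (b \<odot> v))))))"
      using u a b v gH hH by (simp add: comp_simps)
    also have "\<dots> = g \<odot> h" unfolding uv(1,4) using gH hH by simp
    finally show ?thesis .
  qed
  ultimately have ngh: "n = g \<odot> h" by simp
  \<comment> \<open>From n = g h follows g m h = (g m g\<inverse>)(g h) = k, and normality puts k
    into N.\<close>
  define k where "k = g \<odot> m \<odot> inv\<^bsub>Grp\<^esub> g \<odot> n"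
  have "g \<odot> m \<odot> inv\<^bsub>Grp\<^esub> g \<in> N" using N.inv_op_closed2[of g m] gH m by simp
  then have kN: "k \<in> N" using N.m_closed n by (simp add: k_def)
  have "z = a' \<odot> e \<odot> m \<odot> (e \<odot> b')" using a' b' mH unfolding z by (simp add: comp_simps)
  also have "\<dots> = a \<odot> (g \<odot> m \<odot> h) \<odot> b" unfolding ag hb using a b gH hH mH by (simp add: comp_simps)
  also have "g \<odot> m \<odot> h = k"
    unfolding k_def ngh using gH hH mH inv_simps(1)[OF gH] inv_simps(5)[OF gH] by (simp add: comp_simps)
  finally have "z = a \<odot> k \<odot> b" .
  then show ?thesis using nu_relI[OF a b kN ab] rk(1) rk' x by simp
qed

text \<open>Absorbing n into the left factor turns the pair into (a n) e b and (a n) n\<inverse> b,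
  with roles exchanged.\<close>

lemma nu_rel_sym:
  assumes N: "N \<lhd> Grp" and xy: "(x, y) \<in> nu_rel N"
  shows "(y, x) \<in> nu_rel N"
proof -
  interpret N: normal N Grp by (rule N)
  obtain A B a b n where a: "a \<in> mor A Ob" and b: "b \<in> mor Ob B" and n: "n \<in> N" and ab: "rank a \<le> p" "rank b \<le> p"
    and x: "x = a \<odot> e \<odot> b" and y: "y = a \<odot> n \<odot> b" and rk: "rank x = p" "rank y = p"
    using nu_relE[OF xy] .
  have nH: "n \<in> H" using N.subset n by auto
  have i: "inv\<^bsub>Grp\<^esub> n \<in> N" using N.m_inv_closed n by simp
  have an: "a \<odot> n \<in> mor A Ob" using comp_mor[OF a] H_mor nH by simp
  have r: "rank (a \<odot> n) \<le> p" using rank_comp1[OF a H_mor[OF nH]] ab by simp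
  have "y = a \<odot> n \<odot> e \<odot> b" "x = a \<odot> n \<odot> inv\<^bsub>Grp\<^esub> n \<odot> b"
    using a b nH inv_simps[OF nH] unfolding x y by (simp_all add: comp_simps)
  then show ?thesis using nu_relI[OF an b i r ab(2)] rk by simp
qed

lemma nu_rel_left:
  assumes N: "N \<subseteq> H" and xy: "(x, y) \<in> nu_rel N" and c: "c \<in> mor A' (dm x)"
  shows "rank (c \<odot> x) = rank (c \<odot> y)" "rank (c \<odot> x) = p \<Longrightarrow> (c \<odot> x, c \<odot> y) \<in> nu_rel N"
proof -
  note nu = nu_rel_mor[OF N xy]
  show 1: "rank (c \<odot> x) = rank (c \<odot> y)" by (rule H_rel_left[OF nu(3,1,2) c])
  assume r: "rank (c \<odot> x) = p"
  obtain A B a b n where a: "a \<in> mor A Ob" and b: "b \<in> mor Ob B" and n: "n \<in> N" and ab: "rank a \<le> p" "rank b \<le> p"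
    and x: "x = a \<odot> e \<odot> b" and y: "y = a \<odot> n \<odot> b"
    using nu_relE[OF xy] .
  have nH: "n \<in> H" using N n by auto
  have c': "c \<in> mor A' A" using c x a by (simp add: mor_def)
  have eq: "c \<odot> x = c \<odot> a \<odot> e \<odot> b" "c \<odot> y = c \<odot> a \<odot> n \<odot> b" using a b nH c' unfolding x y by (simp_all add: comp_simps)
  have ra: "rank (c \<odot> a) \<le> p" using rank_comp2[OF c' a] ab(1) by (rule order_trans)
  show "(c \<odot> x, c \<odot> y) \<in> nu_rel N"
    unfolding eq by (rule nu_relI[OF comp_mor[OF c' a] b n ra ab(2)]) (use r 1 eq in metis)+
qed

lemma nu_rel_right:
  assumes N: "N \<subseteq> H" and xy: "(x, y) \<in> nu_rel N" and c: "c \<in> mor (cd x) B'"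
  shows "rank (x \<odot> c) = rank (y \<odot> c)" "rank (x \<odot> c) = p \<Longrightarrow> (x \<odot> c, y \<odot> c) \<in> nu_rel N"
proof -
  note nu = nu_rel_mor[OF N xy]
  show 1: "rank (x \<odot> c) = rank (y \<odot> c)" by (rule H_rel_right[OF nu(3,1,2) c])
  assume r: "rank (x \<odot> c) = p"
  obtain A B a b n where a: "a \<in> mor A Ob" and b: "b \<in> mor Ob B" and n: "n \<in> N" and ab: "rank a \<le> p" "rank b \<le> p"
    and x: "x = a \<odot> e \<odot> b" and y: "y = a \<odot> n \<odot> b"
    using nu_relE[OF xy] .
  have nH: "n \<in> H" using N n by auto
  have c': "c \<in> mor B B'" using c x b by (simp add: mor_def)
  have eq: "x \<odot> c = a \<odot> e \<odot> (b \<odot> c)" "y \<odot> c = a \<odot> n \<odot> (b \<odot> c)" using a b nH c' unfolding x y by (simp_all add: comp_simps)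
  have rb: "rank (b \<odot> c) \<le> p" using rank_comp1[OF b c'] ab(2) by (rule order_trans)
  show "(x \<odot> c, y \<odot> c) \<in> nu_rel N"
    unfolding eq by (rule nu_relI[OF a comp_mor[OF b c'] n ab(1) rb]) (use r 1 eq in metis)+
qed

text \<open>H-related entries lose rank together, so a multiple of a \<nu>-pair is either again a
  \<nu>-pair of rank p or a pair in \<open>univ_upto q\<close>.\<close>

lemma rees_nu_congruence:
  assumes N: "N \<lhd> Grp" and p: "p = Suc q" "enat p \<le> r"
  shows "congruence r (univ_upto q \<union> Id_on (bounded r) \<union> nu_rel N)" (is "congruence r ?\<sigma>")
proof -
  interpret N: normal N Grp by (rule N)
  have NH: "N \<subseteq> H" using N.subset by simp
  note nu = nu_rel_mor[OF NH]
  have qr: "enat q \<le> r" using p by (meson enat_ord_simps(1) le_SucI order_refl order_trans)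
  have univ: "x \<in> mor (dm x) (cd x) \<and> y \<in> mor (dm x) (cd x) \<and> rank x \<le> q \<and> rank y \<le> q" if "(x, y) \<in> univ_upto q" for x y
    using that by (simp add: univ_upto_def mor_def)
  have univI: "(x, y) \<in> univ_upto q" if "x \<in> mor A B" "y \<in> mor A B" "rank x \<le> q" "rank y \<le> q" for x y A B
    using that by (simp add: univ_upto_def mor_def)
  have mor: "x \<in> mor (dm x) (cd x) \<and> y \<in> mor (dm x) (cd x)" if xy: "(x, y) \<in> ?\<sigma>" for x y
  proof -
    consider "(x, y) \<in> univ_upto q" | "x = y" "x \<in> bounded r" | "(x, y) \<in> nu_rel N" using xy by auto
    then show ?thesis
    proof cases
      case 1
      then show ?thesis using univ by blast
    next
      case 2
      then show ?thesis by (simp add: bounded_def mor_def)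
    next
      case 3
      then show ?thesis using nu(1,2) by blast
    qed
  qed
  have "equiv (bounded r) ?\<sigma>"
  proof (rule equivI_elem)
    show "?\<sigma> \<subseteq> bounded r \<times> bounded r"
    proof (rule subsetI, rule mem_Times_iff[THEN iffD2])
      fix t assume "t \<in> ?\<sigma>"
      moreover obtain x y where t: "t = (x, y)" by fastforce
      ultimately have xy: "(x, y) \<in> ?\<sigma>" by simp
      have "x \<in> bounded r \<and> y \<in> bounded r"
      proof -
        consider "(x, y) \<in> univ_upto q" | "x = y" "x \<in> bounded r" | "(x, y) \<in> nu_rel N" using xy by auto
        then show ?thesis
        proof cases
          case 1
          then show ?thesis using univ boundedI[OF _ _ qr] by blast
        next
          case 3
          then show ?thesis using nu[OF 3] boundedI[OF _ _ p(2)] by simp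
        qed simp
      qed
      then show "fst t \<in> bounded r \<and> snd t \<in> bounded r" using t by simp
    qed
    have "(x, y) \<in> univ_upto q \<Longrightarrow> (y, x) \<in> univ_upto q" for x y by (simp add: univ_upto_def)
    then show "(y, x) \<in> ?\<sigma>" if "(x, y) \<in> ?\<sigma>" for x y
      using that nu_rel_sym[OF N, of x y] by blast
    show "(x, z) \<in> ?\<sigma>" if xy: "(x, y) \<in> ?\<sigma>" and yz: "(y, z) \<in> ?\<sigma>" for x y z
    proof (cases "x = y \<or> y = z")
      case True
      then show ?thesis using xy yz by auto
    next
      case False
      then have "(x, y) \<in> univ_upto q \<or> (x, y) \<in> nu_rel N" "(y, z) \<in> univ_upto q \<or> (y, z) \<in> nu_rel N"
        using xy yz by auto
      moreover have "(x, z) \<in> univ_upto q" if "(x, y) \<in> univ_upto q" "(y, z) \<in> univ_upto q"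
        using that by (simp add: univ_upto_def)
      \<comment> \<open>A chain cannot mix the two parts: its middle element would have rank at most
        q and also rank q + 1.\<close>
      moreover have "\<not> ((x, y) \<in> univ_upto q \<and> (y, z) \<in> nu_rel N)" "\<not> ((x, y) \<in> nu_rel N \<and> (y, z) \<in> univ_upto q)"
        using univ[of x y] univ[of y z] nu(4)[of y z] nu(5)[of x y] p(1) by auto
      ultimately show ?thesis using nu_rel_trans[OF N, of x y z] by blast
    qed
    show "(x, x) \<in> ?\<sigma>" if "x \<in> bounded r" for x using that by blast
  qed
  moreover have "(a \<odot> x, a \<odot> y) \<in> ?\<sigma>" if xy: "(x, y) \<in> ?\<sigma>" and a: "a \<in> bounded r" "cd a = dm x" for a x y
  proof -
    have am: "a \<in> mor (dm a) (dm x)" using a by (simp add: bounded_def mor_def)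
    have m: "x \<in> mor (dm x) (cd x)" "y \<in> mor (dm x) (cd x)" using mor[OF xy] by simp_all
    have am': "a \<odot> x \<in> mor (dm a) (cd x)" "a \<odot> y \<in> mor (dm a) (cd x)" using comp_mor[OF am] m by blast+
    consider "(x, y) \<in> univ_upto q" | "x = y" "x \<in> bounded r" | "(x, y) \<in> nu_rel N" using xy by auto
    then show ?thesis
    proof cases
      case 1
      then have "rank (a \<odot> x) \<le> q" "rank (a \<odot> y) \<le> q" using rank_comp2[OF am m(1)] rank_comp2[OF am m(2)] univ[OF 1] by simp_all
      then show ?thesis using univI[OF am'] by blast
    next
      case 2
      have "enat (rank (a \<odot> x)) \<le> r"
        using rank_comp2[OF am m(1)] 2 unfolding bounded_def by (metis (no_types, lifting) enat_ord_simps(1) mem_Collect_eq order_trans)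
      then show ?thesis using 2 am' by (simp add: bounded_def mor_def Id_on_iff)
    next
      case 3
      note nl = nu_rel_left[OF NH 3 am]
      have "rank (a \<odot> x) \<le> p" using rank_comp2[OF am m(1)] nu[OF 3] by simp
      then show ?thesis using univI[OF am'] nl p(1) by (cases "rank (a \<odot> x) = p") auto
    qed
  qed
  moreover have "(x \<odot> a, y \<odot> a) \<in> ?\<sigma>" if xy: "(x, y) \<in> ?\<sigma>" and a: "a \<in> bounded r" "cd x = dm a" for a x y
  proof -
    have am: "a \<in> mor (cd x) (cd a)" using a by (simp add: bounded_def mor_def)
    have m: "x \<in> mor (dm x) (cd x)" "y \<in> mor (dm x) (cd x)" using mor[OF xy] by simp_all
    have am': "x \<odot> a \<in> mor (dm x) (cd a)" "y \<odot> a \<in> mor (dm x) (cd a)" using comp_mor[OF _ am] m by blast+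
    consider "(x, y) \<in> univ_upto q" | "x = y" "x \<in> bounded r" | "(x, y) \<in> nu_rel N" using xy by auto
    then show ?thesis
    proof cases
      case 1
      then have "rank (x \<odot> a) \<le> q" "rank (y \<odot> a) \<le> q" using rank_comp1[OF m(1) am] rank_comp1[OF m(2) am] univ[OF 1] by simp_all
      then show ?thesis using univI[OF am'] by blast
    next
      case 2
      have "enat (rank (x \<odot> a)) \<le> r"
        using rank_comp1[OF m(1) am] 2 unfolding bounded_def by (metis (no_types, lifting) enat_ord_simps(1) mem_Collect_eq order_trans)
      then show ?thesis using 2 am' by (simp add: bounded_def mor_def Id_on_iff)
    next
      case 3
      note nl = nu_rel_right[OF NH 3 am]
      have "rank (x \<odot> a) \<le> p" using rank_comp1[OF m(1) am] nu[OF 3] by simp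
      then show ?thesis using univI[OF am'] nl p(1) by (cases "rank (x \<odot> a) = p") auto
    qed
  qed
  moreover have "dm x = dm y \<and> cd x = cd y" if "(x, y) \<in> ?\<sigma>" for x y using mor[OF that] by (simp add: mor_def)
  ultimately show ?thesis unfolding congruence_def by blast
qed

end

text \<open>p is meant as the first level at which \<sigma> fails to be universal; universality just
  below p is added in \<open>sigma_eq\<close>.\<close>

locale trans_group_congruence = trans_group + trans_congruence +
  assumes p_ge: "2 \<le> p" and p_le: "enat p \<le> r" and not_upto: "\<not> univ_upto p \<subseteq> \<sigma>"
begin

definition normal_part :: "'a morphism set" where
  "normal_part = {n \<in> H. (e, n) \<in> \<sigma>}"

lemma normal_part_normal: "normal_part \<lhd> Grp"
proof -
  have e: "e \<in> mor Ob Ob" by (simp add: H_mor)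
  have l: "(a \<odot> x, a \<odot> y) \<in> \<sigma>" and r: "(x \<odot> a, y \<odot> a) \<in> \<sigma>" if "(x, y) \<in> \<sigma>" "x \<in> H" "a \<in> H" for x y a
    using sigma_left[OF that(1) H_mor H_mor] sigma_right[OF that(1) H_mor H_mor] that p_le by simp_all
  have "subgroup normal_part Grp"
  proof (rule G.subgroupI)
    show "normal_part \<subseteq> carrier Grp" by (auto simp: normal_part_def)
    have "e \<in> normal_part" using sigma_refl boundedI[OF e _ p_le] by (simp add: normal_part_def)
    then show "normal_part \<noteq> {}" by auto
    show "inv\<^bsub>Grp\<^esub> a \<in> normal_part" if "a \<in> normal_part" for a
    proof -
      have a: "a \<in> H" "(e, a) \<in> \<sigma>" using that by (simp_all add: normal_part_def)
      have "(e \<odot> inv\<^bsub>Grp\<^esub> a, a \<odot> inv\<^bsub>Grp\<^esub> a) \<in> \<sigma>" by (rule r[OF a(2) e_H inv_simps(1)[OF a(1)]])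
      then show ?thesis using inv_simps[OF a(1)] sigma_sym by (simp add: normal_part_def)
    qed
    show "a \<otimes>\<^bsub>Grp\<^esub> b \<in> normal_part" if "a \<in> normal_part" "b \<in> normal_part" for a b
    proof -
      have ab: "a \<in> H" "(e, a) \<in> \<sigma>" "b \<in> H" "(e, b) \<in> \<sigma>" using that by (simp_all add: normal_part_def)
      have "(a \<odot> e, a \<odot> b) \<in> \<sigma>" by (rule l[OF ab(4) e_H ab(1)])
      then show ?thesis using ab H_mult sigma_trans[OF ab(2)] by (simp add: normal_part_def)
    qed
  qed
  moreover have "x \<otimes>\<^bsub>Grp\<^esub> h \<otimes>\<^bsub>Grp\<^esub> inv\<^bsub>Grp\<^esub> x \<in> normal_part" if "x \<in> H" "h \<in> normal_part" for x h
  proof -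
    have h: "h \<in> H" "(e, h) \<in> \<sigma>" using that by (simp_all add: normal_part_def)
    have "(x \<odot> e \<odot> inv\<^bsub>Grp\<^esub> x, x \<odot> h \<odot> inv\<^bsub>Grp\<^esub> x) \<in> \<sigma>"
      by (rule r[OF l[OF h(2) e_H that(1)] _ inv_simps(1)[OF that(1)]]) (simp add: that)
    then show ?thesis using inv_simps(1,2)[OF that(1)] that h H_mult by (simp add: normal_part_def)
  qed
  ultimately show ?thesis unfolding G.normal_inv_iff by simp
qed

text \<open>The pair is pulled back to the object of the group, where it becomes (e, n). A pair at
  rank p that is not H-related would make \<sigma> universal on I_p, so n lies in H; pushing forward
  again recovers y as a n b.\<close>

lemma sigma_nu_rel:
  assumes xy: "(x, y) \<in> \<sigma>" and rk: "rank x = p" "rank y \<le> p"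
  shows "(x, y) \<in> nu_rel normal_part"
proof -
  have e: "e \<in> mor Ob Ob" by (simp add: H_mor)
  obtain A B where x: "x \<in> mor A B" and y: "y \<in> mor A B" using sigma_mor[OF xy] .
  have H: "ker_le y x" "fn x ` A = fn y ` A"
    using univ_upto_not_H[OF xy rk p_ge] not_upto x y by (auto simp: mor_def)
  then have rky: "rank y = p" using mor_rank[OF x] mor_rank[OF y] rk by simp
  then have kxy: "ker_le x y" using ker_le_rank(2)[OF y x H(1)] rk by simp
  obtain a b where a: "a \<in> mor A Ob" and b: "b \<in> mor Ob B" and xab: "x = a \<odot> e \<odot> b" and ab: "rank a \<le> p" "rank b \<le> p"
    using rank_le_factor[OF e x] rk(1) by (metis H_simps(4) e_H order_refl)
  obtain u v where u: "u \<in> mor Ob A" and v: "v \<in> mor B Ob" and ruv: "rank u \<le> p" "rank v \<le> p"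
    and uv: "\<And>z. u \<odot> (a \<odot> (e \<odot> z)) = e \<odot> z" "\<And>z. e \<odot> (b \<odot> (v \<odot> z)) = e \<odot> z" "u \<odot> (a \<odot> e) = e" "e \<odot> (b \<odot> v) = e"
    using local_inverses[OF a b] rk(1) unfolding xab by metis
  have ae: "a \<odot> e \<in> mor A Ob" and eb: "e \<odot> b \<in> mor Ob B" and eu: "e \<odot> u \<in> mor Ob A" and ve: "v \<odot> e \<in> mor B Ob"
    using comp_mor a b e u v by blast+
  \<comment> \<open>The multipliers e u and v e send x = a e b to e, so applying them to y yields an
    element related to e.\<close>
  define n where "n = e \<odot> u \<odot> y \<odot> (v \<odot> e)"
  have m1: "e \<odot> u \<odot> x \<in> mor Ob B" "e \<odot> u \<odot> y \<in> mor Ob B" using comp_mor eu x y by blast+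
  have nm: "n \<in> mor Ob Ob" unfolding n_def by (rule comp_mor[OF m1(2) ve])
  have r: "enat (rank (e \<odot> u)) \<le> r" "enat (rank (v \<odot> e)) \<le> r"
    using rank_comp2[OF e u] rank_comp1[OF v e] ruv by (auto intro: enat_le_r[OF _ p_le])
  have "(e \<odot> u \<odot> x \<odot> (v \<odot> e), n) \<in> \<sigma>"
    unfolding n_def by (rule sigma_right[OF sigma_left[OF xy x eu r(1)] m1(1) ve r(2)])
  moreover have "e \<odot> u \<odot> x \<odot> (v \<odot> e) = e"
  proof -
    have "e \<odot> u \<odot> x \<odot> (v \<odot> e) = e \<odot> (u \<odot> (a \<odot> (e \<odot> (b \<odot> (v \<odot> e)))))"
      unfolding xab using u a b v by (simp add: comp_simps)
    also have "\<dots> = e" unfolding uv(1) uv(2) by simp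
    finally show ?thesis .
  qed
  ultimately have en: "(e, n) \<in> \<sigma>" by simp
  have "rank n \<le> p" unfolding n_def using rank_comp2[OF m1(2) ve] rank_comp1[OF v e] ruv by simp
  then have "ker_le n e" "fn e ` Ob = fn n ` Ob"
    using univ_upto_not_H[OF en _ _ p_ge] not_upto nm by (auto simp: mor_def)
  moreover have "ker_le e n"
  proof -
    have "n = e \<odot> (u \<odot> y \<odot> (v \<odot> e))" unfolding n_def using u y v by (simp add: comp_simps)
    then show ?thesis using ker_le_comp[OF e] by metis
  qed
  ultimately have nH: "n \<in> H" unfolding H_iff H_rel_def using nm by (simp add: mor_def)
  then have nN: "n \<in> normal_part" using en by (simp add: normal_part_def)
  have "ker_le (a \<odot> e) x" unfolding xab by (rule ker_le_comp[OF ae])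
  then have "ker_le (a \<odot> e) y" using ker_le_trans[OF _ _ kxy] ae x by (simp add: mor_def)
  then obtain z where z: "z \<in> mor Ob B" "y = a \<odot> e \<odot> z" using ker_le_factor[OF ae y] by metis
  have "fn y ` A \<subseteq> fn (e \<odot> b) ` Ob"
  proof -
    have "x = a \<odot> (e \<odot> b)" unfolding xab using a b by (simp add: comp_simps)
    then have "fn y ` A = fn (e \<odot> b) ` fn a ` A" using H(2) comp_image[OF a] by simp
    then show ?thesis using mor_fn[OF a] by blast
  qed
  then obtain w where w: "w \<in> mor A Ob" "y = w \<odot> (e \<odot> b)" using image_factor[OF eb y] by metis
  \<comment> \<open>As y begins with a e and ends with e b, the first form cancels u against a and
    the second cancels v against b.\<close>
  have "a \<odot> n \<odot> b = a \<odot> (e \<odot> (u \<odot> (y \<odot> (v \<odot> (e \<odot> b)))))"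
    unfolding n_def using a b u v y by (simp add: comp_simps)
  also have "\<dots> = a \<odot> (e \<odot> (u \<odot> (a \<odot> (e \<odot> (z \<odot> (v \<odot> (e \<odot> b)))))))"
    unfolding z(2) using a z(1) by (simp add: comp_simps)
  also have "\<dots> = a \<odot> e \<odot> z \<odot> (v \<odot> (e \<odot> b))"
    unfolding uv(1) using a z(1) by (simp add: comp_simps)
  also have "\<dots> = w \<odot> (e \<odot> (b \<odot> (v \<odot> (e \<odot> b))))"
    unfolding z(2)[symmetric] unfolding w(2) using w(1) b by (simp add: comp_simps)
  also have "\<dots> = y" unfolding uv(2) w(2) by simp
  finally have "y = a \<odot> n \<odot> b" by simp
  then show ?thesis using nu_relI[OF a b nN ab] xab rk(1) rky by simp
qed

lemma nu_rel_sigma: "nu_rel normal_part \<subseteq> \<sigma>"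
proof
  fix t assume t: "t \<in> nu_rel normal_part"
  obtain x y where xy: "t = (x, y)" by fastforce
  obtain A B a b n where a: "a \<in> mor A Ob" and b: "b \<in> mor Ob B" and n: "n \<in> normal_part" and ab: "rank a \<le> p" "rank b \<le> p"
    and x: "x = a \<odot> e \<odot> b" and y: "y = a \<odot> n \<odot> b"
    using nu_relE[OF t[unfolded xy]] .
  have "(e, n) \<in> \<sigma>" "enat (rank a) \<le> r" "enat (rank b) \<le> r"
    using n ab enat_le_r[OF _ p_le] by (simp_all add: normal_part_def)
  then show "t \<in> \<sigma>" unfolding xy x y
    using sigma_right[OF sigma_left[OF _ H_mor[OF e_H] a] comp_mor[OF a H_mor[OF e_H]] b] by blast
qed

text \<open>A pair of rank greater than \<open>p\<close> would force \<open>univ_upto p \<subseteq> \<sigma>\<close>.\<close>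

lemma sigma_eq:
  assumes p: "p = Suc q" and upto: "univ_upto q \<subseteq> \<sigma>"
  shows "\<sigma> = univ_upto q \<union> Id_on (bounded r) \<union> nu_rel normal_part"
proof (intro equalityI subsetI)
  have high: "x = y" if xy: "(x, y) \<in> \<sigma>" and le: "rank y \<le> rank x" and r: "p < rank x" for x y
  proof (rule ccontr)
    assume "x \<noteq> y"
    then have "univ_upto (rank x - 1) \<subseteq> \<sigma>"
      using univ_upto_pred[OF xy, of "rank x - 1"] le r p_ge by simp
    moreover have "univ_upto p \<subseteq> univ_upto (rank x - 1)" using r by (auto simp: univ_upto_def)
    ultimately show False using not_upto by blast
  qed
  fix t assume t: "t \<in> \<sigma>"
  obtain x y where xy: "t = (x, y)" by fastforce
  then have s: "(x, y) \<in> \<sigma>" using t by simp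
  have bd: "x \<in> bounded r" using sigma_bounded[OF s] by simp
  obtain A B where m: "x \<in> mor A B" "y \<in> mor A B" using sigma_mor[OF s] .
  consider "rank x \<le> q" "rank y \<le> q" | "rank x = p" "rank y \<le> p" | "rank y = p" "rank x \<le> p" | "p < rank x" "rank y \<le> rank x" | "p < rank y" "rank x \<le> rank y"
    using p by linarith
  then have "(x, y) \<in> univ_upto q \<or> x = y \<or> (x, y) \<in> nu_rel normal_part"
  proof cases
    case 1
    then show ?thesis using m by (simp add: univ_upto_def mor_def)
  next
    case 2
    then show ?thesis using sigma_nu_rel[OF s] by simp
  next
    case 3
    then show ?thesis using nu_rel_sym[OF normal_part_normal sigma_nu_rel[OF sigma_sym[OF s]]] by simp
  next
    case 4
    then show ?thesis using high[OF s] by simp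
  next
    case 5
    then show ?thesis using high[OF sigma_sym[OF s]] by simp
  qed
  then show "t \<in> univ_upto q \<union> Id_on (bounded r) \<union> nu_rel normal_part" using xy bd by auto
next
  fix t assume "t \<in> univ_upto q \<union> Id_on (bounded r) \<union> nu_rel normal_part"
  then show "t \<in> \<sigma>" using upto nu_rel_sigma sigma_refl by auto
qed

end

section \<open>Classification of the congruences on \<open>I\<^sub>r\<close>\<close>

context trans_subcat
begin

lemma rees_cong_Qr:
  assumes "enat q \<le> r"
  shows "rees_cong (Qr r) (rank_ideal Q (enat q)) = univ_upto q \<union> Id_on (bounded r)"
  unfolding rees_cong_def univ_cong_def diag_cong_def rank_ideal_Q parallel_def univ_upto_def
  by (auto simp: bounded_def)

lemma univ_cong_congruence: "congruence r (univ_cong (Qr r))"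
proof -
  have u: "(x, y) \<in> univ_cong (Qr r) \<longleftrightarrow> x \<in> bounded r \<and> y \<in> bounded r \<and> dm x = dm y \<and> cd x = cd y" for x y
    by (simp add: univ_cong_def parallel_def)
  have l1: "a \<odot> x \<in> bounded r" if "x \<in> bounded r" "a \<in> M" "cd a = dm x" for a x
  proof -
    have m: "x \<in> mor (dm x) (cd x)" "a \<in> mor (dm a) (dm x)" "enat (rank x) \<le> r"
      using that by (simp_all add: bounded_def mor_def)
    show ?thesis by (rule boundedI[OF comp_mor[OF m(2,1)] rank_comp2[OF m(2,1)] m(3)])
  qed
  have l2: "x \<odot> a \<in> bounded r" if "x \<in> bounded r" "a \<in> M" "cd x = dm a" for a x
  proof -
    have m: "x \<in> mor (dm x) (cd x)" "a \<in> mor (cd x) (cd a)" "enat (rank x) \<le> r"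
      using that by (simp_all add: bounded_def mor_def)
    show ?thesis by (rule boundedI[OF comp_mor[OF m(1,2)] rank_comp1[OF m(1,2)] m(3)])
  qed
  have "equiv (bounded r) (univ_cong (Qr r))"
  proof (rule equivI_elem)
    show "univ_cong (Qr r) \<subseteq> bounded r \<times> bounded r" by (auto simp: univ_cong_def)
  qed (simp_all add: u)
  then show ?thesis
    unfolding congruence_def u using l1 l2 by (simp add: bounded_def)
qed

lemma diag_cong_congruence: "congruence r (Id_on (bounded r))"
proof -
  have "(x, y) \<in> Id_on (bounded r) \<longleftrightarrow> (x, y) \<in> univ_cong (Qr r) \<and> x = y" for x y
    by (auto simp: univ_cong_def parallel_def)
  moreover have "equiv (bounded r) (Id_on (bounded r))" by (rule equivI_elem) auto
  ultimately show ?thesis using univ_cong_congruence[of r] unfolding congruence_def by blast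
qed

theorem Cong_Qr_classification:
  assumes r: "2 \<le> r"
    and G: "\<And>q. 1 \<le> q \<Longrightarrow> enat q \<le> r \<Longrightarrow> group_H_class Q (G q) \<and> G q \<subseteq> rank_class Q q"
  shows "Cong (Qr r) = {diag_cong (Qr r)} \<union>
    {rees_nu_cong (Qr r) (rank_ideal Q (enat q)) (rank_class Q (q + 1)) N | q N.
      1 \<le> q \<and> enat q < r \<and> N \<lhd> class_group Q (G (q + 1))} \<union> {univ_cong (Qr r)}"
proof -
  have diag: "diag_cong (Qr r) = Id_on (bounded r)" by (simp add: diag_cong_def)
  have suc: "enat (Suc q) \<le> r" if "enat q < r" for q
    using that ileI1[of "enat q" r] by (simp add: eSuc_enat)
  have grp: "trans_group C ord M (Suc q) (G (Suc q))" if "1 \<le> q" "enat q < r" for q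
    using G[of "Suc q"] suc[OF that(2)] trans_subcat_axioms by (simp add: trans_group_def trans_group_axioms_def)
  have rn: "rees_nu_cong (Qr r) (rank_ideal Q (enat q)) (rank_class Q (Suc q)) N =
      univ_upto q \<union> Id_on (bounded r) \<union> trans_group.nu_rel C M (Suc q) (G (Suc q)) N"
    if q: "1 \<le> q" "enat q < r" and N: "N \<lhd> class_group Q (G (Suc q))" for q N
    unfolding rees_nu_cong_def trans_group.nu_eq[OF grp[OF q] N suc[OF q(2)]]
    by (simp add: rees_cong_Qr less_imp_le q(2))
  show ?thesis
    unfolding Cong_Qr
  proof (intro equalityI subsetI)
    fix \<sigma> assume "\<sigma> \<in> {\<sigma>. congruence r \<sigma>}"
    then have "congruence r \<sigma>" by simp
    then interpret S: trans_congruence C ord M r \<sigma> using r by unfold_locales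
    show "\<sigma> \<in> {diag_cong (Qr r)} \<union> {rees_nu_cong (Qr r) (rank_ideal Q (enat q)) (rank_class Q (q + 1)) N | q N.
      1 \<le> q \<and> enat q < r \<and> N \<lhd> class_group Q (G (q + 1))} \<union> {univ_cong (Qr r)}"
    proof (cases "\<sigma> = Id_on (bounded r) \<or> \<sigma> = univ_cong (Qr r)")
      case True
      then show ?thesis unfolding diag by blast
    next
      case False
      have "\<exists>x y. (x, y) \<in> \<sigma> \<and> x \<noteq> y"
      proof (rule ccontr)
        assume n: "\<nexists>x y. (x, y) \<in> \<sigma> \<and> x \<noteq> y"
        have "\<sigma> = Id_on (bounded r)"
        proof (intro equalityI subsetI)
          fix t assume t: "t \<in> \<sigma>"
          obtain x y where xy: "t = (x, y)" by fastforce
          then have "x = y" "x \<in> bounded r" using n t S.sigma_bounded[of x y] by auto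
          then show "t \<in> Id_on (bounded r)" using xy by blast
        next
          fix t assume "t \<in> Id_on (bounded r)"
          then show "t \<in> \<sigma>" using S.sigma_refl by auto
        qed
        then show False using False by blast
      qed
      then obtain x y where "(x, y) \<in> \<sigma>" "x \<noteq> y" by blast
      then have u1: "univ_upto 1 \<subseteq> \<sigma>" by (rule S.univ_upto_1)
      have "\<sigma> \<subseteq> univ_cong (Qr r)"
      proof
        fix t assume t: "t \<in> \<sigma>"
        obtain x y where xy: "t = (x, y)" by fastforce
        then have s: "(x, y) \<in> \<sigma>" using t by simp
        obtain A B where "x \<in> mor A B" "y \<in> mor A B" using S.sigma_mor[OF s] .
        then show "t \<in> univ_cong (Qr r)"
          using S.sigma_bounded[OF s] xy by (simp add: univ_cong_def parallel_def mor_def)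
      qed
      then obtain t where t: "t \<in> univ_cong (Qr r)" "t \<notin> \<sigma>" using False by blast
      obtain x y where xy: "t = (x, y)" by fastforce
      \<comment> \<open>r may be infinite. A parallel pair missing from \<sigma> supplies a finite
        level at which universality fails, so a least such level exists.\<close>
      define m where "m = max (rank x) (rank y)"
      have m: "enat m \<le> r" "(x, y) \<in> univ_upto m"
        using t(1) unfolding xy m_def by (auto simp: univ_cong_def parallel_def bounded_def univ_upto_def max_def)
      then have ex: "\<not> univ_upto m \<subseteq> \<sigma>" using t(2) xy by blast
      define p where "p = (LEAST k. \<not> univ_upto k \<subseteq> \<sigma>)"
      have p: "\<not> univ_upto p \<subseteq> \<sigma>" "p \<le> m" unfolding p_def by (rule LeastI[of _ m], rule ex) (rule Least_le, rule ex)
      have "univ_upto 0 \<subseteq> univ_upto 1" by (auto simp: univ_upto_def)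
      then have "p \<noteq> 0" "p \<noteq> 1" using p(1) u1 by auto
      then obtain q where q: "p = Suc q" "1 \<le> q" by (cases p) auto
      have uq: "univ_upto q \<subseteq> \<sigma>" using not_less_Least[of q "\<lambda>k. \<not> univ_upto k \<subseteq> \<sigma>"] q(1) unfolding p_def by auto
      have pr: "enat p \<le> r" using p(2) m(1) by (meson enat_ord_simps(1) order_trans)
      then have qr: "enat q < r" using q(1) by (metis Suc_ile_eq)
      interpret T: trans_group_congruence C ord M p "G p" r \<sigma>
        using grp[OF q(2) qr] q pr p(1) S.trans_congruence_axioms
        by (simp add: trans_group_congruence_def trans_group_congruence_axioms_def)
      have "\<sigma> = rees_nu_cong (Qr r) (rank_ideal Q (enat q)) (rank_class Q (q + 1)) T.normal_part"
        using T.sigma_eq[OF q(1) uq] rn[OF q(2) qr] T.normal_part_normal q(1) by simp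
      moreover have "T.normal_part \<lhd> class_group Q (G (q + 1))" using T.normal_part_normal q(1) by simp
      ultimately show ?thesis using q(2) qr by blast
    qed
  next
    fix \<sigma> assume "\<sigma> \<in> {diag_cong (Qr r)} \<union> {rees_nu_cong (Qr r) (rank_ideal Q (enat q)) (rank_class Q (q + 1)) N | q N.
      1 \<le> q \<and> enat q < r \<and> N \<lhd> class_group Q (G (q + 1))} \<union> {univ_cong (Qr r)}"
    then consider "\<sigma> = Id_on (bounded r)" | "\<sigma> = univ_cong (Qr r)"
      | q N where "\<sigma> = rees_nu_cong (Qr r) (rank_ideal Q (enat q)) (rank_class Q (Suc q)) N"
          "1 \<le> q" "enat q < r" "N \<lhd> class_group Q (G (Suc q))"
      unfolding diag Suc_eq_plus1 by blast
    then show "\<sigma> \<in> {\<sigma>. congruence r \<sigma>}"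
    proof cases
      case 1
      then show ?thesis using diag_cong_congruence by simp
    next
      case 2
      then show ?thesis using univ_cong_congruence by simp
    next
      case 3
      then show ?thesis
        using trans_group.rees_nu_congruence[OF grp[OF 3(2,3)] 3(4) refl suc[OF 3(3)]] rn[OF 3(2-4)] by simp
    qed
  qed
qed

section \<open>The minimal ideal\<close>

lemma bounded_one_ideal: "is_ideal Q (bounded 1)"
  unfolding is_ideal_def
proof (intro conjI ballI impI)
  obtain A where A: "A \<in> C" using C_ne by blast
  then obtain a where "a \<in> A" using C_nonempty by blast
  then obtain c where c: "c \<in> mor A A" "rank c = card {a}" using image_morphism[OF A, of "{a}"] by blast
  then show "bounded 1 \<noteq> {}" using boundedI[OF c(1), of 1 1] by (auto simp: one_enat_def)
  show "bounded 1 \<subseteq> carrier Q" by (auto simp: bounded_def)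
next
  fix x a assume x: "x \<in> bounded 1" and a: "a \<in> carrier Q"
  have m: "x \<in> mor (dm x) (cd x)" "enat (rank x) \<le> 1" using x by (simp_all add: bounded_def mor_def)
  show "pmult Q a x \<in> bounded 1" if "composable Q a x"
  proof -
    have am: "a \<in> mor (dm a) (dm x)" using that by (simp add: composable_def mor_def)
    show ?thesis using boundedI[OF comp_mor[OF am m(1)] rank_comp2[OF am m(1)] m(2)] by simp
  qed
  show "pmult Q x a \<in> bounded 1" if "composable Q x a"
  proof -
    have am: "a \<in> mor (cd x) (cd a)" using that by (simp add: composable_def mor_def)
    show ?thesis using boundedI[OF comp_mor[OF m(1) am] rank_comp1[OF m(1) am] m(2)] by simp
  qed
qed

text \<open>Every member of the ideal has rank at least 1, so each map of rank 1 factors through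
  it.\<close>

lemma bounded_one_least:
  assumes J: "is_ideal Q J"
  shows "bounded 1 \<subseteq> J"
proof
  fix z assume z: "z \<in> bounded 1"
  obtain x where x: "x \<in> J" "x \<in> M" using J by (auto simp: is_ideal_def)
  have "rank z \<le> rank x"
    using z rank_pos[OF morI[OF x(2)]] by (simp add: bounded_def one_enat_def)
  then obtain a b where ab: "a \<in> mor (dm z) (dm x)" "b \<in> mor (cd x) (cd z)" "z = a \<odot> x \<odot> b"
    using rank_le_factor[OF morI[OF x(2)] morI[of z]] z by (metis (no_types, lifting) bounded_def mem_Collect_eq)
  have "pmult Q a x \<in> J"
    using J x ab(1) unfolding is_ideal_def by (simp add: composable_def mor_def)
  then have "a \<odot> x \<in> J" by simp
  then have "pmult Q (a \<odot> x) b \<in> J"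
    using J x ab(1,2) unfolding is_ideal_def by (simp add: composable_def mor_def M_comp)
  then show "z \<in> J" using ab(3) by simp
qed

lemma minimal_ideal_iff: "minimal_ideal Q J \<longleftrightarrow> J = bounded 1"
  using bounded_one_ideal bounded_one_least unfolding minimal_ideal_def by blast

section \<open>Constant maps and their congruences\<close>

definition const :: "'a set \<Rightarrow> 'a set \<Rightarrow> 'a \<Rightarrow> 'a morphism" where
  "const A B b = (A, \<lambda>a\<in>A. b, B)"

lemma const_simps [simp]:
  "dm (const A B b) = A" "cd (const A B b) = B" "a \<in> A \<Longrightarrow> fn (const A B b) a = b"
  by (simp_all add: const_def)

lemma const_mor:
  assumes "A \<in> C" "B \<in> C" "b \<in> B"
  shows "const A B b \<in> mor A B"
proof -
  have "mono_rel A (ord A) (ord B) (\<lambda>a\<in>A. b)"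
    using linear_order_onD(1)[OF C_linear[OF assms(2)] assms(3)] by (simp add: mono_rel_def)
  then show ?thesis using M_mono[OF assms(1,2)] assms(3) by (simp add: const_def mor_def)
qed

lemma const_rank: "A \<in> C \<Longrightarrow> rank (const A B b) = 1"
  using C_nonempty[of A] by (simp add: const_def image_constant_conv)

lemma bounded_one_iff: "x \<in> bounded 1 \<longleftrightarrow> (\<exists>A\<in>C. \<exists>B\<in>C. \<exists>b\<in>B. x = const A B b)"
proof
  assume "x \<in> bounded 1"
  then have x: "x \<in> mor (dm x) (cd x)" "rank x \<le> 1" by (simp_all add: bounded_def mor_def one_enat_def)
  then have "card (fn x ` dm x) = 1" using rank_pos[OF x(1)] mor_rank[OF x(1)] by simp
  then obtain b where b: "fn x ` dm x = {b}" using card_1_singletonE by blast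
  have fb: "fn x a = b" if "a \<in> dm x" for a using imageI[OF that, of "fn x"] b by simp
  have AB: "dm x \<in> C" "cd x \<in> C" using mor_obj[OF x(1)] by simp_all
  then obtain a where "a \<in> dm x" using C_nonempty by blast
  then have bB: "b \<in> cd x" using mor_fn[OF x(1)] fb by metis
  have "x = const (dm x) (cd x) b" by (rule mor_eqI[OF x(1) const_mor[OF AB bB]]) (simp add: fb)
  then show "\<exists>A\<in>C. \<exists>B\<in>C. \<exists>b\<in>B. x = const A B b" using AB bB by blast
next
  assume "\<exists>A\<in>C. \<exists>B\<in>C. \<exists>b\<in>B. x = const A B b"
  then show "x \<in> bounded 1" using const_mor const_rank by (auto simp: bounded_def mor_def one_enat_def)
qed

lemma const_bounded: "A \<in> C \<Longrightarrow> B \<in> C \<Longrightarrow> b \<in> B \<Longrightarrow> const A B b \<in> bounded 1"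
  using bounded_one_iff by blast

lemma const_eq_iff:
  assumes "A \<in> C"
  shows "const A B b = const A' B' b' \<longleftrightarrow> A = A' \<and> B = B' \<and> b = b'"
proof
  assume h: "const A B b = const A' B' b'"
  obtain a where a: "a \<in> A" using C_nonempty[OF assms] by blast
  have "A = A'" "B = B'" using h by (simp_all add: const_def)
  moreover have "b = b'" using arg_cong[OF h, of "\<lambda>x. fn x a"] a \<open>A = A'\<close> by simp
  ultimately show "A = A' \<and> B = B' \<and> b = b'" by simp
qed simp

lemma const_comp: "A \<in> C \<Longrightarrow> B \<in> C \<Longrightarrow> b \<in> B \<Longrightarrow> const A B b \<odot> const B D d = const A D d"
  by (auto simp: const_def mcomp_def compose_def)

text \<open>One equivalence per codomain, shared by all domains, since left multiplication by
  constants changes the domain freely.\<close>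

definition rel_of :: "('a set \<Rightarrow> 'a rel) \<Rightarrow> 'a morphism rel" where
  "rel_of \<epsilon> = {(const A B b, const A B b') | A B b b'. A \<in> C \<and> B \<in> C \<and> (b, b') \<in> \<epsilon> B}"

lemma rel_of_iff:
  assumes "A \<in> C"
  shows "(const A B b, const A' B' b') \<in> rel_of \<epsilon> \<longleftrightarrow> A' = A \<and> B' = B \<and> B \<in> C \<and> (b, b') \<in> \<epsilon> B"
proof
  assume "(const A B b, const A' B' b') \<in> rel_of \<epsilon>"
  then obtain A1 B1 b1 b2 where 1: "const A B b = const A1 B1 b1" "const A' B' b' = const A1 B1 b2"
    "A1 \<in> C" "B1 \<in> C" "(b1, b2) \<in> \<epsilon> B1"
    unfolding rel_of_def by blast
  then show "A' = A \<and> B' = B \<and> B \<in> C \<and> (b, b') \<in> \<epsilon> B"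
    using const_eq_iff[OF assms, of B b A1 B1 b1] const_eq_iff[OF 1(3), of B1 b2 A' B' b'] by simp
next
  assume "A' = A \<and> B' = B \<and> B \<in> C \<and> (b, b') \<in> \<epsilon> B"
  then show "(const A B b, const A' B' b') \<in> rel_of \<epsilon>" unfolding rel_of_def using assms by blast
qed

lemma rel_of_cong: "(\<And>B. B \<in> C \<Longrightarrow> \<epsilon> B = \<epsilon>' B) \<Longrightarrow> rel_of \<epsilon> = rel_of \<epsilon>'"
  unfolding rel_of_def by blast

text \<open>Right multiplication by a constant makes the two products equal, and left multiplication
  merely replaces the domain.\<close>

lemma rel_of_congruence:
  assumes eq: "\<And>B. B \<in> C \<Longrightarrow> equiv B (\<epsilon> B)"
  shows "congruence 1 (rel_of \<epsilon>)"
proof -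
  note eqD = equivD_elem[OF eq]
  have elem: "b \<in> B \<and> b' \<in> B" if "B \<in> C" "(b, b') \<in> \<epsilon> B" for B b b' using eqD(1)[OF that(1)] that(2) by blast
  have cases: "\<exists>A B b b'. x = const A B b \<and> y = const A B b' \<and> A \<in> C \<and> B \<in> C \<and> (b, b') \<in> \<epsilon> B \<and> b \<in> B \<and> b' \<in> B"
    if "(x, y) \<in> rel_of \<epsilon>" for x y using that elem unfolding rel_of_def by blast
  have "equiv (bounded 1) (rel_of \<epsilon>)"
  proof (rule equivI_elem)
    show "rel_of \<epsilon> \<subseteq> bounded 1 \<times> bounded 1" unfolding rel_of_def using const_bounded elem by blast
    show "(x, x) \<in> rel_of \<epsilon>" if "x \<in> bounded 1" for x
      using that eqD(2) unfolding bounded_one_iff rel_of_def by blast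
    show "(y, x) \<in> rel_of \<epsilon>" if "(x, y) \<in> rel_of \<epsilon>" for x y
      using cases[OF that] eqD(3) rel_of_iff by metis
    show "(x, z) \<in> rel_of \<epsilon>" if xy: "(x, y) \<in> rel_of \<epsilon>" and yz: "(y, z) \<in> rel_of \<epsilon>" for x y z
    proof -
      obtain A B b b' where 1: "x = const A B b" "y = const A B b'" "A \<in> C" "B \<in> C" "(b, b') \<in> \<epsilon> B"
        using cases[OF xy] by blast
      obtain A' B' c c' where 2: "y = const A' B' c" "z = const A' B' c'" "(c, c') \<in> \<epsilon> B'"
        using cases[OF yz] by blast
      have "A' = A" "B' = B" "c = b'" using 1(2) 2(1) const_eq_iff[OF 1(3)] by metis+
      then show ?thesis using 1 2 eqD(4)[OF 1(4,5)] rel_of_iff by blast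
    qed
  qed
  moreover have "dm x = dm y \<and> cd x = cd y \<and> (\<forall>a\<in>bounded 1. (cd a = dm x \<longrightarrow> (a \<odot> x, a \<odot> y) \<in> rel_of \<epsilon>) \<and>
      (cd x = dm a \<longrightarrow> (x \<odot> a, y \<odot> a) \<in> rel_of \<epsilon>))" if xy: "(x, y) \<in> rel_of \<epsilon>" for x y
  proof -
    obtain A B b b' where 1: "x = const A B b" "y = const A B b'" "A \<in> C" "B \<in> C" "(b, b') \<in> \<epsilon> B" "b \<in> B" "b' \<in> B"
      using cases[OF xy] by blast
    have "(a \<odot> x, a \<odot> y) \<in> rel_of \<epsilon>" if a: "a \<in> bounded 1" "cd a = A" for a
    proof -
      obtain A' a' where "A' \<in> C" "a' \<in> A" "a = const A' A a'" using a bounded_one_iff[of a] by auto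
      then show ?thesis using 1 by (simp add: const_comp rel_of_iff)
    qed
    moreover have "(x \<odot> a, y \<odot> a) \<in> rel_of \<epsilon>" if a: "a \<in> bounded 1" "dm a = B" for a
    proof -
      obtain D d where "D \<in> C" "d \<in> D" "a = const B D d" using a bounded_one_iff[of a] by auto
      then show ?thesis using 1 by (simp add: const_comp rel_of_iff eqD(2))
    qed
    moreover have "dm x = A" "dm y = A" "cd x = B" "cd y = B" using 1 by simp_all
    ultimately show ?thesis by metis
  qed
  ultimately show ?thesis unfolding congruence_def by blast
qed

text \<open>A related pair can be moved to any other domain by a constant on the left, so the
  equivalences may be read off at one fixed object \<open>A0\<close>.\<close>

lemma congruence_rel_of:
  assumes \<sigma>: "congruence 1 \<sigma>"
  shows "\<exists>\<epsilon>. (\<forall>B\<in>C. equiv B (\<epsilon> B)) \<and> \<sigma> = rel_of \<epsilon>"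
proof -
  have eqv: "equiv (bounded 1) \<sigma>" using \<sigma> by (simp add: congruence_def)
  note s = equivD_elem[OF eqv]
  have par: "dm x = dm y \<and> cd x = cd y" if "(x, y) \<in> \<sigma>" for x y using \<sigma> that unfolding congruence_def by blast
  have left: "(a \<odot> x, a \<odot> y) \<in> \<sigma>" if "(x, y) \<in> \<sigma>" "a \<in> bounded 1" "cd a = dm x" for a x y
    using \<sigma> that unfolding congruence_def by blast
  have indep: "(const A' B b, const A' B b') \<in> \<sigma>" if h: "(const A B b, const A B b') \<in> \<sigma>" and A: "A \<in> C" "A' \<in> C" for A A' B b b'
  proof -
    obtain a where a: "a \<in> A" using C_nonempty[OF A(1)] by blast
    show ?thesis
      using left[OF h const_bounded[OF A(2,1) a]] const_comp[OF A(2,1) a] by simp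
  qed
  obtain A0 where A0: "A0 \<in> C" using C_ne by blast
  define \<epsilon> where "\<epsilon> B = {(b, b'). b \<in> B \<and> b' \<in> B \<and> (const A0 B b, const A0 B b') \<in> \<sigma>}" for B
  have "equiv B (\<epsilon> B)" if B: "B \<in> C" for B
  proof (rule equivI_elem)
    show "\<epsilon> B \<subseteq> B \<times> B" by (auto simp: \<epsilon>_def)
    show "(x, x) \<in> \<epsilon> B" if "x \<in> B" for x using s(2)[OF const_bounded[OF A0 B that]] that by (simp add: \<epsilon>_def)
    show "(y, x) \<in> \<epsilon> B" if "(x, y) \<in> \<epsilon> B" for x y using that s(3) by (simp add: \<epsilon>_def)
    show "(x, z) \<in> \<epsilon> B" if "(x, y) \<in> \<epsilon> B" "(y, z) \<in> \<epsilon> B" for x y z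
      using that s(4)[of "const A0 B x" "const A0 B y" "const A0 B z"] by (simp add: \<epsilon>_def)
  qed
  moreover have "\<sigma> = rel_of \<epsilon>"
  proof (intro equalityI subsetI)
    fix t assume t: "t \<in> \<sigma>"
    obtain x y where xy: "t = (x, y)" by fastforce
    then have "x \<in> bounded 1" "y \<in> bounded 1" using s(1) t by auto
    then obtain A B b A' B' b' where 1: "A \<in> C" "B \<in> C" "b \<in> B" "x = const A B b" "b' \<in> B'" "y = const A' B' b'"
      unfolding bounded_one_iff by blast
    have "A' = A" "B' = B" using par[of x y] t xy 1 by simp_all
    then have "(b, b') \<in> \<epsilon> B" using indep[of A B b b' A0] t xy 1 A0 by (simp add: \<epsilon>_def)
    then show "t \<in> rel_of \<epsilon>" using xy 1 \<open>A' = A\<close> \<open>B' = B\<close> by (simp add: rel_of_iff)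
  next
    fix t assume "t \<in> rel_of \<epsilon>"
    then obtain A B b b' where "t = (const A B b, const A B b')" "A \<in> C" "B \<in> C" "(b, b') \<in> \<epsilon> B"
      unfolding rel_of_def by blast
    then show "t \<in> \<sigma>" using indep[of A0 B b b' A] A0 by (simp add: \<epsilon>_def)
  qed
  ultimately show ?thesis by blast
qed

lemma rel_of_subset_iff:
  assumes "\<And>B. B \<in> C \<Longrightarrow> equiv B (\<epsilon> B)"
  shows "rel_of \<epsilon> \<subseteq> rel_of \<epsilon>' \<longleftrightarrow> (\<forall>B\<in>C. \<epsilon> B \<subseteq> \<epsilon>' B)"
proof
  assume h: "rel_of \<epsilon> \<subseteq> rel_of \<epsilon>'"
  obtain A where A: "A \<in> C" using C_ne by blast
  show "\<forall>B\<in>C. \<epsilon> B \<subseteq> \<epsilon>' B"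
  proof (intro ballI subrelI)
    fix B b b' assume B: "B \<in> C" "(b, b') \<in> \<epsilon> B"
    then have "(const A B b, const A B b') \<in> rel_of \<epsilon>" using rel_of_iff[OF A] by simp
    then have "(const A B b, const A B b') \<in> rel_of \<epsilon>'" using h by blast
    then show "(b, b') \<in> \<epsilon>' B" using rel_of_iff[OF A] by simp
  qed
next
  assume "\<forall>B\<in>C. \<epsilon> B \<subseteq> \<epsilon>' B"
  then show "rel_of \<epsilon> \<subseteq> rel_of \<epsilon>'" unfolding rel_of_def by blast
qed

text \<open>The constant from A to B with value b becomes (A, (B, b)). Each \<open>X A\<close> is a
  single point, so \<open>E1\<close> carries no information; \<open>Y B\<close> is a tagged copy of
  B because members of C may overlap.\<close>

lemma ex_partial_rect_band_iso:
  "\<exists>(X :: 'a set \<Rightarrow> 'a set set) (Y :: 'a set \<Rightarrow> ('a set \<times> 'a) set) \<phi>.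
     band_data C X Y \<and> psemigroup_iso (Qr 1) (partial_rect_band C X Y) \<phi> \<and>
     Cong (Qr 1) = {pullback_rel (bounded 1) \<phi> (band_cong C X Y E1 E2) | E1 E2.
       \<forall>A\<in>C. E1 A \<in> Eq (X A) \<and> E2 A \<in> Eq (Y A)}"
proof (intro exI conjI)
  define X :: "'a set \<Rightarrow> 'a set set" where "X A = {A}" for A
  define Y :: "'a set \<Rightarrow> ('a set \<times> 'a) set" where "Y B = {B} \<times> B" for B
  \<comment> \<open>On a constant map the chosen point of the nonempty domain does not affect the
    value.\<close>
  define \<phi> :: "'a morphism \<Rightarrow> 'a set \<times> 'a set \<times> 'a" where "\<phi> x = (dm x, cd x, fn x (SOME a. a \<in> dm x))" for x
  let ?B = "partial_rect_band C X Y"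
  have \<phi>: "\<phi> (const A B b) = (A, B, b)" if "A \<in> C" for A B b
    using C_nonempty[OF that] some_in_eq[of A] by (simp add: \<phi>_def)
  show "band_data C X Y"
    using C_nonempty by (auto simp: band_data_def X_def Y_def disjoint_family_on_def)
  have carr: "carrier ?B = {(A, B, b) | A B b. A \<in> C \<and> B \<in> C \<and> b \<in> B}"
    by (auto simp: partial_rect_band_def X_def Y_def)
  have dr: "dom_of ?B (A, B, b) = A" "rng_of ?B (A, B, b) = B" if "A \<in> C" "B \<in> C" "b \<in> B" for A B b
    using that by (auto simp: partial_rect_band_def X_def Y_def intro!: the_equality)
  have pm: "pmult ?B (A, y) (A', y') = (A, y')" for A A' y y'
    by (simp add: partial_rect_band_def)
  have "bij_betw \<phi> (bounded 1) (carrier ?B)"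
    unfolding bij_betw_def
  proof
    show "inj_on \<phi> (bounded 1)"
    proof (rule inj_onI)
      fix x y assume "x \<in> bounded 1" "y \<in> bounded 1" and eq: "\<phi> x = \<phi> y"
      then obtain A B b A' B' b' where "A \<in> C" "A' \<in> C" "x = const A B b" "y = const A' B' b'"
        unfolding bounded_one_iff by blast
      then show "x = y" using eq by (simp add: \<phi>)
    qed
    show "\<phi> ` bounded 1 = carrier ?B"
    proof (intro equalityI subsetI)
      fix t assume "t \<in> \<phi> ` bounded 1"
      then obtain x where x: "x \<in> bounded 1" "t = \<phi> x" by blast
      then obtain A B b where "A \<in> C" "B \<in> C" "b \<in> B" "t = \<phi> (const A B b)"
        unfolding bounded_one_iff by blast
      then show "t \<in> carrier ?B" unfolding carr by (simp add: \<phi>)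
    next
      fix t assume "t \<in> carrier ?B"
      then obtain A B b where "A \<in> C" "B \<in> C" "b \<in> B" "t = (A, B, b)" unfolding carr by blast
      then show "t \<in> \<phi> ` bounded 1" using imageI[OF const_bounded[of A B b], of \<phi>] by (simp add: \<phi>)
    qed
  qed
  moreover have "dom_of ?B (\<phi> x) = dm x \<and> rng_of ?B (\<phi> x) = cd x" if x: "x \<in> bounded 1" for x
  proof -
    obtain A B b where "A \<in> C" "B \<in> C" "b \<in> B" "x = const A B b" using x bounded_one_iff by blast
    then show ?thesis by (simp add: \<phi> dr)
  qed
  moreover have "\<phi> (x \<odot> y) = pmult ?B (\<phi> x) (\<phi> y)" if xy: "x \<in> bounded 1" "y \<in> bounded 1" "cd x = dm y" for x y
  proof -
    obtain A B b where 1: "A \<in> C" "B \<in> C" "b \<in> B" "x = const A B b" using xy(1) bounded_one_iff by blast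
    obtain B' D d where 2: "B' \<in> C" "D \<in> C" "d \<in> D" "y = const B' D d" using xy(2) bounded_one_iff by blast
    have "B' = B" using xy(3) 1 2 by simp
    then show ?thesis using 1 2 by (simp add: \<phi> const_comp pm)
  qed
  ultimately show "psemigroup_iso (Qr 1) ?B \<phi>"
    unfolding psemigroup_iso_def composable_def by simp
  have pb: "pullback_rel (bounded 1) \<phi> (band_cong C X Y E1 E2) = rel_of (\<lambda>B. {(b, b'). ((B, b), (B, b')) \<in> E2 B})"
    if E: "\<forall>A\<in>C. E1 A \<in> Eq (X A) \<and> E2 A \<in> Eq (Y A)" for E1 E2
  proof -
    have E1: "(A, A) \<in> E1 A" if "A \<in> C" for A
      using equivD_elem(2)[of "X A" "E1 A" A] E that by (simp add: Eq_def X_def)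
    have E2: "E2 B \<subseteq> ({B} \<times> B) \<times> ({B} \<times> B)" if "B \<in> C" for B
      using equivD_elem(1)[of "Y B" "E2 B"] E that by (simp add: Eq_def Y_def)
    have bc: "((A, B, b), (A', B', b')) \<in> band_cong C X Y E1 E2 \<longleftrightarrow> A' = A \<and> B' = B \<and> ((B, b), (B, b')) \<in> E2 B"
      if "A \<in> C" "B \<in> C" "b \<in> B" "b' \<in> B'" for A B b A' B' b'
      using E1 that by (auto simp: band_cong_def X_def Y_def)
    show ?thesis
    proof (intro equalityI subsetI)
      fix t assume "t \<in> pullback_rel (bounded 1) \<phi> (band_cong C X Y E1 E2)"
      then obtain x y where t: "t = (x, y)" "x \<in> bounded 1" "y \<in> bounded 1" "(\<phi> x, \<phi> y) \<in> band_cong C X Y E1 E2"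
        unfolding pullback_rel_def by blast
      obtain A B b where 1: "A \<in> C" "B \<in> C" "b \<in> B" "x = const A B b" using t(2) bounded_one_iff by blast
      obtain A' B' b' where 2: "A' \<in> C" "B' \<in> C" "b' \<in> B'" "y = const A' B' b'" using t(3) bounded_one_iff by blast
      show "t \<in> rel_of (\<lambda>B. {(b, b'). ((B, b), (B, b')) \<in> E2 B})"
        using t(1,4) bc[OF 1(1-3) 2(3)] 1 2 by (simp add: \<phi> rel_of_iff)
    next
      fix t assume "t \<in> rel_of (\<lambda>B. {(b, b'). ((B, b), (B, b')) \<in> E2 B})"
      then obtain A B b b' where t: "t = (const A B b, const A B b')" "A \<in> C" "B \<in> C" "((B, b), (B, b')) \<in> E2 B"
        unfolding rel_of_def by blast
      then have "b \<in> B" "b' \<in> B" using E2[of B] by auto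
      then show "t \<in> pullback_rel (bounded 1) \<phi> (band_cong C X Y E1 E2)"
        using t bc[of A B b b' B A] const_bounded by (simp add: pullback_rel_def \<phi>)
    qed
  qed
  show "Cong (Qr 1) = {pullback_rel (bounded 1) \<phi> (band_cong C X Y E1 E2) | E1 E2.
       \<forall>A\<in>C. E1 A \<in> Eq (X A) \<and> E2 A \<in> Eq (Y A)}"
    unfolding Cong_Qr
  proof (intro equalityI subsetI)
    fix \<sigma> assume "\<sigma> \<in> {\<sigma>. congruence 1 \<sigma>}"
    then obtain \<epsilon> where \<epsilon>: "\<And>B. B \<in> C \<Longrightarrow> equiv B (\<epsilon> B)" "\<sigma> = rel_of \<epsilon>" using congruence_rel_of by blast
    define E1 :: "'a set \<Rightarrow> 'a set rel" where "E1 A = {(A, A)}" for A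
    define E2 :: "'a set \<Rightarrow> ('a set \<times> 'a) rel" where "E2 B = {((B, b), (B, b')) | b b'. (b, b') \<in> \<epsilon> B}" for B
    have E: "\<forall>A\<in>C. E1 A \<in> Eq (X A) \<and> E2 A \<in> Eq (Y A)"
    proof
      fix A assume A: "A \<in> C"
      note e = equivD_elem[OF \<epsilon>(1)[OF A]]
      have "equiv (X A) (E1 A)" by (rule equivI_elem) (auto simp: X_def E1_def)
      moreover have "equiv (Y A) (E2 A)"
      proof (rule equivI_elem)
        show "E2 A \<subseteq> Y A \<times> Y A" using e(1) by (auto simp: E2_def Y_def)
        show "(x, x) \<in> E2 A" if "x \<in> Y A" for x using that e(2) by (auto simp: E2_def Y_def)
        show "(y, x) \<in> E2 A" if "(x, y) \<in> E2 A" for x y using that e(3) by (auto simp: E2_def)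
        show "(x, z) \<in> E2 A" if "(x, y) \<in> E2 A" "(y, z) \<in> E2 A" for x y z
          using that e(4) unfolding E2_def by blast
      qed
      ultimately show "E1 A \<in> Eq (X A) \<and> E2 A \<in> Eq (Y A)" by (simp add: Eq_def)
    qed
    have "{(b, b'). ((B, b), (B, b')) \<in> E2 B} = \<epsilon> B" for B by (auto simp: E2_def)
    then have "\<sigma> = pullback_rel (bounded 1) \<phi> (band_cong C X Y E1 E2)" using pb[OF E] \<epsilon>(2) by simp
    then show "\<sigma> \<in> {pullback_rel (bounded 1) \<phi> (band_cong C X Y E1 E2) | E1 E2.
       \<forall>A\<in>C. E1 A \<in> Eq (X A) \<and> E2 A \<in> Eq (Y A)}" using E by blast
  next
    fix \<sigma> assume "\<sigma> \<in> {pullback_rel (bounded 1) \<phi> (band_cong C X Y E1 E2) | E1 E2.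
       \<forall>A\<in>C. E1 A \<in> Eq (X A) \<and> E2 A \<in> Eq (Y A)}"
    then obtain E1 E2 where E: "\<forall>A\<in>C. E1 A \<in> Eq (X A) \<and> E2 A \<in> Eq (Y A)"
      and \<sigma>: "\<sigma> = pullback_rel (bounded 1) \<phi> (band_cong C X Y E1 E2)" by blast
    have "equiv B {(b, b'). ((B, b), (B, b')) \<in> E2 B}" if B: "B \<in> C" for B
    proof -
      have "equiv (Y B) (E2 B)" using E B by (simp add: Eq_def)
      note e = equivD_elem[OF this]
      show ?thesis
      proof (rule equivI_elem)
        show "{(b, b'). ((B, b), (B, b')) \<in> E2 B} \<subseteq> B \<times> B" using e(1) by (auto simp: Y_def)
        show "(x, x) \<in> {(b, b'). ((B, b), (B, b')) \<in> E2 B}" if "x \<in> B" for x using that e(2) by (simp add: Y_def)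
        show "(y, x) \<in> {(b, b'). ((B, b), (B, b')) \<in> E2 B}" if "(x, y) \<in> {(b, b'). ((B, b), (B, b')) \<in> E2 B}" for x y
          using that e(3) by simp
        show "(x, z) \<in> {(b, b'). ((B, b), (B, b')) \<in> E2 B}"
          if "(x, y) \<in> {(b, b'). ((B, b), (B, b')) \<in> E2 B}" "(y, z) \<in> {(b, b'). ((B, b), (B, b')) \<in> E2 B}" for x y z
          using that e(4)[of "(B, x)" "(B, y)" "(B, z)"] by simp
      qed
    qed
    then show "\<sigma> \<in> {\<sigma>. congruence 1 \<sigma>}" unfolding \<sigma> pb[OF E] mem_Collect_eq by (rule rel_of_congruence)
  qed
qed

end

section \<open>Order isomorphisms of lattices\<close>

text \<open>Least upper and greatest lower bounds are transported back along the order isomorphism.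
  This makes L a lattice, as \<open>join_pres\<close> and \<open>meet_pres\<close> demand, and
  determines the joins and meets.\<close>

lemma order_iso_lattice_isomorphic:
  fixes L :: "'x gorder" and K :: "'y gorder"
  assumes K: "lattice K" and eq: "eq L = (=)" and bij: "bij_betw \<Phi> (carrier L) (carrier K)"
    and le: "\<And>x y. x \<in> carrier L \<Longrightarrow> y \<in> carrier L \<Longrightarrow> le L x y \<longleftrightarrow> le K (\<Phi> x) (\<Phi> y)"
  shows "lattice_isomorphic L K"
proof -
  interpret K: lattice K by (rule K)
  have car: "\<Phi> x \<in> carrier K" if "x \<in> carrier L" for x using bij that by (auto simp: bij_betw_def)
  have sur: "\<exists>x\<in>carrier L. y = \<Phi> x" if "y \<in> carrier K" for y using bij that by (auto simp: bij_betw_def)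
  have inj: "x = y" if "\<Phi> x = \<Phi> y" "x \<in> carrier L" "y \<in> carrier L" for x y
    using bij that by (auto simp: bij_betw_def inj_on_def)
  have po: "partial_order L"
  proof unfold_locales
    show "x \<sqsubseteq>\<^bsub>L\<^esub> x" if "x \<in> carrier L" for x using that le car by simp
    show "x .=\<^bsub>L\<^esub> y" if "x \<sqsubseteq>\<^bsub>L\<^esub> y" "y \<sqsubseteq>\<^bsub>L\<^esub> x" "x \<in> carrier L" "y \<in> carrier L" for x y
      using that le car inj K.le_antisym eq by simp
    show "x \<sqsubseteq>\<^bsub>L\<^esub> z" if "x \<sqsubseteq>\<^bsub>L\<^esub> y" "y \<sqsubseteq>\<^bsub>L\<^esub> z" "x \<in> carrier L" "y \<in> carrier L" "z \<in> carrier L" for x y z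
      using that le car K.le_trans[of "\<Phi> x" "\<Phi> y" "\<Phi> z"] by simp
  qed (simp_all add: eq)
  have ex: "\<exists>s\<in>carrier L. \<Phi> s = \<Phi> x \<squnion>\<^bsub>K\<^esub> \<Phi> y" "\<exists>s\<in>carrier L. \<Phi> s = \<Phi> x \<sqinter>\<^bsub>K\<^esub> \<Phi> y"
    if "x \<in> carrier L" "y \<in> carrier L" for x y
    using sur[OF K.join_closed[OF car[OF that(1)] car[OF that(2)]]] sur[OF K.meet_closed[OF car[OF that(1)] car[OF that(2)]]]
    by (metis, metis)
  have lub: "least L s (Upper L {x, y})" if s: "s \<in> carrier L" "\<Phi> s = \<Phi> x \<squnion>\<^bsub>K\<^esub> \<Phi> y" and xy: "x \<in> carrier L" "y \<in> carrier L" for s x y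
    unfolding least_def Upper_def
  proof (intro conjI)
    have "\<Phi> x \<sqsubseteq>\<^bsub>K\<^esub> \<Phi> s" "\<Phi> y \<sqsubseteq>\<^bsub>K\<^esub> \<Phi> s" using K.join_left K.join_right car xy s(2) by simp_all
    then show "s \<in> {u. \<forall>z. z \<in> {x, y} \<inter> carrier L \<longrightarrow> z \<sqsubseteq>\<^bsub>L\<^esub> u} \<inter> carrier L" using le xy s(1) by auto
    show "\<forall>z\<in>{u. \<forall>z. z \<in> {x, y} \<inter> carrier L \<longrightarrow> z \<sqsubseteq>\<^bsub>L\<^esub> u} \<inter> carrier L. s \<sqsubseteq>\<^bsub>L\<^esub> z"
    proof
      fix z assume "z \<in> {u. \<forall>z. z \<in> {x, y} \<inter> carrier L \<longrightarrow> z \<sqsubseteq>\<^bsub>L\<^esub> u} \<inter> carrier L"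
      then have z: "z \<in> carrier L" "x \<sqsubseteq>\<^bsub>L\<^esub> z" "y \<sqsubseteq>\<^bsub>L\<^esub> z" using xy by auto
      then have "\<Phi> x \<squnion>\<^bsub>K\<^esub> \<Phi> y \<sqsubseteq>\<^bsub>K\<^esub> \<Phi> z" using K.join_le car le xy by simp
      then show "s \<sqsubseteq>\<^bsub>L\<^esub> z" using le s z by simp
    qed
  qed auto
  have glb: "greatest L s (Lower L {x, y})" if s: "s \<in> carrier L" "\<Phi> s = \<Phi> x \<sqinter>\<^bsub>K\<^esub> \<Phi> y" and xy: "x \<in> carrier L" "y \<in> carrier L" for s x y
    unfolding greatest_def Lower_def
  proof (intro conjI)
    have "\<Phi> s \<sqsubseteq>\<^bsub>K\<^esub> \<Phi> x" "\<Phi> s \<sqsubseteq>\<^bsub>K\<^esub> \<Phi> y" using K.meet_left K.meet_right car xy s(2) by simp_all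
    then show "s \<in> {l. \<forall>z. z \<in> {x, y} \<inter> carrier L \<longrightarrow> l \<sqsubseteq>\<^bsub>L\<^esub> z} \<inter> carrier L" using le xy s(1) by auto
    show "\<forall>z\<in>{l. \<forall>z. z \<in> {x, y} \<inter> carrier L \<longrightarrow> l \<sqsubseteq>\<^bsub>L\<^esub> z} \<inter> carrier L. z \<sqsubseteq>\<^bsub>L\<^esub> s"
    proof
      fix z assume "z \<in> {l. \<forall>z. z \<in> {x, y} \<inter> carrier L \<longrightarrow> l \<sqsubseteq>\<^bsub>L\<^esub> z} \<inter> carrier L"
      then have z: "z \<in> carrier L" "z \<sqsubseteq>\<^bsub>L\<^esub> x" "z \<sqsubseteq>\<^bsub>L\<^esub> y" using xy by auto
      then have "\<Phi> z \<sqsubseteq>\<^bsub>K\<^esub> \<Phi> x \<sqinter>\<^bsub>K\<^esub> \<Phi> y" using K.meet_le car le xy by simp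
      then show "z \<sqsubseteq>\<^bsub>L\<^esub> s" using le s z by simp
    qed
  qed auto
  interpret L: partial_order L by (rule po)
  interpret L: lattice L
  proof unfold_locales
    show "\<exists>s. least L s (Upper L {x, y})" if xy: "x \<in> carrier L" "y \<in> carrier L" for x y
    proof -
      obtain s where s: "s \<in> carrier L" "\<Phi> s = \<Phi> x \<squnion>\<^bsub>K\<^esub> \<Phi> y" using ex(1)[OF xy] by blast
      show ?thesis by (rule exI, rule lub[OF s xy])
    qed
    show "\<exists>s. greatest L s (Lower L {x, y})" if xy: "x \<in> carrier L" "y \<in> carrier L" for x y
    proof -
      obtain s where s: "s \<in> carrier L" "\<Phi> s = \<Phi> x \<sqinter>\<^bsub>K\<^esub> \<Phi> y" using ex(2)[OF xy] by blast
      show ?thesis by (rule exI, rule glb[OF s xy])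
    qed
  qed
  have "\<Phi> (x \<squnion>\<^bsub>L\<^esub> y) = \<Phi> x \<squnion>\<^bsub>K\<^esub> \<Phi> y" if xy: "x \<in> carrier L" "y \<in> carrier L" for x y
  proof -
    obtain s where s: "s \<in> carrier L" "\<Phi> s = \<Phi> x \<squnion>\<^bsub>K\<^esub> \<Phi> y" using ex(1)[OF xy] by blast
    have "x \<squnion>\<^bsub>L\<^esub> y = s"
      unfolding join_def sup_def
      by (rule some_equality, rule lub[OF s xy], erule L.least_unique, rule lub[OF s xy])
    then show ?thesis using s by simp
  qed
  moreover have "\<Phi> (x \<sqinter>\<^bsub>L\<^esub> y) = \<Phi> x \<sqinter>\<^bsub>K\<^esub> \<Phi> y" if xy: "x \<in> carrier L" "y \<in> carrier L" for x y
  proof -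
    obtain s where s: "s \<in> carrier L" "\<Phi> s = \<Phi> x \<sqinter>\<^bsub>K\<^esub> \<Phi> y" using ex(2)[OF xy] by blast
    have "x \<sqinter>\<^bsub>L\<^esub> y = s"
      unfolding meet_def inf_def
      by (rule some_equality, rule glb[OF s xy], erule L.greatest_unique, rule glb[OF s xy])
    then show ?thesis using s by simp
  qed
  ultimately show ?thesis
    unfolding lattice_isomorphic_def join_pres_def meet_pres_def
    using bij K L.lattice_axioms by blast
qed

lemma equiv_trancl_Un:
  assumes "equiv A r" "equiv A s"
  shows "equiv A ((r \<union> s)\<^sup>+)"
proof (rule equivI_elem)
  note r = equivD_elem[OF assms(1)] and s = equivD_elem[OF assms(2)]
  have "r \<union> s \<subseteq> A \<times> A" using r(1) s(1) by blast
  then show "(r \<union> s)\<^sup>+ \<subseteq> A \<times> A" by (rule trancl_subset_Sigma)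
  show "(x, x) \<in> (r \<union> s)\<^sup>+" if "x \<in> A" for x using r(2)[OF that] by blast
  have "sym (r \<union> s)" using r(3) s(3) by (blast intro: symI)
  then have "sym ((r \<union> s)\<^sup>+)" by (rule sym_trancl)
  then show "(y, x) \<in> (r \<union> s)\<^sup>+" if "(x, y) \<in> (r \<union> s)\<^sup>+" for x y using that by (rule symD)
  show "(x, z) \<in> (r \<union> s)\<^sup>+" if "(x, y) \<in> (r \<union> s)\<^sup>+" "(y, z) \<in> (r \<union> s)\<^sup>+" for x y z
    using that by (rule trancl_trans)
qed

text \<open>Meets and joins are taken componentwise: intersection, and transitive closure of the
  union.\<close>

lemma lattice_prod_Eq: "lattice (prod_Eq_lattice C)"
proof -
  let ?L = "prod_Eq_lattice C"
  have carr: "f \<in> carrier ?L \<longleftrightarrow> f \<in> extensional C \<and> (\<forall>A\<in>C. equiv A (f A))" for f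
    by (auto simp: prod_Eq_lattice_def Eq_def PiE_def Pi_iff)
  have le: "f \<sqsubseteq>\<^bsub>?L\<^esub> g \<longleftrightarrow> (\<forall>A\<in>C. f A \<subseteq> g A)" for f g by (simp add: prod_Eq_lattice_def)
  have eq: "(.=\<^bsub>?L\<^esub>) = (=)" by (simp add: prod_Eq_lattice_def)
  interpret partial_order ?L
  proof unfold_locales
    show "f .=\<^bsub>?L\<^esub> g" if "f \<sqsubseteq>\<^bsub>?L\<^esub> g" "g \<sqsubseteq>\<^bsub>?L\<^esub> f" "f \<in> carrier ?L" "g \<in> carrier ?L" for f g
      using that unfolding le carr eq by (intro extensionalityI[of f C g]) auto
    show "f \<sqsubseteq>\<^bsub>?L\<^esub> h" if "f \<sqsubseteq>\<^bsub>?L\<^esub> g" "g \<sqsubseteq>\<^bsub>?L\<^esub> h" for f g h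
      using that unfolding le by blast
  qed (simp_all add: eq le)
  show ?thesis
  proof unfold_locales
    fix f g assume f: "f \<in> carrier ?L" and g: "g \<in> carrier ?L"
    let ?s = "\<lambda>A\<in>C. (f A \<union> g A)\<^sup>+" and ?i = "\<lambda>A\<in>C. f A \<inter> g A"
    have s: "?s \<in> carrier ?L" using f g unfolding carr by (simp add: equiv_trancl_Un)
    have "equiv A (f A \<inter> g A)" if "A \<in> C" for A
    proof -
      have eq: "equiv A (f A)" "equiv A (g A)" using f g that by (simp_all add: carr)
      show ?thesis
        using equivD_elem(1)[OF eq(1)] equivD_elem(2-)[OF eq(1)] equivD_elem(2-)[OF eq(2)]
        by (intro equivI_elem) blast+
    qed
    then have i: "?i \<in> carrier ?L" unfolding carr by simp
    show "\<exists>s. least ?L s (Upper ?L {f, g})"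
    proof (intro exI least_UpperI)
      show "x \<sqsubseteq>\<^bsub>?L\<^esub> ?s" if "x \<in> {f, g}" for x using that unfolding le by auto
      show "?s \<sqsubseteq>\<^bsub>?L\<^esub> y" if y: "y \<in> Upper ?L {f, g}" for y
        unfolding le
      proof
        fix A assume A: "A \<in> C"
        have yc: "y \<in> carrier ?L" "f \<sqsubseteq>\<^bsub>?L\<^esub> y" "g \<sqsubseteq>\<^bsub>?L\<^esub> y" using y f g by (auto simp: Upper_def)
        then have "f A \<union> g A \<subseteq> y A" using A unfolding le by blast
        moreover have "trans (y A)" using yc(1) A by (simp add: carr equiv_def)
        ultimately have "(f A \<union> g A)\<^sup>+ \<subseteq> y A" by (metis trancl_id trancl_mono subsetI)
        then show "?s A \<subseteq> y A" using A by simp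
      qed
    qed (use f g s in auto)
    show "\<exists>i. greatest ?L i (Lower ?L {f, g})"
    proof (intro exI greatest_LowerI)
      show "?i \<sqsubseteq>\<^bsub>?L\<^esub> x" if "x \<in> {f, g}" for x using that unfolding le by auto
      show "y \<sqsubseteq>\<^bsub>?L\<^esub> ?i" if y: "y \<in> Lower ?L {f, g}" for y
      proof -
        have "y \<sqsubseteq>\<^bsub>?L\<^esub> f" "y \<sqsubseteq>\<^bsub>?L\<^esub> g" using y f g by (auto simp: Lower_def)
        then show ?thesis unfolding le by simp
      qed
    qed (use f g i in auto)
  qed
qed

context trans_subcat
begin

lemma lattice_iso_prod_Eq: "lattice_isomorphic (cong_lattice (Qr 1)) (prod_Eq_lattice C)"
proof -
  let ?K = "prod_Eq_lattice C" and ?L = "cong_lattice (Qr 1)"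
  have carr: "\<epsilon> \<in> carrier ?K \<longleftrightarrow> \<epsilon> \<in> extensional C \<and> (\<forall>A\<in>C. equiv A (\<epsilon> A))" for \<epsilon>
    by (auto simp: prod_Eq_lattice_def Eq_def PiE_def Pi_iff)
  have sub: "rel_of \<epsilon> \<subseteq> rel_of \<epsilon>' \<longleftrightarrow> le ?K \<epsilon> \<epsilon>'" if "\<epsilon> \<in> carrier ?K" "\<epsilon>' \<in> carrier ?K" for \<epsilon> \<epsilon>'
    using rel_of_subset_iff[of \<epsilon> \<epsilon>'] that unfolding carr by (simp add: prod_Eq_lattice_def)
  have "bij_betw rel_of (carrier ?K) (carrier ?L)"
    unfolding bij_betw_def
  proof
    show "inj_on rel_of (carrier ?K)"
    proof (rule inj_onI)
      fix \<epsilon> \<epsilon>' assume h: "\<epsilon> \<in> carrier ?K" "\<epsilon>' \<in> carrier ?K" "rel_of \<epsilon> = rel_of \<epsilon>'"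
      then have "le ?K \<epsilon> \<epsilon>'" "le ?K \<epsilon>' \<epsilon>" using sub by blast+
      then have "\<epsilon> A = \<epsilon>' A" if "A \<in> C" for A using that by (simp add: prod_Eq_lattice_def subset_antisym)
      then show "\<epsilon> = \<epsilon>'" using h(1,2) unfolding carr by (intro extensionalityI[of \<epsilon> C \<epsilon>']) auto
    qed
    show "rel_of ` carrier ?K = carrier ?L"
    proof (intro equalityI subsetI)
      fix \<sigma> assume "\<sigma> \<in> rel_of ` carrier ?K"
      then show "\<sigma> \<in> carrier ?L" using rel_of_congruence unfolding carr by (auto simp: cong_lattice_def Cong_Qr carr)
    next
      fix \<sigma> assume "\<sigma> \<in> carrier ?L"
      then obtain \<epsilon> where \<epsilon>: "\<And>B. B \<in> C \<Longrightarrow> equiv B (\<epsilon> B)" "\<sigma> = rel_of \<epsilon>"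
        using congruence_rel_of[of \<sigma>] by (auto simp: cong_lattice_def Cong_Qr)
      have "restrict \<epsilon> C \<in> carrier ?K" "\<sigma> = rel_of (restrict \<epsilon> C)"
        unfolding carr using \<epsilon> rel_of_cong[of \<epsilon> "restrict \<epsilon> C"] by simp_all
      then show "\<sigma> \<in> rel_of ` carrier ?K" by blast
    qed
  qed
  \<comment> \<open>\<open>rel_of\<close> runs from families to congruences; it is inverted because
    the transfer of lattice structure takes the known lattice as its target.\<close>
  then have inv: "bij_betw (inv_into (carrier ?K) rel_of) (carrier ?L) (carrier ?K)"
    and im: "rel_of ` carrier ?K = carrier ?L"
    by (rule bij_betw_inv_into, rule bij_betw_imp_surj_on)
  show ?thesis
  proof (rule order_iso_lattice_isomorphic[OF lattice_prod_Eq _ inv])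
    show "(.=\<^bsub>?L\<^esub>) = (=)" by (simp add: cong_lattice_def)
    fix \<sigma> \<tau> assume "\<sigma> \<in> carrier ?L" "\<tau> \<in> carrier ?L"
    then have st: "\<sigma> \<in> rel_of ` carrier ?K" "\<tau> \<in> rel_of ` carrier ?K" using im by simp_all
    show "\<sigma> \<sqsubseteq>\<^bsub>?L\<^esub> \<tau> \<longleftrightarrow> inv_into (carrier ?K) rel_of \<sigma> \<sqsubseteq>\<^bsub>?K\<^esub> inv_into (carrier ?K) rel_of \<tau>"
      using sub[OF inv_into_into[OF st(1)] inv_into_into[OF st(2)]] f_inv_into_f[OF st(1)] f_inv_into_f[OF st(2)]
      by (simp add: cong_lattice_def)
  qed
qed

end

section \<open>The four categories\<close>

text \<open>K is a property of plain functions. Its independence of values outside A allows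
  composites and regular inverses to be made extensional.\<close>

lemma trans_subcatI:
  fixes K :: "'a set \<Rightarrow> 'a set \<Rightarrow> ('a \<Rightarrow> 'a) \<Rightarrow> bool"
  assumes C: "C \<noteq> {}" "\<forall>A\<in>C. finite A \<and> A \<noteq> {} \<and> linear_order_on A (ord A)"
    and cong: "\<And>A B f g. \<forall>a\<in>A. f a = g a \<Longrightarrow> K A B f \<Longrightarrow> K A B g"
    and mono: "\<And>A B f. A \<in> C \<Longrightarrow> B \<in> C \<Longrightarrow> mono_rel A (ord A) (ord B) f \<Longrightarrow> K A B f"
    and comp: "\<And>A B D f g. A \<in> C \<Longrightarrow> B \<in> C \<Longrightarrow> D \<in> C \<Longrightarrow> f \<in> A \<rightarrow> B \<Longrightarrow> K A B f \<Longrightarrow> K B D g \<Longrightarrow> K A D (g \<circ> f)"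
    and reg: "\<And>A B f. A \<in> C \<Longrightarrow> B \<in> C \<Longrightarrow> f \<in> A \<rightarrow> B \<Longrightarrow> K A B f \<Longrightarrow>
      \<exists>g\<in>B \<rightarrow> A. K B A g \<and> (\<forall>a\<in>A. f (g (f a)) = f a)"
    and M: "\<And>x. x \<in> M \<longleftrightarrow> dm x \<in> C \<and> cd x \<in> C \<and> fn x \<in> dm x \<rightarrow>\<^sub>E cd x \<and> K (dm x) (cd x) (fn x)"
  shows "trans_subcat C ord M"
proof
  show "x \<odot> y \<in> M" if x: "x \<in> M" and y: "y \<in> M" and xy: "cd x = dm y" for x y
  proof -
    have f: "fn x \<in> dm x \<rightarrow> cd x" and g: "fn y \<in> cd x \<rightarrow> cd y" using x y xy unfolding M PiE_def by auto
    have "K (dm x) (cd y) (fn y \<circ> fn x)" using comp[of "dm x" "cd x" "cd y" "fn x" "fn y"] x y xy f unfolding M by auto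
    then have "K (dm x) (cd y) (compose (dm x) (fn y) (fn x))" by (rule cong[rotated]) (simp add: compose_def)
    moreover have "compose (dm x) (fn y) (fn x) \<in> dm x \<rightarrow>\<^sub>E cd y"
      using f g by (auto simp: compose_def)
    ultimately show ?thesis using x y unfolding M mcomp_def by simp
  qed
  show "\<exists>x'\<in>M. dm x' = cd x \<and> cd x' = dm x \<and> (\<forall>a\<in>dm x. fn x (fn x' (fn x a)) = fn x a)" if x: "x \<in> M" for x
  proof -
    have f: "fn x \<in> dm x \<rightarrow> cd x" using x unfolding M PiE_def by auto
    obtain g where g: "g \<in> cd x \<rightarrow> dm x" "K (cd x) (dm x) g" "\<forall>a\<in>dm x. fn x (g (fn x a)) = fn x a"
      using reg[of "dm x" "cd x" "fn x"] x f unfolding M by auto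
    let ?x = "(cd x, restrict g (cd x), dm x)"
    have "K (cd x) (dm x) (restrict g (cd x))" using g(2) by (rule cong[rotated]) simp
    then have "?x \<in> M" using x g(1) unfolding M by auto
    moreover have "fn x (fn ?x (fn x a)) = fn x a" if "a \<in> dm x" for a
      using g(3) funcset_mem[OF f that] that by simp
    ultimately show ?thesis by (intro bexI[of _ ?x]) simp_all
  qed
  show "(A, f, B) \<in> M" if "A \<in> C" "B \<in> C" "f \<in> A \<rightarrow>\<^sub>E B" "mono_rel A (ord A) (ord B) f" for A B f
    using that mono unfolding M by simp
qed (use C M in auto)

lemma trans_cat_carrier: "x \<in> carrier (trans_cat C) \<longleftrightarrow> dm x \<in> C \<and> cd x \<in> C \<and> fn x \<in> dm x \<rightarrow>\<^sub>E cd x"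
  by (cases x) (simp add: trans_cat_def)

text \<open>Reversing maps are treated as preserving maps into the converse order, so the results on
  lists and rotations cover all four notions.\<close>

lemma orientation_characterizations:
  assumes C: "\<forall>A\<in>C. finite A \<and> A \<noteq> {} \<and> linear_order_on A (ord A)"
    and x: "x \<in> carrier (trans_cat C)"
  shows "order_preserving ord x \<longleftrightarrow> mono_rel (dm x) (ord (dm x)) (ord (cd x)) (fn x)"
    "order_reversing ord x \<longleftrightarrow> mono_rel (dm x) (ord (dm x)) ((ord (cd x))\<inverse>) (fn x)"
    "orientation_preserving ord x \<longleftrightarrow> (\<exists>L. cut_mono (dm x) (ord (dm x)) L (ord (cd x)) (fn x))"
    "orientation_reversing ord x \<longleftrightarrow> (\<exists>L. cut_mono (dm x) (ord (dm x)) L ((ord (cd x))\<inverse>) (fn x))"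
proof -
  obtain A f B where xe: "x = (A, f, B)" by (cases x)
  have A: "finite A" "A \<noteq> {}" "linear_order_on A (ord A)" and B: "linear_order_on B (ord B)" "linear_order_on B ((ord B)\<inverse>)"
    and f: "f ` A \<subseteq> B"
    using x C unfolding trans_cat_carrier xe by auto
  note xs = enumeration[where ord = ord, OF A(3,1)]
  show "order_preserving ord x \<longleftrightarrow> mono_rel (dm x) (ord (dm x)) (ord (cd x)) (fn x)"
    using sorted_map_iff[OF A(3) B(1) xs(3), of f] xs(1) f by (simp add: xe)
  show "order_reversing ord x \<longleftrightarrow> mono_rel (dm x) (ord (dm x)) ((ord (cd x))\<inverse>) (fn x)"
    using sorted_map_iff[OF A(3) B(2) xs(3), of f] xs(1) f by (simp add: xe)
  show "orientation_preserving ord x \<longleftrightarrow> (\<exists>L. cut_mono (dm x) (ord (dm x)) L (ord (cd x)) (fn x))"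
    using sorted_rotate_iff[OF A(3) B(1) A(1,2) xs f] by (simp add: xe)
  show "orientation_reversing ord x \<longleftrightarrow> (\<exists>L. cut_mono (dm x) (ord (dm x)) L ((ord (cd x))\<inverse>) (fn x))"
    using sorted_rotate_iff[OF A(3) B(2) A(1,2) xs f] by (simp add: xe)
qed

lemma cut_mono_cong: "(\<And>a. a \<in> A \<Longrightarrow> f a = g a) \<Longrightarrow> cut_mono A R L S f \<longleftrightarrow> cut_mono A R L S g"
  by (simp add: cut_mono_def)

text \<open>The regular inverse can be chosen of the same kind as the map, and two reversals compose
  to a preserving map, so the unions with reversing maps satisfy the same closure
  properties.\<close>

lemma order_category_subcat:
  assumes C: "C \<noteq> {}" "\<forall>A\<in>C. finite A \<and> A \<noteq> {} \<and> linear_order_on A (ord A)"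
    and Q: "Q \<in> {P_plus C ord, P_pm C ord, A_plus C ord, A_pm C ord}"
  obtains M where "trans_subcat C ord M" "Q = restrict_to (trans_cat C) M"
proof -
  note char = orientation_characterizations[OF C(2)]
  have fin: "finite A" "A \<noteq> {}" if "A \<in> C" for A using C(2) that by auto
  have lin: "linear_order_on A (ord A)" "linear_order_on A ((ord A)\<inverse>)" if "A \<in> C" for A using C(2) that by auto
  define P where "P A B f \<longleftrightarrow> mono_rel A (ord A) (ord B) f" for A B f
  define P' where "P' A B f \<longleftrightarrow> mono_rel A (ord A) ((ord B)\<inverse>) f" for A B f
  define V where "V A B f \<longleftrightarrow> (\<exists>L. cut_mono A (ord A) L (ord B) f)" for A B f
  define V' where "V' A B f \<longleftrightarrow> (\<exists>L. cut_mono A (ord A) L ((ord B)\<inverse>) f)" for A B f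
  note defs = P_def P'_def V_def V'_def
  have cong: "P A B f \<Longrightarrow> P A B g" "P' A B f \<Longrightarrow> P' A B g" "V A B f \<Longrightarrow> V A B g" "V' A B f \<Longrightarrow> V' A B g"
    if "\<forall>a\<in>A. f a = g a" for A B f g
    using mono_rel_cong[of A f g] cut_mono_cong[of A f g] that unfolding defs by simp_all
  have PO: "P A B f \<Longrightarrow> V A B f" for A B f
    unfolding defs using cut_mono_empty by metis
  have Pc: "P A B f \<Longrightarrow> P B D g \<Longrightarrow> P A D (g \<circ> f)" "P A B f \<Longrightarrow> P' B D g \<Longrightarrow> P' A D (g \<circ> f)"
    "P' A B f \<Longrightarrow> P B D g \<Longrightarrow> P' A D (g \<circ> f)" "P' A B f \<Longrightarrow> P' B D g \<Longrightarrow> P A D (g \<circ> f)"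
    if "f \<in> A \<rightarrow> B" for A B D f g
    using that mono_rel_comp[OF _ _ that] mono_rel_converse[of B "ord B" "ord D" g]
      mono_rel_converse_left[of B "ord B" "ord D" g] unfolding defs by metis+
  \<comment> \<open>After a reversing map the second map is read between converse orders; it is
    again monotone up to a cut.\<close>
  have conv: "\<exists>L. cut_mono B (R\<inverse>) L (S\<inverse>) g" if "\<exists>L. cut_mono B R L S g" for B R S and g :: "'a \<Rightarrow> 'a"
    using that cut_mono_converse by metis
  have Oc: "V A B f \<Longrightarrow> V B D g \<Longrightarrow> V A D (g \<circ> f)" "V A B f \<Longrightarrow> V' B D g \<Longrightarrow> V' A D (g \<circ> f)"
    "V' A B f \<Longrightarrow> V B D g \<Longrightarrow> V' A D (g \<circ> f)" "V' A B f \<Longrightarrow> V' B D g \<Longrightarrow> V A D (g \<circ> f)"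
    if AB: "A \<in> C" "B \<in> C" and f: "f \<in> A \<rightarrow> B" for A B D f g
  proof -
    note c1 = cut_mono_comp[OF lin(1)[OF AB(1)] lin(1)[OF AB(2)] f]
      and c2 = cut_mono_comp[OF lin(1)[OF AB(1)] lin(2)[OF AB(2)] f]
    show "V A B f \<Longrightarrow> V B D g \<Longrightarrow> V A D (g \<circ> f)" unfolding defs using c1 by metis
    show "V A B f \<Longrightarrow> V' B D g \<Longrightarrow> V' A D (g \<circ> f)" unfolding defs using c1 by metis
    show "V' A B f \<Longrightarrow> V B D g \<Longrightarrow> V' A D (g \<circ> f)"
      unfolding defs using c2 conv[of B "ord B" "ord D" g] by metis
    show "V' A B f \<Longrightarrow> V' B D g \<Longrightarrow> V A D (g \<circ> f)"
      unfolding defs using c2 conv[of B "ord B" "(ord D)\<inverse>" g] by (metis converse_converse)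
  qed
  have Pr: "\<exists>g\<in>B \<rightarrow> A. P B A g \<and> (\<forall>a\<in>A. f (g (f a)) = f a)" if "A \<in> C" "B \<in> C" "f \<in> A \<rightarrow> B" "P A B f" for A B f
    using mono_rel_regular[OF lin(1)[OF that(1)] lin(1)[OF that(2)] fin[OF that(1)] that(3)] that(4) unfolding defs by metis
  have Pr': "\<exists>g\<in>B \<rightarrow> A. P' B A g \<and> (\<forall>a\<in>A. f (g (f a)) = f a)" if "A \<in> C" "B \<in> C" "f \<in> A \<rightarrow> B" "P' A B f" for A B f
    using mono_rel_regular[OF lin(1)[OF that(1)] lin(2)[OF that(2)] fin[OF that(1)] that(3)] that(4)
    unfolding defs mono_rel_converse_left by metis
  have Or: "\<exists>g\<in>B \<rightarrow> A. V B A g \<and> (\<forall>a\<in>A. f (g (f a)) = f a)" if "A \<in> C" "B \<in> C" "f \<in> A \<rightarrow> B" "V A B f" for A B f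
    using cut_mono_regular[OF lin(1)[OF that(1)] lin(1)[OF that(2)] fin[OF that(1)] that(3)] that(4) unfolding defs by metis
  have Or': "\<exists>g\<in>B \<rightarrow> A. V' B A g \<and> (\<forall>a\<in>A. f (g (f a)) = f a)" if "A \<in> C" "B \<in> C" "f \<in> A \<rightarrow> B" "V' A B f" for A B f
    using cut_mono_regular[OF lin(1)[OF that(1)] lin(2)[OF that(2)] fin[OF that(1)] that(3)] that(4)
      conv[of B "(ord B)\<inverse>" "ord A"] unfolding defs by (metis converse_converse)
  from Q consider "Q = P_plus C ord" | "Q = P_pm C ord" | "Q = A_plus C ord" | "Q = A_pm C ord" by auto
  then show thesis
  proof cases
    case 1
    have "trans_subcat C ord {x \<in> carrier (trans_cat C). order_preserving ord x}"
    proof (rule trans_subcatI[OF C, where K = P])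
      show "x \<in> {x \<in> carrier (trans_cat C). order_preserving ord x} \<longleftrightarrow>
        dm x \<in> C \<and> cd x \<in> C \<and> fn x \<in> dm x \<rightarrow>\<^sub>E cd x \<and> P (dm x) (cd x) (fn x)" for x
        using char(1)[of x] unfolding defs mem_Collect_eq trans_cat_carrier by blast
      show "P A B g" if "\<forall>a\<in>A. f a = g a" "P A B f" for A B f g by (rule cong(1)[OF that])
      show "P A B f" if "mono_rel A (ord A) (ord B) f" for A B f using that by (simp add: defs)
      show "P A D (g \<circ> f)" if "f \<in> A \<rightarrow> B" "P A B f" "P B D g" for A B D f g using Pc(1) that by blast
    qed (rule Pr)
    then show thesis using that 1 unfolding P_plus_def by blast
  next
    case 2
    have "trans_subcat C ord {x \<in> carrier (trans_cat C). order_preserving ord x \<or> order_reversing ord x}"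
    proof (rule trans_subcatI[OF C, where K = "\<lambda>A B f. P A B f \<or> P' A B f"])
      show "x \<in> {x \<in> carrier (trans_cat C). order_preserving ord x \<or> order_reversing ord x} \<longleftrightarrow>
        dm x \<in> C \<and> cd x \<in> C \<and> fn x \<in> dm x \<rightarrow>\<^sub>E cd x \<and> (P (dm x) (cd x) (fn x) \<or> P' (dm x) (cd x) (fn x))" for x
        using char(1,2)[of x] unfolding defs mem_Collect_eq trans_cat_carrier by blast
      show "P A B g \<or> P' A B g" if "\<forall>a\<in>A. f a = g a" "P A B f \<or> P' A B f" for A B f g
        using cong(1,2)[OF that(1)] that(2) by metis
      show "P A B f \<or> P' A B f" if "mono_rel A (ord A) (ord B) f" for A B f using that by (simp add: defs)
      show "P A D (g \<circ> f) \<or> P' A D (g \<circ> f)" if "f \<in> A \<rightarrow> B" "P A B f \<or> P' A B f" "P B D g \<or> P' B D g" for A B D f g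
        using that(2,3) Pc[OF that(1)] by (elim disjE) blast+
      show "\<exists>g\<in>B \<rightarrow> A. (P B A g \<or> P' B A g) \<and> (\<forall>a\<in>A. f (g (f a)) = f a)"
        if "A \<in> C" "B \<in> C" "f \<in> A \<rightarrow> B" "P A B f \<or> P' A B f" for A B f
        using that(4) Pr[OF that(1-3)] Pr'[OF that(1-3)] by (elim disjE) (blast, blast)
    qed
    then show thesis using that 2 unfolding P_pm_def by blast
  next
    case 3
    have "trans_subcat C ord {x \<in> carrier (trans_cat C). orientation_preserving ord x}"
    proof (rule trans_subcatI[OF C, where K = V])
      show "x \<in> {x \<in> carrier (trans_cat C). orientation_preserving ord x} \<longleftrightarrow>
        dm x \<in> C \<and> cd x \<in> C \<and> fn x \<in> dm x \<rightarrow>\<^sub>E cd x \<and> V (dm x) (cd x) (fn x)" for x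
        using char(3)[of x] unfolding defs mem_Collect_eq trans_cat_carrier by blast
      show "V A B g" if "\<forall>a\<in>A. f a = g a" "V A B f" for A B f g by (rule cong(3)[OF that])
      show "V A B f" if "mono_rel A (ord A) (ord B) f" for A B f using that PO unfolding P_def by blast
      show "V A D (g \<circ> f)" if "A \<in> C" "B \<in> C" "f \<in> A \<rightarrow> B" "V A B f" "V B D g" for A B D f g using Oc(1) that by blast
    qed (rule Or)
    then show thesis using that 3 unfolding A_plus_def by blast
  next
    case 4
    have "trans_subcat C ord {x \<in> carrier (trans_cat C). orientation_preserving ord x \<or> orientation_reversing ord x}"
    proof (rule trans_subcatI[OF C, where K = "\<lambda>A B f. V A B f \<or> V' A B f"])
      show "x \<in> {x \<in> carrier (trans_cat C). orientation_preserving ord x \<or> orientation_reversing ord x} \<longleftrightarrow>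
        dm x \<in> C \<and> cd x \<in> C \<and> fn x \<in> dm x \<rightarrow>\<^sub>E cd x \<and> (V (dm x) (cd x) (fn x) \<or> V' (dm x) (cd x) (fn x))" for x
        using char(3,4)[of x] unfolding defs mem_Collect_eq trans_cat_carrier by blast
      show "V A B g \<or> V' A B g" if "\<forall>a\<in>A. f a = g a" "V A B f \<or> V' A B f" for A B f g
        using cong(3,4)[OF that(1)] that(2) by metis
      show "V A B f \<or> V' A B f" if "mono_rel A (ord A) (ord B) f" for A B f using that PO unfolding P_def by blast
      show "V A D (g \<circ> f) \<or> V' A D (g \<circ> f)"
        if "A \<in> C" "B \<in> C" "f \<in> A \<rightarrow> B" "V A B f \<or> V' A B f" "V B D g \<or> V' B D g" for A B D f g
        using that(4,5) Oc[OF that(1-3)] by (elim disjE) blast+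
      show "\<exists>g\<in>B \<rightarrow> A. (V B A g \<or> V' B A g) \<and> (\<forall>a\<in>A. f (g (f a)) = f a)"
        if "A \<in> C" "B \<in> C" "f \<in> A \<rightarrow> B" "V A B f \<or> V' A B f" for A B f
        using that(4) Or[OF that(1-3)] Or'[OF that(1-3)] by (elim disjE) (blast, blast)
    qed
    then show thesis using that 4 unfolding A_pm_def by blast
  qed
qed

theorem theorem5p9:
  fixes C :: "'a set set"
    and ord :: "'a set \<Rightarrow> 'a rel"
    and Q :: "('a morphism, 'a set) psemigroup"
    and G :: "nat \<Rightarrow> 'a morphism set"
  assumes "C \<noteq> {}"
    and "\<And>A. A \<in> C \<Longrightarrow> finite A \<and> A \<noteq> {}"
    and "\<And>A. A \<in> C \<Longrightarrow> linear_order_on A (ord A)"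
    and "Q \<in> {P_plus C ord, P_pm C ord, A_plus C ord, A_pm C ord}"
    and "\<And>q. 1 \<le> q \<Longrightarrow> enat q < xi C \<Longrightarrow> group_H_class Q (G q) \<and> G q \<subseteq> rank_class Q q"
  shows
    "(minimal_ideal Q (rank_ideal Q 1) \<and> (\<forall>J. minimal_ideal Q J \<longrightarrow> J = rank_ideal Q 1)) \<and>
     (\<exists>(X :: 'a set \<Rightarrow> 'a set set) (Y :: 'a set \<Rightarrow> ('a set \<times> 'a) set) \<phi>.
        band_data C X Y \<and>
        psemigroup_iso (rank_psemigroup Q 1) (partial_rect_band C X Y) \<phi> \<and>
        Cong (rank_psemigroup Q 1) =
          {pullback_rel (rank_ideal Q 1) \<phi> (band_cong C X Y E1 E2) | E1 E2.
             \<forall>A\<in>C. E1 A \<in> Eq (X A) \<and> E2 A \<in> Eq (Y A)}) \<and>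
     lattice_isomorphic (cong_lattice (rank_psemigroup Q 1)) (prod_Eq_lattice C) \<and>
     (\<forall>r :: enat. 2 \<le> r \<and> (r < xi C \<or> r = \<infinity> \<and> xi C = \<infinity>) \<longrightarrow>
        Cong (rank_psemigroup Q r) =
          {diag_cong (rank_psemigroup Q r)} \<union>
          {rees_nu_cong (rank_psemigroup Q r) (rank_ideal Q (enat q)) (rank_class Q (q + 1)) N | q N.
             1 \<le> q \<and> enat q < r \<and> N \<lhd> class_group Q (G (q + 1))} \<union>
          {univ_cong (rank_psemigroup Q r)})"
proof -
  obtain M where "trans_subcat C ord M" and Q: "Q = restrict_to (trans_cat C) M"
    using order_category_subcat[of C ord Q] assms(1-4) by blast
  then interpret trans_subcat C ord M by simp
  have restrict: "restrict_to (restrict_to S I) J = restrict_to S J" for S :: "('a morphism, 'a set) psemigroup" and I J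
    by simp
  note unf = Q rank_ideal_Q restrict
  have ideal: "minimal_ideal Q (rank_ideal Q 1) \<and> (\<forall>J. minimal_ideal Q J \<longrightarrow> J = rank_ideal Q 1)"
    unfolding unf minimal_ideal_iff by simp
  have classification: "Cong (rank_psemigroup Q r) = {diag_cong (rank_psemigroup Q r)} \<union>
      {rees_nu_cong (rank_psemigroup Q r) (rank_ideal Q (enat q)) (rank_class Q (q + 1)) N | q N.
         1 \<le> q \<and> enat q < r \<and> N \<lhd> class_group Q (G (q + 1))} \<union> {univ_cong (rank_psemigroup Q r)}"
    if r: "2 \<le> r \<and> (r < xi C \<or> r = \<infinity> \<and> xi C = \<infinity>)" for r
  proof -
    \<comment> \<open>Group classes are supplied below \<open>xi C\<close>. As q is finite, the case
      r = \<open>xi C\<close> = \<infinity> is covered too.\<close>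
    have "enat q < xi C" if "enat q \<le> r" for q using r that by auto
    then have G: "group_H_class Q (G q) \<and> G q \<subseteq> rank_class Q q" if "1 \<le> q" "enat q \<le> r" for q
      using assms(5) that by simp
    show ?thesis
      unfolding unf by (rule Cong_Qr_classification[OF conjunct1[OF r] G[unfolded Q], folded rank_ideal_Q, unfolded unf])
  qed
  show ?thesis
    unfolding unf
    by (rule conjI[OF ideal[unfolded unf] conjI[OF ex_partial_rect_band_iso conjI[OF lattice_iso_prod_Eq]]])
      (intro allI impI, rule classification[unfolded unf])
qed

end
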